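(* Assume that siblings in $\mathscr A$ have comparable measure, i.e. there is a constant $c_0>0$ such that $|A'|\ge c_0|A''|$ for all $A\in\mathscr A$. Let $(f_n)_{n\ge 0}$ be an $\ell$-sparse smartingale with respect to the Lebesgue measure $\mathbb P=|\cdot|$ having uniformly bounded differences, $|\Delta f_n|\le L$ for all $n$ and some constant $L$. Then: (i) If $\sum_k \mathbb E_k|\Delta f_k|=\infty$ (at every point of $\Omega$), then $$\liminf_{n\to\infty}\frac{f_n}{\sum_{k\le n}\mathbb E_k|\Delta f_k|}>0$$ on a set of Hausdorff dimension $d$. (ii) If $(f_n)$ is uniformly bounded, then $\sum_k\mathbb E_k|\Delta f_k|<\infty$ on a set of Hausdorff dimension $d$.
   Context: Setting. $\Omega\subset\mathbb R^d$ is a convex compact set and $\mathbb P=|\cdot|$ is $d$-dimensional Lebesgue measure on $\Omega$, normalized so that $|\Omega|=1$. $(\mathscr F_n)_{n\ge 0}$ is a filtration with $\mathscr F_0=\{\emptyset,\Omega\}$ such that for each $n\ge 1$, $\mathscr F_n$ is generated by subdividing each atom $A$ of $\mathscr F_{n-1}$ into two atoms $A',A''$ of $\mathscr F_n$ (the siblings) with $|A''|\ge|A'|>0$. $\mathscr A_n$ is the set of atoms of $\mathscr F_n$ and $\mathscr A=\bigcup_n\mathscr A_n$. Every atom is a convex set, $\max_{A\in\mathscr A_n}\operatorname{diam}A\to0$ as $n\to\infty$, and there is a constant $c_4>0$ with $w(A)\ge c_4\operatorname{diam}A$ for all $A\in\mathscr A$, where $w(A)$ is the minimal distance between two parallel supporting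 hyperplanes of $A$. $\mathbb E_n$ is conditional expectation with respect to $\mathscr F_n$ and Lebesgue measure. $S$ is a finite-dimensional vector space of real polynomials on $\Omega$ containing the constant function $1$; $S^2=\operatorname{span}\{g_1g_2:g_1,g_2\in S\}$. $S_n$ is the space of functions $f:\Omega\to\mathbb R$ such that for each $A\in\mathscr A_n$ there is $g\in S$ with $f=g$ on $A$. $P_n$ is the orthogonal projection onto $S_n$ in $L^2(\mathbb P)$, extended to $L^1$ (i.e. $\int_A(f-P_nf)q\,d\mathbb P=0$ for all $A\in\mathscr A_n$, $q\in S$). A sequence $(f_n)_{n\ge0}$ of integrable functions is a smartingale (with respect to $\mathbb P$) if $P_{n-1}f_n=f_{n-1}$ for all $n\ge1$; then $f_n\in S_n$. Put $\Delta f_n=f_n-f_{n-1}$ for $n\ge1$. Sparsity. A smartingale is $\nu$-sparse if $\Delta f_n\ne0$ and $\Delta f_m\neq 0$ imply $n=m$ or $|n-m|\ge\nu+1$. The integer $\ell$. Since siblings have comparable measure there exists an integer $\ell_0\ge0$ such that for every $k\ge\ell_0$ there is $c>0$ with $\sum_{B\in\mathscr A_{j+k},B\subseteq A}|\int_Bu\,d\mathbb P|\ge c\int_A|u|\,d\mathbb P$ for all $j\ge0$, $A\in\mathscr A_j$, $u\in S^2$. Such an $\ell_0$ is fixed, and $\ell$ is the smallest integer with $\ell\ge\ell_0$ and $2^{\ell+1}\ge\dim S+\dim S^2$. *)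

theory Defs
  imports "HOL-Probability.Probability" "HOL-Library.Function_Algebras"
begin

text \<open>Real functions on a type form a real vector space under the pointwise operations.  This makes
  \<^const>\<open>span\<close> and \<^const>\<open>dim\<close> available for spaces of functions.\<close>

instantiation "fun" :: (type, real_vector) real_vector
begin

definition scaleR_fun :: "real \<Rightarrow> ('a \<Rightarrow> 'b) \<Rightarrow> 'a \<Rightarrow> 'b"
  where "scaleR_fun c f = (\<lambda>x. c *\<^sub>R f x)"

instance
  by standard (auto simp: scaleR_fun_def fun_eq_iff scaleR_add_right scaleR_add_left)

end

section \<open>Hausdorff dimension\<close>

text \<open>The power diam(U)^s, with the conventions diam({})^s = 0 and diam(U)^0 = 1 for nonempty U
  (note that \<^term>\<open>(0::real) powr 0 = 0\<close> in the library).\<close>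

definition diam_power :: "real \<Rightarrow> 'a::metric_space set \<Rightarrow> ennreal" where
  "diam_power s U = (if U = {} then 0 else if s = 0 then 1 else ennreal (diameter U powr s))"

text \<open>Boundedness of the covering sets is required since \<^const>\<open>diameter\<close> is meaningful only for
  bounded sets.\<close>

definition hausdorff_content :: "real \<Rightarrow> real \<Rightarrow> 'a::metric_space set \<Rightarrow> ennreal" where
  "hausdorff_content s \<delta> E =
     (INF U \<in> {U :: nat \<Rightarrow> 'a set. E \<subseteq> (\<Union>i. U i) \<and> (\<forall>i. bounded (U i) \<and> diameter (U i) \<le> \<delta>)}.
        \<Sum>i. diam_power s (U i))"

definition hausdorff_measure :: "real \<Rightarrow> 'a::metric_space set \<Rightarrow> ennreal" where
  "hausdorff_measure s E = (SUP \<delta>\<in>{0<..}. hausdorff_content s \<delta> E)"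

definition hausdorff_dim :: "'a::metric_space set \<Rightarrow> ereal" where
  "hausdorff_dim E = (INF s\<in>{s. 0 \<le> s \<and> hausdorff_measure s E = 0}. ereal s)"

section \<open>Width of a convex set\<close>

definition supporting_hyperplane :: "'a::euclidean_space set \<Rightarrow> 'a set \<Rightarrow> bool" where
  "supporting_hyperplane A H \<longleftrightarrow>
     (\<exists>u c. u \<noteq> 0 \<and> H = {x. u \<bullet> x = c} \<and> (\<forall>x\<in>A. u \<bullet> x \<le> c) \<and> H \<inter> closure A \<noteq> {})"

definition width :: "'a::euclidean_space set \<Rightarrow> real" where
  "width A = Inf {setdist H K | H K. supporting_hyperplane A H \<and> supporting_hyperplane A K
                    \<and> affine_parallel H K \<and> H \<noteq> K}"

section \<open>Atoms and binary subdivision\<close>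

text \<open>As in the library's locale \<^locale>\<open>filtration\<close>, a sigma-algebra is represented by a value of
  type \<^typ>\<open>'a measure\<close> of which only the space and the measurable sets matter.\<close>

definition atoms :: "'a measure \<Rightarrow> 'a set set" where
  "atoms G = {A \<in> sets G. A \<noteq> {} \<and> (\<forall>B\<in>sets G. B \<subseteq> A \<longrightarrow> B = {} \<or> B = A)}"

definition siblings :: "'a::euclidean_space measure \<Rightarrow> 'a set \<Rightarrow> 'a set \<Rightarrow> 'a set \<Rightarrow> bool" where
  "siblings G A A' A'' \<longleftrightarrow>
     A' \<in> atoms G \<and> A'' \<in> atoms G \<and> A' \<union> A'' = A \<and> A' \<inter> A'' = {} \<and>
     measure lebesgue A'' \<ge> measure lebesgue A' \<and> measure lebesgue A' > 0"

definition binary_filtration :: "'a::euclidean_space set \<Rightarrow> (nat \<Rightarrow> 'a measure) \<Rightarrow> bool" where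
  "binary_filtration \<Omega> F \<longleftrightarrow>
     filtration \<Omega> F \<and> sets (F 0) = {{}, \<Omega>} \<and>
     (\<forall>n. sets (F (Suc n)) = sigma_sets \<Omega> (atoms (F (Suc n)))) \<and>
     (\<forall>n. \<forall>A\<in>atoms (F n). \<exists>A' A''. siblings (F (Suc n)) A A' A'')"

text \<open>The conditional expectation given \<open>F n\<close> under Lebesgue measure on \<open>\<Omega>\<close>.  It is \<open>F n\<close>-measurable,
  hence constant on atoms; as the atoms have positive measure, its value at every point of \<open>\<Omega>\<close>
  (not only almost everywhere) is the average of the function over the atom containing the point.\<close>

definition cexp ::
  "'a::euclidean_space set \<Rightarrow> (nat \<Rightarrow> 'a measure) \<Rightarrow> nat \<Rightarrow> ('a \<Rightarrow> real) \<Rightarrow> 'a \<Rightarrow> real" where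
  "cexp \<Omega> F n g = real_cond_exp (lebesgue_on \<Omega>) (F n) g"

section \<open>Smartingales\<close>

text \<open>\<open>S\<close> is a set of polynomial functions on the whole space.  As \<open>\<Omega>\<close> is convex of positive measure,
  a polynomial is determined by its restriction to \<open>\<Omega>\<close>, so linear spans and dimensions are the same
  as for the restrictions.\<close>

definition square_space :: "('a \<Rightarrow> real) set \<Rightarrow> ('a \<Rightarrow> real) set" where
  "square_space S = span {(\<lambda>x. g1 x * g2 x) | g1 g2. g1 \<in> S \<and> g2 \<in> S}"

definition piecewise_space :: "'a measure \<Rightarrow> ('a \<Rightarrow> real) set \<Rightarrow> ('a \<Rightarrow> real) set" where
  "piecewise_space G S = {f. \<forall>A\<in>atoms G. \<exists>g\<in>S. \<forall>x\<in>A. f x = g x}"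

text \<open>\<open>h\<close> is the projection of the integrable function \<open>f\<close> onto the space of functions that are
  piecewise in \<open>S\<close>.  This determines \<open>h\<close> uniquely at every point of \<open>\<Omega>\<close>; values outside \<open>\<Omega>\<close>
  are irrelevant throughout.\<close>

definition is_projection ::
  "'a::euclidean_space measure \<Rightarrow> ('a \<Rightarrow> real) set \<Rightarrow> ('a \<Rightarrow> real) \<Rightarrow> ('a \<Rightarrow> real) \<Rightarrow> bool" where
  "is_projection G S f h \<longleftrightarrow>
     h \<in> piecewise_space G S \<and>
     (\<forall>A\<in>atoms G. \<forall>q\<in>S. (LINT x:A|lebesgue. (f x - h x) * q x) = 0)"

definition smartingale ::
  "'a::euclidean_space set \<Rightarrow> (nat \<Rightarrow> 'a measure) \<Rightarrow> ('a \<Rightarrow> real) set \<Rightarrow> (nat \<Rightarrow> 'a \<Rightarrow> real) \<Rightarrow> bool"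
  where
  "smartingale \<Omega> F S f \<longleftrightarrow>
     (\<forall>n. integrable (lebesgue_on \<Omega>) (f n)) \<and>
     (\<forall>n\<ge>1. is_projection (F (n - 1)) S (f n) (f (n - 1)))"

text \<open>Only used for \<open>n \<ge> 1\<close>.\<close>

definition increment :: "(nat \<Rightarrow> 'a \<Rightarrow> real) \<Rightarrow> nat \<Rightarrow> 'a \<Rightarrow> real" where
  "increment f n x = f n x - f (n - 1) x"

definition nu_sparse :: "'a set \<Rightarrow> nat \<Rightarrow> (nat \<Rightarrow> 'a \<Rightarrow> real) \<Rightarrow> bool" where
  "nu_sparse \<Omega> \<nu> f \<longleftrightarrow>
     (\<forall>n\<ge>1. \<forall>m\<ge>1. (\<exists>x\<in>\<Omega>. increment f n x \<noteq> 0) \<and> (\<exists>x\<in>\<Omega>. increment f m x \<noteq> 0) \<longrightarrow>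
        n = m \<or> \<bar>int n - int m\<bar> \<ge> int \<nu> + 1)"

definition sign_resolving ::
  "(nat \<Rightarrow> 'a::euclidean_space measure) \<Rightarrow> ('a \<Rightarrow> real) set \<Rightarrow> nat \<Rightarrow> bool" where
  "sign_resolving F S k \<longleftrightarrow>
     (\<exists>c>0. \<forall>j. \<forall>A\<in>atoms (F j). \<forall>u\<in>square_space S.
        (\<Sum>B\<in>{B \<in> atoms (F (j + k)). B \<subseteq> A}. \<bar>LINT x:B|lebesgue. u x\<bar>)
          \<ge> c * (LINT x:A|lebesgue. \<bar>u x\<bar>))"

definition sparsity_index :: "('a \<Rightarrow> real) set \<Rightarrow> nat \<Rightarrow> nat" where
  "sparsity_index S l0 = (LEAST l. l \<ge> l0 \<and> 2 ^ (l + 1) \<ge> dim S + dim (square_space S))"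

end

(*
  The sparsity of the smartingale leaves l further levels on which a step function phi_k with
  |phi_k| <= 1 can be built that annihilates S^2 on every atom of level k and turns the orthogonality
  of Df_k to S into (phi_k Df_k, q) = rho_k (1, q), where rho_k dominates the mean of |Df_k|.  Here the
  Remez inequality and the sign resolving property are used.  With the weights
  W_n = prod_{k<n} (1 + eps phi_k) the drift of f is M_n = sum_{k<n} eps rho_k, and the series
  G_n = sum_{k<n} (Df_k - eps rho_k) / (1 + M_{k+1}) is bounded in L^2 with respect to W_n.  Hence
  it converges along all branches of the tree of atoms outside a set of small mass for
  the measure with densities W_n, and by Kronecker's lemma f_n / (1 + M_n) tends to 1 or M_n is bounded
  there.  As W_n <= (1 + eps)^n, the mass of an atom A is at most |A|^{s/d} for small eps, and the mass
  distribution principle shows that the set of convergence has positive s-dimensional Hausdorff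
  measure.  The principle is applied to families of atoms, so that no limit measure is needed.
*)
theory Submission
  imports Defs
begin

section \<open>A Remez inequality on convex sets\<close>

text \<open>Passing from \<open>W n\<close> to \<open>W (Suc n)\<close> must preserve local
  integrals of squares such as \<open>(G n x - G m x)\<^sup>2\<close>, which are piecewise in
  \<open>S2\<close>; so the multipliers annihilate \<open>S2\<close> and not only \<open>S\<close>.
  They live \<open>l\<close> levels below the increment they belong to. Sparsity makes this
  harmless: at the next active index all earlier factors are constant on atoms, and the weight
  leaves every local integral as a constant. Damping by \<open>1 + M (Suc k) x\<close> needs no
  knowledge of how fast the drift grows: the energy of a step is at most a multiple of
  \<open>1 / (1 + M k x) - 1 / (1 + M (Suc k) x)\<close>, which telescopes. Energy bounds are
  integral bounds, whereas a point must be found. The Remez inequality bridges this: a polynomial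
  that is large at one point of an atom already costs energy in proportion to the whole mass of the
  atom, so the atom can be discarded entirely. The parameter \<open>\<epsilon>\<close> depends on
  \<open>s\<close>, and so do multipliers, weights and drift. The sets in the theorem depend on none
  of them and contain a convergence set for every \<open>s\<close> below the dimension.\<close>

definition line_poly :: "nat \<Rightarrow> ('a::real_vector \<Rightarrow> real) \<Rightarrow> bool" where
  "line_poly N p \<longleftrightarrow> (\<forall>x y. \<exists>P::real poly. degree P \<le> N \<and> (\<forall>t. p (x + t *\<^sub>R y) = poly P t))"

lemma line_poly_mono: "line_poly N p \<Longrightarrow> N \<le> M \<Longrightarrow> line_poly M p"
  unfolding line_poly_def by (meson order_trans)

lemma line_poly_const: "line_poly N (\<lambda>x. c)"
  unfolding line_poly_def by (intro allI exI[of _ "[:c:]"]) auto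

lemma line_poly_add:
  assumes "line_poly N p" "line_poly N q"
  shows "line_poly N (\<lambda>x. p x + q x)"
  unfolding line_poly_def
proof (intro allI)
  fix x y
  obtain P Q where "degree P \<le> N" "\<forall>t. p (x + t *\<^sub>R y) = poly P t"
    "degree Q \<le> N" "\<forall>t. q (x + t *\<^sub>R y) = poly Q t"
    using assms unfolding line_poly_def by meson
  then show "\<exists>P. degree P \<le> N \<and> (\<forall>t. p (x + t *\<^sub>R y) + q (x + t *\<^sub>R y) = poly P t)"
    by (intro exI[of _ "P + Q"]) (auto intro: degree_add_le)
qed

lemma line_poly_mult:
  assumes "line_poly N p" "line_poly M q"
  shows "line_poly (N + M) (\<lambda>x. p x * q x)"
  unfolding line_poly_def
proof (intro allI)
  fix x y
  obtain P Q where PQ: "degree P \<le> N" "\<forall>t. p (x + t *\<^sub>R y) = poly P t"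
    "degree Q \<le> M" "\<forall>t. q (x + t *\<^sub>R y) = poly Q t"
    using assms unfolding line_poly_def by meson
  have "degree (P * Q) \<le> N + M"
    using PQ by (meson add_mono degree_mult_le order_trans)
  then show "\<exists>P. degree P \<le> N + M \<and> (\<forall>t. p (x + t *\<^sub>R y) * q (x + t *\<^sub>R y) = poly P t)"
    using PQ by (intro exI[of _ "P * Q"]) auto
qed

lemma line_poly_cmult:
  assumes "line_poly N p"
  shows "line_poly N (\<lambda>x. c * p x)"
  using line_poly_mult[OF line_poly_const[of 0 c] assms] by simp

lemma real_polynomial_function_line_poly:
  "real_polynomial_function p \<Longrightarrow> \<exists>N. line_poly N p"
proof (induction rule: real_polynomial_function.induct)
  case (linear f)
  interpret bounded_linear f by fact
  have "line_poly 1 f"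
    unfolding line_poly_def
  proof (intro allI)
    fix x y
    show "\<exists>P. degree P \<le> 1 \<and> (\<forall>t. f (x + t *\<^sub>R y) = poly P t)"
      by (intro exI[of _ "[:f x, f y:]"]) (auto simp: add scaleR)
  qed
  then show ?case by blast
next
  case (const c)
  then show ?case using line_poly_const by blast
next
  case (add f g)
  then obtain N M where "line_poly N f" "line_poly M g" by blast
  then have "line_poly (max N M) (\<lambda>x. f x + g x)"
    by (intro line_poly_add) (auto intro: line_poly_mono)
  then show ?case by blast
next
  case (mult f g)
  then show ?case using line_poly_mult by blast
qed

text \<open>A finite spanning set supplies one degree for the whole space, so that the Remez
  constants depend on the space only.\<close>

lemma line_poly_span:
  fixes B :: "('a::real_normed_vector \<Rightarrow> real) set"
  assumes "finite B" "\<And>g. g \<in> B \<Longrightarrow> real_polynomial_function g"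
  shows "\<exists>N. \<forall>g\<in>span B. line_poly N g"
proof -
  obtain n where n: "\<And>g. g \<in> B \<Longrightarrow> line_poly (n g) g"
    using real_polynomial_function_line_poly assms(2) by metis
  define N where "N = Max (n ` B)"
  have N: "line_poly N g" if "g \<in> B" for g
    using n[OF that] that assms(1) by (auto intro!: line_poly_mono[of "n g"] simp: N_def)
  have "line_poly N g" if "g \<in> span B" for g
    using that
  proof (induction rule: span_induct_alt)
    case base
    then show ?case using line_poly_const[of N 0] by (simp add: zero_fun_def)
  next
    case (step c x y)
    have "c *\<^sub>R x + y = (\<lambda>z. c * x z + y z)"
      by (auto simp: fun_eq_iff scaleR_fun_def)
    then show ?case
      using line_poly_add[OF line_poly_cmult[OF N[OF step(1)]] step(2)] by simp
  qed
  then show ?thesis by blast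
qed

text \<open>Induction on the degree by splitting off a linear factor at a node \<open>a\<close>: the
  quotient is at most \<open>2 / g * m\<close> on the other nodes because they keep distance
  \<open>g\<close> from \<open>a\<close>. Only the gap and the degree enter \<open>M\<close>, which
  serves for all polynomials and node sets.\<close>

lemma poly_bound_at_0:
  assumes "0 < g"
  shows "\<exists>M\<ge>0. \<forall>P::real poly. \<forall>I m. degree P \<le> N \<longrightarrow> I \<subseteq> {0..1} \<longrightarrow> finite I \<longrightarrow> N < card I
     \<longrightarrow> (\<forall>s\<in>I. \<forall>t\<in>I. s \<noteq> t \<longrightarrow> g \<le> \<bar>s - t\<bar>) \<longrightarrow> (\<forall>t\<in>I. \<bar>poly P t\<bar> \<le> m) \<longrightarrow> \<bar>poly P 0\<bar> \<le> M * m"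
proof (induction N)
  case 0
  show ?case
  proof (intro exI[of _ 1] conjI allI impI)
    fix P :: "real poly" and I m
    assume "degree P \<le> 0" "0 < card I" and m: "\<forall>t\<in>I. \<bar>poly P t\<bar> \<le> m"
    then obtain a where "a \<in> I" by (metis card.empty ex_in_conv less_irrefl)
    moreover obtain c where "P = [:c:]" using \<open>degree P \<le> 0\<close> degree_eq_zeroE le_zero_eq by blast
    ultimately show "\<bar>poly P 0\<bar> \<le> 1 * m" using m by auto
  qed auto
next
  case (Suc N)
  then obtain M where M: "M \<ge> 0" "\<And>P::real poly. \<And>I m. degree P \<le> N \<Longrightarrow> I \<subseteq> {0..1} \<Longrightarrow> finite I \<Longrightarrow> N < card I
     \<Longrightarrow> (\<forall>s\<in>I. \<forall>t\<in>I. s \<noteq> t \<longrightarrow> g \<le> \<bar>s - t\<bar>) \<Longrightarrow> (\<forall>t\<in>I. \<bar>poly P t\<bar> \<le> m) \<Longrightarrow> \<bar>poly P 0\<bar> \<le> M * m"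
    by metis
  show ?case
  proof (intro exI[of _ "1 + M * (2 / g)"] conjI allI impI)
    fix P :: "real poly" and I m
    assume P: "degree P \<le> Suc N" and I: "I \<subseteq> {0..1}" "finite I" "Suc N < card I"
      and gap: "\<forall>s\<in>I. \<forall>t\<in>I. s \<noteq> t \<longrightarrow> g \<le> \<bar>s - t\<bar>"
      and m: "\<forall>t\<in>I. \<bar>poly P t\<bar> \<le> m"
    obtain a where a: "a \<in> I" using I by (metis card.empty ex_in_conv not_less0)
    define R where "R = synthetic_div P a"
    have PR: "poly P t = (t - a) * poly R t + poly P a" for t
    proof -
      have "poly P t = poly ([:- a, 1:] * R + [:poly P a:]) t"
        unfolding R_def by (simp only: synthetic_div_correct')
      then show ?thesis by (simp add: algebra_simps)
    qed
    have m0: "0 \<le> m" using m a by (meson abs_ge_zero order_trans)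
    have "\<bar>poly R t\<bar> \<le> 2 / g * m" if t: "t \<in> I - {a}" for t
    proof -
      have ga: "g \<le> \<bar>t - a\<bar>" using gap t a by auto
      have "g * \<bar>poly R t\<bar> \<le> \<bar>t - a\<bar> * \<bar>poly R t\<bar>" using ga by (rule mult_right_mono) simp
      also have "\<dots> = \<bar>poly P t - poly P a\<bar>" using PR[of t] by (simp add: abs_mult)
      also have "\<dots> \<le> 2 * m" using m a t by (smt (verit) DiffD1)
      finally show ?thesis using assms by (simp add: field_simps)
    qed
    moreover have "degree R \<le> N" using P by (simp add: R_def degree_synthetic_div)
    moreover have "N < card (I - {a})" using I a by simp
    ultimately have "\<bar>poly R 0\<bar> \<le> M * (2 / g * m)"
      using I gap by (intro M(2)[of R "I - {a}"]) auto
    moreover have "\<bar>a\<bar> * \<bar>poly R 0\<bar> \<le> 1 * \<bar>poly R 0\<bar>"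
      using a I by (intro mult_right_mono) auto
    moreover have "\<bar>poly P 0\<bar> \<le> \<bar>a\<bar> * \<bar>poly R 0\<bar> + \<bar>poly P a\<bar>"
      using PR[of 0] by (simp add: abs_mult[symmetric])
    ultimately have "\<bar>poly P 0\<bar> \<le> M * (2 / g * m) + m" using m a by fastforce
    then show "\<bar>poly P 0\<bar> \<le> (1 + M * (2 / g)) * m" by (simp add: algebra_simps)
  qed (use M assms in auto)
qed

text \<open>With more than \<open>N\<close> small nodes the bound at 0, the parameter of
  \<open>x\<close>, would give
  \<open>\<bar>p x\<bar> \<le> M / (M + 1) * \<bar>p x\<bar>\<close>.\<close>

lemma card_small_on_line:
  assumes M: "\<forall>P::real poly. \<forall>I m. degree P \<le> N \<longrightarrow> I \<subseteq> {0..1} \<longrightarrow> finite I \<longrightarrow> N < card I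
     \<longrightarrow> (\<forall>s\<in>I. \<forall>t\<in>I. s \<noteq> t \<longrightarrow> g \<le> \<bar>s - t\<bar>) \<longrightarrow> (\<forall>t\<in>I. \<bar>poly P t\<bar> \<le> m) \<longrightarrow> \<bar>poly P 0\<bar> \<le> M * m"
    and "M \<ge> 0" and p: "line_poly N p" and T: "T \<subseteq> {0..1}" "finite T"
    and gap: "\<forall>s\<in>T. \<forall>t\<in>T. s \<noteq> t \<longrightarrow> g \<le> \<bar>s - t\<bar>"
  shows "card {t\<in>T. \<bar>p (x + t *\<^sub>R (y - x))\<bar> < 1 / (M + 1) * \<bar>p x\<bar>} \<le> N"
proof (rule ccontr)
  let ?I = "{t\<in>T. \<bar>p (x + t *\<^sub>R (y - x))\<bar> < 1 / (M + 1) * \<bar>p x\<bar>}"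
  assume "\<not> card ?I \<le> N"
  then have c: "N < card ?I" by simp
  then obtain t where t: "t \<in> ?I" by (metis (no_types, lifting) card.empty ex_in_conv not_less0)
  have pos: "0 < \<bar>p x\<bar>"
  proof (rule ccontr)
    assume "\<not> 0 < \<bar>p x\<bar>"
    then have "\<bar>p x\<bar> = 0" by simp
    then show False using t by (simp del: abs_eq_0)
  qed
  obtain P where P: "degree P \<le> N" "\<And>t. p (x + t *\<^sub>R (y - x)) = poly P t"
    using p unfolding line_poly_def by meson
  have "\<bar>poly P 0\<bar> \<le> M * (1 / (M + 1) * \<bar>p x\<bar>)"
    using T gap c by (intro M[rule_format, of P ?I, OF P(1)]) (auto simp: P(2)[symmetric])
  moreover have "p x = poly P 0" using P(2)[of 0] by simp
  ultimately have "\<bar>p x\<bar> \<le> M / (M + 1) * \<bar>p x\<bar>" by simp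
  then show False using pos \<open>M \<ge> 0\<close> by (simp add: field_simps)
qed

lemma scaling_power_near_1:
  fixes \<delta> :: real
  assumes "0 < \<delta>"
  shows "\<exists>\<tau>. 0 < \<tau> \<and> \<tau> < 1 \<and> 1 - (1 - \<tau>) ^ d \<le> \<delta>"
proof -
  have "((\<lambda>\<tau>::real. (1 - \<tau>) ^ d) \<longlongrightarrow> (1 - 0) ^ d) (at_right 0)"
    by (intro tendsto_intros)
  then have "\<forall>\<^sub>F \<tau> in at_right (0::real). 1 - \<delta> < (1 - \<tau>) ^ d"
    using assms by (intro order_tendstoD(1)) auto
  moreover have "\<forall>\<^sub>F \<tau> in at_right (0::real). \<tau> \<in> {0<..<1}"
    by (rule eventually_at_right_less[THEN eventually_mono, of 0, simplified] eventually_at_right_real) auto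
  ultimately have "\<forall>\<^sub>F \<tau> in at_right (0::real). \<tau> \<in> {0<..<1} \<and> 1 - \<delta> < (1 - \<tau>) ^ d"
    by (rule eventually_conj[rotated])
  then obtain \<tau> where "\<tau> \<in> {0<..<1} \<and> 1 - \<delta> < (1 - \<tau>) ^ d"
    by (metis (mono_tags, lifting) eventually_happens' trivial_limit_at_right_real)
  then show ?thesis by (intro exI[of _ \<tau>]) auto
qed

text \<open>The set \<open>B\<close> of small values is pulled back under \<open>K\<close>
  homotheties with centre \<open>x\<close> and ratios just below 1. Each pull-back has almost the
  measure of \<open>B\<close>, yet by the count on segments from \<open>x\<close> no point lies in
  more than \<open>N\<close> of them; double counting bounds the measure of \<open>B\<close>.
  Convexity keeps the segments inside \<open>A\<close>.\<close>

lemma remez_measure: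
  assumes "0 < \<delta>"
  shows "\<exists>\<eta>>0. \<forall>A (p::'a::euclidean_space \<Rightarrow> real) x. convex A \<longrightarrow> A \<in> lmeasurable \<longrightarrow> line_poly N p
     \<longrightarrow> continuous_on UNIV p \<longrightarrow> x \<in> A \<longrightarrow> measure lebesgue {y\<in>A. \<bar>p y\<bar> < \<eta> * \<bar>p x\<bar>} \<le> \<delta> * measure lebesgue A"
proof -
  let ?d = "DIM('a)" and ?\<mu> = "measure (lebesgue :: 'a measure)"
  obtain \<tau> :: real where \<tau>: "0 < \<tau>" "\<tau> < 1" "1 - (1 - \<tau>) ^ ?d \<le> \<delta> / 2"
    using scaling_power_near_1[of "\<delta>/2" ?d] assms by auto
  \<comment> \<open>\<open>K\<close> is so large that the \<open>N\<close> coincidences cost at most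
    half of \<open>\<delta>\<close>; the other half pays for the volume lost by the
    contractions.\<close>
  obtain K0 :: nat where "real N / (\<delta> / 2) < real K0" using reals_Archimedean2 by blast
  then have K0: "real N / (\<delta> / 2) < real (Suc K0)" by simp
  define K where "K = Suc K0"
  have K: "0 < K" "real N \<le> \<delta> / 2 * real K"
    using K0 assms unfolding K_def[symmetric] by (simp_all add: field_simps K_def)
  \<comment> \<open>The ratios lie in the interval from \<open>1 - \<tau>\<close> to 1 with spacing
    \<open>\<tau> / K\<close>, the gap required of the nodes.\<close>
  define t where "t i = 1 - \<tau> * (real i / real K)" for i
  define T where "T = t ` {1..K}"
  have t01: "0 < t i" "t i \<le> 1" "1 - \<tau> \<le> t i" if "i \<in> {1..K}" for i
  proof -
    have "real i / real K \<le> 1" using that K by auto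
    then have "\<tau> * (real i / real K) \<le> \<tau> * 1" using \<tau> by (intro mult_left_mono) auto
    then show "0 < t i" "1 - \<tau> \<le> t i" unfolding t_def using \<tau> by linarith+
    show "t i \<le> 1" unfolding t_def using \<tau> by simp
  qed
  have tgap: "\<tau> / K \<le> \<bar>t i - t j\<bar>" if "i \<noteq> j" for i j
  proof -
    have "t i - t j = (real j - real i) * (\<tau> / K)" unfolding t_def using K by (simp add: diff_divide_distrib algebra_simps)
    then have "\<bar>t i - t j\<bar> = \<bar>real j - real i\<bar> * (\<tau> / K)" using \<tau> by (simp add: abs_mult)
    moreover have "1 * (\<tau> / K) \<le> \<bar>real j - real i\<bar> * (\<tau> / K)"
      using that \<tau> by (intro mult_right_mono) auto
    ultimately show ?thesis by simp
  qed
  have "0 < \<tau> / K" using \<tau> K by simp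
  then have tinj: "inj_on t {1..K}" using tgap by (intro inj_onI) (smt (verit))
  from poly_bound_at_0[OF \<open>0 < \<tau> / K\<close>, of N] obtain M where
    M: "M \<ge> 0" "\<forall>P::real poly. \<forall>I m. degree P \<le> N \<longrightarrow> I \<subseteq> {0..1} \<longrightarrow> finite I \<longrightarrow> N < card I
     \<longrightarrow> (\<forall>s\<in>I. \<forall>t\<in>I. s \<noteq> t \<longrightarrow> \<tau> / K \<le> \<bar>s - t\<bar>) \<longrightarrow> (\<forall>t\<in>I. \<bar>poly P t\<bar> \<le> m) \<longrightarrow> \<bar>poly P 0\<bar> \<le> M * m"
    by (elim exE conjE)
  show ?thesis
  proof (intro exI[of _ "1 / (M + 1)"] conjI allI impI)
    show "0 < 1 / (M + 1)" using M by simp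
    fix A :: "'a set" and p :: "'a \<Rightarrow> real" and x :: 'a
    assume A: "convex A" "A \<in> lmeasurable" and p: "line_poly N p" "continuous_on UNIV p" and x: "x \<in> A"
    define B where "B = {y\<in>A. \<bar>p y\<bar> < 1 / (M + 1) * \<bar>p x\<bar>}"
    have op: "open {y. \<bar>p y\<bar> < 1 / (M + 1) * \<bar>p x\<bar>}"
      using p(2) by (intro open_Collect_less continuous_intros) auto
    have B: "B \<in> lmeasurable"
    proof -
      have "B = A \<inter> {y. \<bar>p y\<bar> < 1 / (M + 1) * \<bar>p x\<bar>}" by (auto simp: B_def)
      then show ?thesis using A op by (auto intro!: fmeasurable_Int_fmeasurable)
    qed
    define E where "E i = {y\<in>A. x + t i *\<^sub>R (y - x) \<in> B}" for i
    have inA: "x + t i *\<^sub>R (y - x) \<in> A" if "y \<in> A" "i \<in> {1..K}" for i y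
    proof -
      have "(1 - t i) *\<^sub>R x + t i *\<^sub>R y \<in> A"
        using that A x t01[OF that(2)] by (intro convexD) auto
      then show ?thesis by (simp add: algebra_simps)
    qed
    have E: "E i \<in> lmeasurable" if "i \<in> {1..K}" for i
    proof -
      have "E i = A \<inter> {y. \<bar>p (x + t i *\<^sub>R (y - x))\<bar> < 1 / (M + 1) * \<bar>p x\<bar>}"
        using inA[OF _ that] by (auto simp: E_def B_def)
      moreover have "open {y. \<bar>p (x + t i *\<^sub>R (y - x))\<bar> < 1 / (M + 1) * \<bar>p x\<bar>}"
        by (intro open_Collect_less continuous_intros continuous_on_compose2[OF p(2)]) auto
      ultimately show ?thesis using A by (auto intro!: fmeasurable_Int_fmeasurable)
    qed
    have EB: "?\<mu> B \<le> ?\<mu> (E i) + \<delta> / 2 * ?\<mu> A" if i: "i \<in> {1..K}" for i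
    proof -
      define f where "f = (\<lambda>y. t i *\<^sub>R y + (1 - t i) *\<^sub>R x)"
      have f: "f y = x + t i *\<^sub>R (y - x)" for y by (simp add: f_def algebra_simps)
      have fm: "?\<mu> (f ` X) = t i ^ ?d * ?\<mu> X" for X
        using measure_lebesgue_affine[of "t i" "(1 - t i) *\<^sub>R x" X] t01[OF i] by (simp add: f_def)
      have fl: "f ` X \<in> lmeasurable" if "X \<in> lmeasurable" for X
      proof -
        have f': "f = (+) ((1 - t i) *\<^sub>R x) \<circ> (*\<^sub>R) (t i)" by (auto simp: f_def)
        have "(*\<^sub>R) (t i) ` X = (*\<^sub>R) (1 / t i) -` X \<inter> space lebesgue"
        proof safe
          fix y assume "(1 / t i) *\<^sub>R y \<in> X"
          then show "y \<in> (*\<^sub>R) (t i) ` X"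
            using t01[OF i] by (intro image_eqI[of _ _ "(1 / t i) *\<^sub>R y"]) auto
        qed (use t01[OF i] in auto)
        then have "(*\<^sub>R) (t i) ` X \<in> sets lebesgue"
          using measurable_sets[OF lebesgue_measurable_scaling, of X "1 / t i"] that by auto
        then have "f ` X \<in> sets lebesgue"
          unfolding f' image_comp[symmetric] by (rule lebesgue_sets_translation)
        moreover have "emeasure lebesgue (f ` X) < \<infinity>"
          unfolding f_def emeasure_lebesgue_affine using fmeasurableD2[OF that]
          by (simp add: ennreal_mult_less_top less_top power_less_top_ennreal del: emeasure_completion)
        ultimately show ?thesis by (intro fmeasurableI) auto
      qed
      \<comment> \<open>Points of \<open>B\<close> outside the contracted copy of \<open>A\<close>
        have no preimage in \<open>A\<close>; they belong to the part of relative measure at most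
        \<open>\<delta> / 2\<close>.\<close>
      have "B \<subseteq> f ` E i \<union> (A - f ` A)" by (auto simp: E_def f B_def)
      then have "?\<mu> B \<le> ?\<mu> (f ` E i \<union> (A - f ` A))"
        using B E[OF i] fl A by (intro measure_mono_fmeasurable fmeasurable.Un fmeasurable.Diff) auto
      also have "\<dots> \<le> ?\<mu> (f ` E i) + ?\<mu> (A - f ` A)"
        using E[OF i] fl A by (intro measure_Un_le) auto
      also have "?\<mu> (A - f ` A) = ?\<mu> A - ?\<mu> (f ` A)"
        using A fl inA[OF _ i] by (intro measurable_measure_Diff) (auto simp: f)
      also have "?\<mu> (f ` E i) \<le> 1 * ?\<mu> (E i)"
        unfolding fm using t01[OF i] by (intro mult_right_mono) (auto intro: power_le_one)
      also have "?\<mu> A - ?\<mu> (f ` A) \<le> \<delta> / 2 * ?\<mu> A"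
      proof -
        have "(1 - \<tau>) ^ ?d \<le> t i ^ ?d" using t01[OF i] \<tau> by (intro power_mono) auto
        then have "1 - t i ^ ?d \<le> \<delta> / 2" using \<tau> by linarith
        then have "(1 - t i ^ ?d) * ?\<mu> A \<le> \<delta> / 2 * ?\<mu> A" by (intro mult_right_mono) auto
        then show ?thesis unfolding fm by (simp add: algebra_simps)
      qed
      finally show ?thesis by simp
    qed
    have count: "(\<Sum>i\<in>{1..K}. indicat_real (E i) y) \<le> N * indicat_real A y" for y
    proof (cases "y \<in> A")
      case True
      let ?S = "{i\<in>{1..K}. \<bar>p (x + t i *\<^sub>R (y - x))\<bar> < 1 / (M + 1) * \<bar>p x\<bar>}"
      have ES: "{i\<in>{1..K}. y \<in> E i} = ?S"
      proof (rule Collect_cong, rule conj_cong[OF refl])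
        fix i assume "i \<in> {1..K}"
        from inA[OF True this] show "(y \<in> E i) = (\<bar>p (x + t i *\<^sub>R (y - x))\<bar> < 1 / (M + 1) * \<bar>p x\<bar>)"
          using True by (simp add: E_def B_def)
      qed
      have c1: "card ?S = card (t ` ?S)"
        by (rule card_image[symmetric, OF inj_on_subset[OF tinj]]) blast
      have c2: "t ` ?S = {s\<in>T. \<bar>p (x + s *\<^sub>R (y - x))\<bar> < 1 / (M + 1) * \<bar>p x\<bar>}"
        unfolding T_def by (simp only: Compr_image_eq)
      have c3: "card {s\<in>T. \<bar>p (x + s *\<^sub>R (y - x))\<bar> < 1 / (M + 1) * \<bar>p x\<bar>} \<le> N"
      proof (rule card_small_on_line[OF M(2,1) p(1)])
        show "T \<subseteq> {0..1}"
          unfolding T_def by (rule image_subsetI) (use t01 in \<open>simp add: less_imp_le\<close>)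
        show "\<forall>s\<in>T. \<forall>u\<in>T. s \<noteq> u \<longrightarrow> \<tau> / real K \<le> \<bar>s - u\<bar>"
        proof (intro ballI impI)
          fix s u assume "s \<in> T" "u \<in> T" "s \<noteq> u"
          then obtain i j where "s = t i" "u = t j" "i \<noteq> j" unfolding T_def by blast
          then show "\<tau> / real K \<le> \<bar>s - u\<bar>" using tgap by simp
        qed
      qed (simp add: T_def)
      have "(\<Sum>i\<in>{1..K}. indicat_real (E i) y) = card {i\<in>{1..K}. y \<in> E i}"
        by (simp add: indicator_def sum.If_cases Int_def)
      moreover have "card {i\<in>{1..K}. y \<in> E i} \<le> N"
        unfolding ES c1 c2 by (rule c3)
      ultimately show ?thesis using True by simp
    next
      case False
      then show ?thesis by (simp add: E_def)
    qed
    have "(\<Sum>i\<in>{1..K}. ?\<mu> (E i)) = (\<Sum>i\<in>{1..K}. integral\<^sup>L lebesgue (indicat_real (E i)))"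
      using E by (intro sum.cong) auto
    also have "\<dots> = integral\<^sup>L lebesgue (\<lambda>y. \<Sum>i\<in>{1..K}. indicat_real (E i) y)"
      using E by (intro Bochner_Integration.integral_sum[symmetric]) (simp add: lmeasurable_iff_integrable)
    also have "\<dots> \<le> integral\<^sup>L lebesgue (\<lambda>y. N * indicat_real A y)"
      using E A count by (intro integral_mono Bochner_Integration.integrable_sum integrable_mult_right)
        (simp_all add: lmeasurable_iff_integrable)
    also have "\<dots> = N * ?\<mu> A" using A by simp
    finally have "(\<Sum>i\<in>{1..K}. ?\<mu> (E i)) \<le> N * ?\<mu> A" .
    moreover have "(\<Sum>i\<in>{1..K}. ?\<mu> B) \<le> (\<Sum>i\<in>{1..K}. ?\<mu> (E i) + \<delta> / 2 * ?\<mu> A)"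
      by (intro sum_mono EB) auto
    ultimately have "K * ?\<mu> B \<le> N * ?\<mu> A + K * (\<delta> / 2 * ?\<mu> A)" by (simp add: sum.distrib)
    also have "N * ?\<mu> A \<le> (\<delta> / 2 * real K) * ?\<mu> A" using K by (intro mult_right_mono) auto
    finally have "K * ?\<mu> B \<le> K * (\<delta> * ?\<mu> A)" by (simp add: algebra_simps)
    then show "?\<mu> {y\<in>A. \<bar>p y\<bar> < 1 / (M + 1) * \<bar>p x\<bar>} \<le> \<delta> * ?\<mu> A"
      using K unfolding B_def by simp
  qed
qed

section \<open>Bounded measurable functions\<close>

text \<open>A class closed under products and contained in the integrable functions on sets of
  finite measure, so that products need no separate integrability argument. The bound is required on
  \<open>X\<close> only, since values off the domain are arbitrary.\<close>

definition bdd_meas :: "'a::euclidean_space set \<Rightarrow> ('a \<Rightarrow> real) \<Rightarrow> bool" where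
  "bdd_meas X h \<longleftrightarrow> h \<in> borel_measurable (lebesgue_on X) \<and> (\<exists>K. \<forall>x\<in>X. \<bar>h x\<bar> \<le> K)"

lemma bdd_measI: "h \<in> borel_measurable (lebesgue_on X) \<Longrightarrow> (\<And>x. x \<in> X \<Longrightarrow> \<bar>h x\<bar> \<le> K) \<Longrightarrow> bdd_meas X h"
  unfolding bdd_meas_def by blast

lemma bdd_meas_const [simp, intro]: "bdd_meas X (\<lambda>x. c)"
  by (rule bdd_measI[of _ _ "\<bar>c\<bar>"]) auto

lemma bdd_meas_add [intro]:
  assumes "bdd_meas X g" "bdd_meas X h"
  shows "bdd_meas X (\<lambda>x. g x + h x)"
proof -
  obtain K L where "\<forall>x\<in>X. \<bar>g x\<bar> \<le> K" "\<forall>x\<in>X. \<bar>h x\<bar> \<le> L" using assms unfolding bdd_meas_def by blast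
  then show ?thesis
    using assms by (intro bdd_measI[of _ _ "K + L"]) (auto simp: bdd_meas_def intro: abs_triangle_ineq[THEN order_trans] add_mono)
qed

lemma bdd_meas_mult [intro]:
  assumes "bdd_meas X g" "bdd_meas X h"
  shows "bdd_meas X (\<lambda>x. g x * h x)"
proof -
  obtain K L where "\<forall>x\<in>X. \<bar>g x\<bar> \<le> K" "\<forall>x\<in>X. \<bar>h x\<bar> \<le> L" using assms unfolding bdd_meas_def by blast
  then show ?thesis
    using assms
    by (intro bdd_measI[of _ _ "\<bar>K\<bar> * \<bar>L\<bar>"]) (auto simp: bdd_meas_def abs_mult intro!: mult_mono intro: order_trans[OF _ abs_ge_self])
qed

lemma bdd_meas_abs [intro]:
  assumes "bdd_meas X g"
  shows "bdd_meas X (\<lambda>x. \<bar>g x\<bar>)"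
  using assms unfolding bdd_meas_def by auto

lemma bdd_meas_minus [intro]: "bdd_meas X g \<Longrightarrow> bdd_meas X (\<lambda>x. - g x)"
  unfolding bdd_meas_def by auto

lemma bdd_meas_diff [intro]:
  assumes "bdd_meas X g" "bdd_meas X h"
  shows "bdd_meas X (\<lambda>x. g x - h x)"
  using bdd_meas_add[OF assms(1) bdd_meas_minus[OF assms(2)]] by simp

lemma bdd_meas_power [intro]: "bdd_meas X g \<Longrightarrow> bdd_meas X (\<lambda>x. g x ^ n)"
  by (induction n) (auto)

lemma bdd_meas_sum [intro]: "(\<And>i. i \<in> I \<Longrightarrow> bdd_meas X (g i)) \<Longrightarrow> bdd_meas X (\<lambda>x. \<Sum>i\<in>I. g i x)"
  by (induction I rule: infinite_finite_induct) (auto)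

lemma bdd_meas_prod [intro]: "(\<And>i. i \<in> I \<Longrightarrow> bdd_meas X (g i)) \<Longrightarrow> bdd_meas X (\<lambda>x. \<Prod>i\<in>I. g i x)"
  by (induction I rule: infinite_finite_induct) (auto)

lemma bdd_meas_cong: "(\<And>x. x \<in> X \<Longrightarrow> g x = h x) \<Longrightarrow> bdd_meas X g \<longleftrightarrow> bdd_meas X h"
  unfolding bdd_meas_def by (intro conj_cong measurable_cong) auto

lemma bdd_meas_subset: "bdd_meas X h \<Longrightarrow> Y \<subseteq> X \<Longrightarrow> bdd_meas Y h"
  unfolding bdd_meas_def by (auto intro: measurable_restrict_mono)

lemma bdd_meas_indicator: "A \<in> sets lebesgue \<Longrightarrow> bdd_meas X (indicat_real A)"
  by (intro bdd_measI[of _ _ 1] measurable_restrict_space1) (auto simp: indicator_def)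

lemma bdd_meas_continuous:
  assumes "continuous_on UNIV h" "bounded X"
  shows "bdd_meas X h"
proof -
  have "compact (h ` closure X)"
    using assms by (intro compact_continuous_image) (auto simp: compact_closure intro: continuous_on_subset)
  then obtain K where "\<forall>y\<in>h ` closure X. \<bar>y\<bar> \<le> K"
    using compact_imp_bounded bounded_real by blast
  then have "\<And>x. x \<in> X \<Longrightarrow> \<bar>h x\<bar> \<le> K" using closure_subset by blast
  moreover have "h \<in> borel_measurable lebesgue"
    using assms(1) by (intro borel_measurable_continuous_onI measurable_completion) (auto intro: borel_measurable_continuous_onI)
  ultimately show ?thesis by (intro bdd_measI[of _ _ K]) (auto intro: measurable_restrict_space1)
qed

lemma bdd_meas_integrable:
  assumes "bdd_meas A h" "A \<in> lmeasurable"
  shows "set_integrable lebesgue A h"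
proof -
  obtain K where K: "h \<in> borel_measurable (lebesgue_on A)" "\<And>x. x \<in> A \<Longrightarrow> \<bar>h x\<bar> \<le> K"
    using assms unfolding bdd_meas_def by blast
  have "finite_measure (lebesgue_on A)" using assms(2) by (rule finite_measure_lebesgue_on)
  then have "integrable (lebesgue_on A) h"
    using K by (intro finite_measure.integrable_const_bound[of _ _ K]) (auto)
  then show ?thesis
    using assms(2) by (simp add: set_integrable_def integrable_restrict_space)
qed

section \<open>Integrals of bounded measurable functions over sets of finite measure\<close>

abbreviation Int_on :: "'a::euclidean_space set \<Rightarrow> ('a \<Rightarrow> real) \<Rightarrow> real" where
  "Int_on A h \<equiv> (LINT x:A|lebesgue. h x)"

lemma Int_on_mono:
  assumes "bdd_meas A g" "bdd_meas A h" "A \<in> lmeasurable" "\<And>x. x \<in> A \<Longrightarrow> g x \<le> h x"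
  shows "Int_on A g \<le> Int_on A h"
  using assms by (intro set_integral_mono bdd_meas_integrable) auto

lemma Int_on_add:
  assumes "bdd_meas A g" "bdd_meas A h" "A \<in> lmeasurable"
  shows "Int_on A (\<lambda>x. g x + h x) = Int_on A g + Int_on A h"
  using assms by (intro set_integral_add bdd_meas_integrable) auto

lemma Int_on_diff:
  assumes "bdd_meas A g" "bdd_meas A h" "A \<in> lmeasurable"
  shows "Int_on A (\<lambda>x. g x - h x) = Int_on A g - Int_on A h"
  using assms by (intro set_integral_diff bdd_meas_integrable) auto

lemma Int_on_const:
  assumes "A \<in> lmeasurable"
  shows "Int_on A (\<lambda>x. c) = c * measure lebesgue A"
  using assms by (subst set_integral_const) (auto simp: fmeasurable_def)

lemma Int_on_nonneg: "(\<And>x. x \<in> A \<Longrightarrow> 0 \<le> h x) \<Longrightarrow> 0 \<le> Int_on A h"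
  unfolding set_lebesgue_integral_def by (intro Bochner_Integration.integral_nonneg) (auto simp: indicator_def)

lemma Int_on_cong: "(\<And>x. x \<in> A \<Longrightarrow> g x = h x) \<Longrightarrow> Int_on A g = Int_on A h"
  unfolding set_lebesgue_integral_def by (intro Bochner_Integration.integral_cong) (auto simp: indicator_def)

lemma Int_on_finite_Union:
  assumes "bdd_meas (\<Union>\<B>) h" "finite \<B>" "disjoint \<B>" "\<And>B. B \<in> \<B> \<Longrightarrow> B \<in> lmeasurable"
  shows "Int_on (\<Union>\<B>) h = (\<Sum>B\<in>\<B>. Int_on B h)"
proof -
  have "Int_on (\<Union>B\<in>\<B>. B) h = (\<Sum>B\<in>\<B>. Int_on B h)"
    using assms
    by (intro set_integral_finite_Union bdd_meas_integrable)
      (auto simp: disjoint_family_on_def disjoint_def intro: bdd_meas_subset)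
  then show ?thesis by simp
qed

lemma Int_on_mono_set:
  assumes "bdd_meas A h" "A \<in> lmeasurable" "E \<in> lmeasurable" "E \<subseteq> A" "\<And>x. x \<in> A \<Longrightarrow> 0 \<le> h x"
  shows "Int_on E h \<le> Int_on A h"
proof -
  have "Int_on E h + Int_on (A - E) h = Int_on (E \<union> (A - E)) h"
    using assms by (intro set_integral_Un[symmetric] bdd_meas_integrable) (auto intro: bdd_meas_subset fmeasurable.Diff)
  moreover have "0 \<le> Int_on (A - E) h" using assms by (intro Int_on_nonneg) auto
  moreover have "E \<union> (A - E) = A" using assms by auto
  ultimately show ?thesis by simp
qed

lemma Int_on_Un:
  assumes "bdd_meas (A \<union> B) h" "A \<in> lmeasurable" "B \<in> lmeasurable" "A \<inter> B = {}"
  shows "Int_on (A \<union> B) h = Int_on A h + Int_on B h"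
  using assms by (intro set_integral_Un bdd_meas_integrable) (auto intro: bdd_meas_subset)

text \<open>Otherwise \<open>c - h\<close> would be strictly positive on \<open>A\<close> with
  integral at most 0, which forces \<open>A\<close> to be null.\<close>

lemma Int_on_ge_imp_point_ge:
  assumes "bdd_meas A h" "A \<in> lmeasurable" "0 < measure lebesgue A" "Int_on A h \<ge> c * measure lebesgue A"
  shows "\<exists>x\<in>A. c \<le> h x"
proof (rule ccontr)
  assume "\<not> ?thesis"
  then have less: "\<And>x. x \<in> A \<Longrightarrow> h x < c" by force
  have "integrable lebesgue (\<lambda>x. indicat_real A x *\<^sub>R (c - h x))"
    using bdd_meas_integrable[OF bdd_meas_diff[OF bdd_meas_const assms(1)] assms(2)] unfolding set_integrable_def .
  moreover have "Int_on A (\<lambda>x. c - h x) = 0"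
  proof (rule antisym)
    show "Int_on A (\<lambda>x. c - h x) \<le> 0"
      using assms by (subst Int_on_diff) (auto simp: Int_on_const)
    show "0 \<le> Int_on A (\<lambda>x. c - h x)" by (intro Int_on_nonneg) (use less in \<open>auto simp: less_imp_le\<close>)
  qed
  ultimately have "AE x in lebesgue. indicat_real A x *\<^sub>R (c - h x) = 0"
    by (subst integral_nonneg_eq_0_iff_AE[symmetric])
      (use less in \<open>auto simp: set_lebesgue_integral_def indicator_def less_imp_le\<close>)
  then have "AE x in lebesgue. x \<notin> A"
    by eventually_elim (use less in \<open>force simp: indicator_def split: if_splits\<close>)
  then have "A \<in> null_sets lebesgue"
    using assms(2) AE_iff_null_sets fmeasurableD by blast
  then show False using assms(3) by (simp add: null_sets_def measure_def)
qed

section \<open>Remez inequalities in integral form\<close>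

lemma remez_large_part:
  fixes p :: "'a::euclidean_space \<Rightarrow> real"
  assumes R: "measure lebesgue {y\<in>A. \<bar>p y\<bar> < s} \<le> \<delta>" and A: "A \<in> lmeasurable" "E \<in> lmeasurable" "E \<subseteq> A"
    and p: "continuous_on UNIV p"
  shows "{y\<in>E. s \<le> \<bar>p y\<bar>} \<in> lmeasurable" "measure lebesgue E - \<delta> \<le> measure lebesgue {y\<in>E. s \<le> \<bar>p y\<bar>}"
proof -
  let ?\<mu> = "measure (lebesgue :: 'a measure)"
  have op: "open {y. \<bar>p y\<bar> < s}" and cl: "closed {y. s \<le> \<bar>p y\<bar>}"
    using p by (auto intro!: open_Collect_less closed_Collect_le continuous_intros)
  have "E \<inter> {y. s \<le> \<bar>p y\<bar>} \<in> lmeasurable" "A \<inter> {y. \<bar>p y\<bar> < s} \<in> lmeasurable"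
    using A op cl by (auto intro!: fmeasurable_Int_fmeasurable)
  moreover have eq: "E \<inter> {y. s \<le> \<bar>p y\<bar>} = {y\<in>E. s \<le> \<bar>p y\<bar>}" "A \<inter> {y. \<bar>p y\<bar> < s} = {y\<in>A. \<bar>p y\<bar> < s}" by auto
  ultimately have G: "{y\<in>E. s \<le> \<bar>p y\<bar>} \<in> lmeasurable" and H: "{y\<in>A. \<bar>p y\<bar> < s} \<in> lmeasurable" by simp_all
  show "{y\<in>E. s \<le> \<bar>p y\<bar>} \<in> lmeasurable" by (rule G)
  have "?\<mu> E \<le> ?\<mu> ({y\<in>E. s \<le> \<bar>p y\<bar>} \<union> {y\<in>A. \<bar>p y\<bar> < s})"
    using A G H by (intro measure_mono_fmeasurable fmeasurable.Un) auto
  also have "\<dots> \<le> ?\<mu> {y\<in>E. s \<le> \<bar>p y\<bar>} + ?\<mu> {y\<in>A. \<bar>p y\<bar> < s}" using G H by (intro measure_Un_le) auto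
  finally show "?\<mu> E - \<delta> \<le> ?\<mu> {y\<in>E. s \<le> \<bar>p y\<bar>}" using R by simp
qed

text \<open>Applied with \<open>c / 2\<close>, the Remez inequality leaves at least half of the
  guaranteed share of \<open>E\<close> on which \<open>\<bar>p\<bar>\<close> is comparable to
  \<open>\<bar>p x\<bar>\<close>. The point \<open>x\<close> may lie outside \<open>E\<close>; this
  is how bounds extend from a child to its parent.\<close>

lemma remez_integral:
  assumes "0 < c"
  shows "\<exists>C>0. \<forall>A E (p::'a::euclidean_space \<Rightarrow> real) x. convex A \<longrightarrow> bounded A \<longrightarrow> A \<in> lmeasurable
     \<longrightarrow> E \<in> lmeasurable \<longrightarrow> E \<subseteq> A \<longrightarrow> c * measure lebesgue A \<le> measure lebesgue E
     \<longrightarrow> line_poly N p \<longrightarrow> continuous_on UNIV p \<longrightarrow> x \<in> A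
     \<longrightarrow> \<bar>p x\<bar> * measure lebesgue A \<le> C * Int_on E (\<lambda>y. \<bar>p y\<bar>)"
proof -
  let ?\<mu> = "measure (lebesgue :: 'a measure)"
  have "0 < c / 2" using assms by simp
  from remez_measure[OF this, of N, where 'a='a]
  obtain \<eta> where \<eta>: "\<eta> > 0" and R: "\<forall>A (p::'a \<Rightarrow> real) x. convex A \<longrightarrow> A \<in> lmeasurable \<longrightarrow> line_poly N p
     \<longrightarrow> continuous_on UNIV p \<longrightarrow> x \<in> A \<longrightarrow> ?\<mu> {y\<in>A. \<bar>p y\<bar> < \<eta> * \<bar>p x\<bar>} \<le> c / 2 * ?\<mu> A"
    by (elim exE conjE)
  show ?thesis
  proof (intro exI[of _ "2 / (\<eta> * c)"] conjI allI impI)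
    show "0 < 2 / (\<eta> * c)" using \<eta> assms by simp
    fix A E :: "'a set" and p :: "'a \<Rightarrow> real" and x :: 'a
    assume A: "convex A" "bounded A" "A \<in> lmeasurable" and E: "E \<in> lmeasurable" "E \<subseteq> A" "c * ?\<mu> A \<le> ?\<mu> E"
      and p: "line_poly N p" "continuous_on UNIV p" and x: "x \<in> A"
    define G where "G = {y\<in>E. \<eta> * \<bar>p x\<bar> \<le> \<bar>p y\<bar>}"
    have "?\<mu> {y\<in>A. \<bar>p y\<bar> < \<eta> * \<bar>p x\<bar>} \<le> c / 2 * ?\<mu> A"
      using R A p x by simp
    from remez_large_part[OF this A(3) E(1,2) p(2)]
    have G: "G \<in> lmeasurable" and muG: "c / 2 * ?\<mu> A \<le> ?\<mu> G" using E(3) by (auto simp: G_def)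
    have bm: "bdd_meas E (\<lambda>y. \<bar>p y\<bar>)"
      using p(2) A(2) E(2) by (intro bdd_meas_abs bdd_meas_continuous) (auto intro: bounded_subset)
    have GE: "G \<subseteq> E" by (auto simp: G_def)
    have "\<eta> * \<bar>p x\<bar> * (c / 2 * ?\<mu> A) \<le> \<eta> * \<bar>p x\<bar> * ?\<mu> G"
      using muG \<eta> by (intro mult_left_mono) auto
    also have "\<dots> = Int_on G (\<lambda>y. \<eta> * \<bar>p x\<bar>)" by (rule Int_on_const[OF G, symmetric])
    also have "\<dots> \<le> Int_on G (\<lambda>y. \<bar>p y\<bar>)"
      using G GE bm by (intro Int_on_mono) (auto simp: G_def intro: bdd_meas_subset)
    also have "\<dots> \<le> Int_on E (\<lambda>y. \<bar>p y\<bar>)"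
      using G GE bm E by (intro Int_on_mono_set) auto
    finally show "\<bar>p x\<bar> * ?\<mu> A \<le> 2 / (\<eta> * c) * Int_on E (\<lambda>y. \<bar>p y\<bar>)"
      using \<eta> assms by (simp add: field_simps)
  qed
qed

text \<open>With \<open>1/3\<close> as exceptional share for each factor, at least a third of
  \<open>A\<close> remains where both are large at once. So the product controls both factors, even
  at different points.\<close>

lemma remez_product_integral:
  shows "\<exists>C>0. \<forall>A (p::'a::euclidean_space \<Rightarrow> real) q x y. convex A \<longrightarrow> bounded A \<longrightarrow> A \<in> lmeasurable
     \<longrightarrow> line_poly N p \<longrightarrow> continuous_on UNIV p \<longrightarrow> line_poly N q \<longrightarrow> continuous_on UNIV q \<longrightarrow> x \<in> A \<longrightarrow> y \<in> A
     \<longrightarrow> \<bar>p x\<bar> * \<bar>q y\<bar> * measure lebesgue A \<le> C * Int_on A (\<lambda>z. \<bar>p z * q z\<bar>)"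
proof -
  let ?\<mu> = "measure (lebesgue :: 'a measure)"
  have "0 < (1/3::real)" by simp
  from remez_measure[OF this, of N, where 'a='a]
  obtain \<eta> where \<eta>: "\<eta> > 0" and R: "\<forall>A (p::'a \<Rightarrow> real) x. convex A \<longrightarrow> A \<in> lmeasurable \<longrightarrow> line_poly N p
     \<longrightarrow> continuous_on UNIV p \<longrightarrow> x \<in> A \<longrightarrow> ?\<mu> {y\<in>A. \<bar>p y\<bar> < \<eta> * \<bar>p x\<bar>} \<le> 1/3 * ?\<mu> A"
    by (elim exE conjE)
  show ?thesis
  proof (intro exI[of _ "3 / (\<eta> * \<eta>)"] conjI allI impI)
    show "0 < 3 / (\<eta> * \<eta>)" using \<eta> by simp
    fix A :: "'a set" and p q :: "'a \<Rightarrow> real" and x y :: 'a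
    assume A: "convex A" "bounded A" "A \<in> lmeasurable"
      and p: "line_poly N p" "continuous_on UNIV p" and q: "line_poly N q" "continuous_on UNIV q"
      and x: "x \<in> A" and y: "y \<in> A"
    define E where "E = {z\<in>A. \<eta> * \<bar>p x\<bar> \<le> \<bar>p z\<bar>}"
    define G where "G = {z\<in>E. \<eta> * \<bar>q y\<bar> \<le> \<bar>q z\<bar>}"
    have "?\<mu> {z\<in>A. \<bar>p z\<bar> < \<eta> * \<bar>p x\<bar>} \<le> 1/3 * ?\<mu> A" using R A p x by simp
    from remez_large_part[OF this A(3) A(3) order_refl p(2)]
    have E: "E \<in> lmeasurable" and muE: "2/3 * ?\<mu> A \<le> ?\<mu> E" by (auto simp: E_def)
    have EA: "E \<subseteq> A" by (auto simp: E_def)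
    have "?\<mu> {z\<in>A. \<bar>q z\<bar> < \<eta> * \<bar>q y\<bar>} \<le> 1/3 * ?\<mu> A" using R A q y by simp
    from remez_large_part[OF this A(3) E EA q(2)]
    have G: "G \<in> lmeasurable" and muG: "1/3 * ?\<mu> A \<le> ?\<mu> G" using muE by (auto simp: G_def)
    have GA: "G \<subseteq> A" by (auto simp: G_def E_def)
    have bm: "bdd_meas A (\<lambda>z. \<bar>p z * q z\<bar>)"
      using p q A(2) by (intro bdd_meas_abs bdd_meas_mult bdd_meas_continuous)
    let ?k = "\<eta> * \<bar>p x\<bar> * (\<eta> * \<bar>q y\<bar>)"
    have "?k * (1/3 * ?\<mu> A) \<le> ?k * ?\<mu> G"
      using muG \<eta> by (intro mult_left_mono) auto
    also have "\<dots> = Int_on G (\<lambda>z. ?k)" by (rule Int_on_const[OF G, symmetric])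
    also have "\<dots> \<le> Int_on G (\<lambda>z. \<bar>p z * q z\<bar>)"
    proof (rule Int_on_mono)
      show "bdd_meas G (\<lambda>z. \<bar>p z * q z\<bar>)" using bm GA by (rule bdd_meas_subset)
      fix z assume "z \<in> G"
      then show "?k \<le> \<bar>p z * q z\<bar>"
        unfolding abs_mult using \<eta> by (intro mult_mono) (auto simp: G_def E_def)
    qed (use G in auto)
    also have "\<dots> \<le> Int_on A (\<lambda>z. \<bar>p z * q z\<bar>)"
      using G GA bm A by (intro Int_on_mono_set) auto
    finally show "\<bar>p x\<bar> * \<bar>q y\<bar> * ?\<mu> A \<le> 3 / (\<eta> * \<eta>) * Int_on A (\<lambda>z. \<bar>p z * q z\<bar>)"
      using \<eta> by (simp add: field_simps)
  qed
qed

section \<open>The width of a convex set\<close>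

lemma extent_pos:
  fixes A :: "'a::euclidean_space set"
  assumes "measure lebesgue A > 0" "u \<noteq> 0" "\<And>x. x \<in> A \<Longrightarrow> l \<le> u \<bullet> x" "\<And>x. x \<in> A \<Longrightarrow> u \<bullet> x \<le> h"
  shows "l < h"
proof (rule ccontr)
  assume "\<not> l < h"
  then have "A \<subseteq> {x. u \<bullet> x = h}" using assms(3,4) by force
  moreover have "negligible {x. u \<bullet> x = h}" using assms(2) by (intro negligible_hyperplane) auto
  ultimately have "negligible A" using negligible_subset by blast
  then have "measure lebesgue A = 0" by (rule negligible_imp_measure0)
  then show False using assms(1) by simp
qed

lemma supporting_hyperplane_Sup:
  fixes A :: "'a::euclidean_space set"
  assumes A: "bounded A" "A \<noteq> {}" and u: "u \<noteq> 0"
  shows "supporting_hyperplane A {x. u \<bullet> x = Sup ((\<bullet>) u ` A)}"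
proof -
  let ?h = "Sup ((\<bullet>) u ` A)"
  have bdd: "bdd_above ((\<bullet>) u ` A)"
    using A(1) by (intro bounded_imp_bdd_above bounded_linear_image bounded_linear_inner_right)
  have le: "u \<bullet> x \<le> ?h" if "x \<in> A" for x using bdd that by (intro cSup_upper) auto
  have cl: "u \<bullet> x \<le> ?h" if "x \<in> closure A" for x
  proof -
    have "closure A \<subseteq> {x. u \<bullet> x \<le> ?h}"
      using le by (intro closure_minimal) (auto simp: closed_halfspace_le)
    then show ?thesis using that by auto
  qed
  have "compact (closure A)" "closure A \<noteq> {}" using A by (auto simp: compact_closure)
  then obtain x where x: "x \<in> closure A" "\<And>y. y \<in> closure A \<Longrightarrow> u \<bullet> y \<le> u \<bullet> x"
    using continuous_attains_sup[of "closure A" "\<lambda>x. u \<bullet> x", OF _ _ continuous_on_inner[OF continuous_on_const continuous_on_id]]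
    by blast
  have "?h \<le> u \<bullet> x"
    using A(2) x(2) closure_subset by (intro cSup_least) auto
  with cl[OF x(1)] have "u \<bullet> x = ?h" by simp
  then show ?thesis
    unfolding supporting_hyperplane_def using u le x(1) by (intro exI[of _ u] exI[of _ ?h]) auto
qed

text \<open>The two hyperplanes that bound \<open>A\<close> in direction \<open>u\<close> are
  parallel and supporting, and the multiples of \<open>u\<close> on them bound their distance.
  Positive measure keeps them distinct, as \<open>width\<close> demands.\<close>

lemma width_le_extent:
  fixes A :: "'a::euclidean_space set"
  assumes A: "bounded A" "measure lebesgue A > 0" and u: "norm u = 1"
  shows "width A \<le> Sup ((\<bullet>) u ` A) - Inf ((\<bullet>) u ` A)"
proof -
  let ?h = "Sup ((\<bullet>) u ` A)" and ?l = "Inf ((\<bullet>) u ` A)"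
  have ne: "A \<noteq> {}" using A(2) by auto
  have bdd: "bdd_above ((\<bullet>) u ` A)" "bdd_below ((\<bullet>) u ` A)"
    using A(1) by (auto intro!: bounded_imp_bdd_above bounded_imp_bdd_below bounded_linear_image bounded_linear_inner_right)
  have u0: "u \<noteq> 0" using u by auto
  have uu: "u \<bullet> u = 1" using u by (simp add: dot_square_norm)
  have lh: "?l < ?h"
    by (rule extent_pos[OF A(2) u0 cInf_lower[OF imageI bdd(2)] cSup_upper[OF imageI bdd(1)]])
  let ?H = "{x. u \<bullet> x = ?h}" and ?K = "{x. u \<bullet> x = ?l}"
  have H: "supporting_hyperplane A ?H" by (rule supporting_hyperplane_Sup[OF A(1) ne u0])
  have "(\<bullet>) (- u) ` A = uminus ` ((\<bullet>) u ` A)" by (simp add: image_image)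
  then have "Sup ((\<bullet>) (- u) ` A) = - ?l"
    by (simp add: Inf_real_def image_image)
  then have "{x. (- u) \<bullet> x = Sup ((\<bullet>) (- u) ` A)} = ?K" by auto
  then have K: "supporting_hyperplane A ?K" using supporting_hyperplane_Sup[OF A(1) ne, of "- u"] u0 by simp
  have HK: "?H \<noteq> ?K"
  proof
    assume "?H = ?K"
    moreover have "?h *\<^sub>R u \<in> ?H" using uu by simp
    ultimately show False using lh uu by simp
  qed
  have par: "affine_parallel ?H ?K"
    unfolding affine_parallel_def
  proof (intro exI[of _ "(?l - ?h) *\<^sub>R u"] set_eqI iffI)
    fix x assume "x \<in> ?K"
    then show "x \<in> (+) ((?l - ?h) *\<^sub>R u) ` ?H"
      using uu by (intro image_eqI[of _ _ "x - (?l - ?h) *\<^sub>R u"]) (auto simp: inner_diff_right)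
  qed (use uu in \<open>auto simp: inner_add_right\<close>)
  have "width A \<le> setdist ?H ?K"
    unfolding width_def using H K HK par
    by (intro cInf_lower bdd_belowI[of _ 0]) (auto simp: setdist_pos_le)
  also have "\<dots> \<le> dist (?h *\<^sub>R u) (?l *\<^sub>R u)"
    using uu by (intro setdist_le_dist) auto
  also have "\<dots> = ?h - ?l"
    using u lh by (simp add: dist_norm scaleR_diff_left[symmetric])
  finally show ?thesis .
qed

text \<open>Contracting \<open>A\<close> by the factor 1/2 towards a point where \<open>u \<bullet> x\<close> is nearly minimal gives a subset of
  \<open>A\<close> of relative measure \<open>2 ^ - DIM('a)\<close> that stays away from the upper supporting hyperplane.\<close>

lemma mean_below_Sup:
  fixes A :: "'a::euclidean_space set"
  assumes A: "convex A" "bounded A" "A \<in> lmeasurable" "measure lebesgue A > 0" and u: "u \<noteq> 0"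
  defines "h \<equiv> Sup ((\<bullet>) u ` A)" and "l \<equiv> Inf ((\<bullet>) u ` A)"
  shows "(h - l) / 2 ^ (DIM('a) + 2) * measure lebesgue A \<le> Int_on A (\<lambda>x. h - u \<bullet> x)"
proof -
  let ?\<mu> = "measure (lebesgue :: 'a measure)"
  have ne: "A \<noteq> {}" using A(4) by auto
  have bdd: "bdd_above ((\<bullet>) u ` A)" "bdd_below ((\<bullet>) u ` A)"
    using A(2) by (auto intro!: bounded_imp_bdd_above bounded_imp_bdd_below bounded_linear_image bounded_linear_inner_right)
  have le: "u \<bullet> x \<le> h" "l \<le> u \<bullet> x" if "x \<in> A" for x
    unfolding h_def l_def
    by (rule cSup_upper[OF imageI[OF that] bdd(1)], rule cInf_lower[OF imageI[OF that] bdd(2)])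
  have lh: "l < h" using extent_pos[OF A(4) u] le by blast
  have "Inf ((\<bullet>) u ` A) < (l + h) / 2" using lh unfolding l_def[symmetric] by simp
  then obtain y where y: "y \<in> A" "u \<bullet> y < (l + h) / 2"
    using cInf_less_iff[of "(\<bullet>) u ` A"] ne bdd by blast
  let ?E = "(\<lambda>x. (1/2) *\<^sub>R x + (1/2) *\<^sub>R y) ` A"
  have muE: "?\<mu> ?E = ?\<mu> A / 2 ^ DIM('a)"
    using measure_lebesgue_affine[of "1/2" "(1/2) *\<^sub>R y" A] by (simp add: power_one_over field_simps)
  have EA: "?E \<subseteq> A" using A(1) y(1) by (auto intro!: convexD)
  have Ec: "convex ?E"
  proof -
    have "?E = (\<lambda>x. (1/2) *\<^sub>R y + x) ` ((*\<^sub>R) (1/2) ` A)" by (simp add: image_image add.commute)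
    then show ?thesis using A(1) by (simp only: convex_translation convex_scaling)
  qed
  have E: "?E \<in> lmeasurable"
    using Ec EA A(2) by (intro measurable_convex) (auto intro: bounded_subset)
  have c: "bdd_meas A (\<lambda>x. h - u \<bullet> x)"
    using A(2) by (intro bdd_meas_continuous continuous_intros)
  have "(h - l) / 2 ^ (DIM('a) + 2) * ?\<mu> A = Int_on ?E (\<lambda>x. (h - l) / 4)"
    by (subst Int_on_const[OF E]) (simp add: muE)
  also have "\<dots> \<le> Int_on ?E (\<lambda>x. h - u \<bullet> x)"
  proof (rule Int_on_mono)
    show "bdd_meas ?E (\<lambda>x. h - u \<bullet> x)" using c EA by (rule bdd_meas_subset)
    fix z assume "z \<in> ?E"
    then obtain x where "x \<in> A" "z = (1/2) *\<^sub>R x + (1/2) *\<^sub>R y" by blast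
    then show "(h - l) / 4 \<le> h - u \<bullet> z" using le(1)[of x] y(2) by (simp add: inner_add_right field_simps)
  qed (use E in auto)
  also have "\<dots> \<le> Int_on A (\<lambda>x. h - u \<bullet> x)"
    using c A E EA le by (intro Int_on_mono_set) auto
  finally show ?thesis .
qed

text \<open>The centre is the centroid of \<open>A\<close>: by \<open>mean_below_Sup\<close> it
  keeps the distance \<open>r\<close> from the supporting hyperplane in every direction. Separation
  puts the ball into the closure of \<open>A\<close>, and for convex \<open>A\<close> the interior
  of the closure is the interior of \<open>A\<close>.\<close>

lemma inscribed_ball:
  fixes A :: "'a::euclidean_space set"
  assumes A: "convex A" "bounded A" "A \<in> lmeasurable" "measure lebesgue A > 0"
  shows "\<exists>c. ball c (width A / 2 ^ (DIM('a) + 2)) \<subseteq> A"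
proof -
  let ?\<mu> = "measure (lebesgue :: 'a measure)"
  define r where "r = width A / 2 ^ (DIM('a) + 2)"
  define c where "c = (1 / ?\<mu> A) *\<^sub>R integral\<^sup>L lebesgue (\<lambda>x. indicat_real A x *\<^sub>R x)"
  obtain K where K: "\<And>x. x \<in> A \<Longrightarrow> norm x \<le> K" using A(2) bounded_iff by metis
  have int: "integrable lebesgue (\<lambda>x. indicat_real A x *\<^sub>R x)"
  proof (rule Bochner_Integration.integrable_bound[of _ "\<lambda>x. \<bar>K\<bar> * indicat_real A x"])
    show "integrable lebesgue (\<lambda>x. \<bar>K\<bar> * indicat_real A x)"
      using A(3) by (intro integrable_mult_right) (simp add: lmeasurable_iff_integrable)
    have "(\<lambda>x::'a. x) \<in> borel_measurable lebesgue" by (auto intro: measurable_completion)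
    then show "(\<lambda>x. indicat_real A x *\<^sub>R x) \<in> borel_measurable lebesgue"
      using A(3) by (intro borel_measurable_scaleR borel_measurable_indicator) auto
    show "AE x in lebesgue. norm (indicat_real A x *\<^sub>R x) \<le> norm (\<bar>K\<bar> * indicat_real A x)"
      using K by (intro AE_I2) (auto simp: indicator_def intro: order_trans[OF _ abs_ge_self])
  qed
  have uc: "u \<bullet> c = Int_on A (\<lambda>x. u \<bullet> x) / ?\<mu> A" for u
  proof -
    have "u \<bullet> integral\<^sup>L lebesgue (\<lambda>x. indicat_real A x *\<^sub>R x) =
      integral\<^sup>L lebesgue (\<lambda>x. u \<bullet> (indicat_real A x *\<^sub>R x))"
      using int by (subst integral_inner_right) auto
    then show ?thesis by (simp add: c_def set_lebesgue_integral_def inner_scaleR_right)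
  qed
  have key: "r \<le> Sup ((\<bullet>) u ` A) - u \<bullet> c" if u: "norm u = 1" for u
  proof -
    let ?h = "Sup ((\<bullet>) u ` A)" and ?l = "Inf ((\<bullet>) u ` A)"
    have u0: "u \<noteq> 0" using u by auto
    have "(?h - ?l) / 2 ^ (DIM('a) + 2) * ?\<mu> A \<le> Int_on A (\<lambda>x. ?h - u \<bullet> x)"
      by (rule mean_below_Sup[OF A u0])
    also have "\<dots> = (?h - u \<bullet> c) * ?\<mu> A"
      using A bdd_meas_continuous[of "\<lambda>x. u \<bullet> x" A, OF continuous_on_inner[OF continuous_on_const continuous_on_id]]
      by (subst Int_on_diff) (simp_all add: Int_on_const uc left_diff_distrib)
    finally have "(?h - ?l) / 2 ^ (DIM('a) + 2) \<le> ?h - u \<bullet> c"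
      using mult_le_cancel_right_pos[OF A(4)] by blast
    moreover have "r \<le> (?h - ?l) / 2 ^ (DIM('a) + 2)"
      unfolding r_def using width_le_extent[OF A(2,4) u] by (intro divide_right_mono) auto
    ultimately show ?thesis by linarith
  qed
  have "ball c r \<subseteq> closure A"
  proof
    fix z assume z: "z \<in> ball c r"
    show "z \<in> closure A"
    proof (rule ccontr)
      assume "z \<notin> closure A"
      then obtain a b where ab: "a \<bullet> z < b" "\<And>x. x \<in> closure A \<Longrightarrow> b < a \<bullet> x"
        using separating_hyperplane_closed_point[of "closure A" z] A(1) convex_closure by auto
      have ne: "A \<noteq> {}" using A(4) by auto
      then obtain x0 where "x0 \<in> A" by blast
      then have a0: "a \<noteq> 0" using ab closure_subset by force
      define u where "u = - (1 / norm a) *\<^sub>R a"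
      have u: "norm u = 1" using a0 by (simp add: u_def)
      have "u \<bullet> x \<le> u \<bullet> z" if "x \<in> A" for x
      proof -
        have "a \<bullet> z \<le> a \<bullet> x" using ab(1) ab(2)[of x] that closure_subset by fastforce
        then show ?thesis using a0 by (simp add: u_def divide_right_mono)
      qed
      then have "Sup ((\<bullet>) u ` A) \<le> u \<bullet> z" using ne by (intro cSup_least) auto
      then have "r \<le> u \<bullet> (z - c)" using key[OF u] by (simp add: inner_diff_right)
      also have "\<dots> \<le> norm (z - c)" using norm_cauchy_schwarz[of u "z - c"] u by simp
      finally show False using z by (simp add: dist_norm norm_minus_commute)
    qed
  qed
  then have "ball c r \<subseteq> interior (closure A)" by (intro interior_maximal) auto
  also have "interior (closure A) = interior A" by (rule convex_interior_closure[OF A(1)])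
  also have "\<dots> \<subseteq> A" by (rule interior_subset)
  finally show ?thesis unfolding r_def by blast
qed

section \<open>The tree of atoms\<close>

locale atom_tree =
  fixes \<Omega> :: "'a::euclidean_space set" and F :: "nat \<Rightarrow> 'a measure" and c0 c4 :: real
  assumes compact_domain: "compact \<Omega>" and measure_domain: "measure lebesgue \<Omega> = 1"
    and binary: "binary_filtration \<Omega> F"
    and convex_atom: "\<And>n A. A \<in> atoms (F n) \<Longrightarrow> convex A"
    and c0_pos: "c0 > 0"
    and comparable: "\<And>n A A' A''. A \<in> atoms (F n) \<Longrightarrow> siblings (F (Suc n)) A A' A''
           \<Longrightarrow> measure lebesgue A' \<ge> c0 * measure lebesgue A''"
    and c4_pos: "c4 > 0"
    and fat: "\<And>n A. A \<in> atoms (F n) \<Longrightarrow> width A \<ge> c4 * diameter A"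
begin

abbreviation At :: "nat \<Rightarrow> 'a set set" where "At n \<equiv> atoms (F n)"
abbreviation vol :: "'a set \<Rightarrow> real" where "vol A \<equiv> measure lebesgue A"

lemma space_F: "space (F n) = \<Omega>"
  using binary unfolding binary_filtration_def filtration_def by blast

lemma At_subset: "A \<in> At n \<Longrightarrow> A \<subseteq> \<Omega>"
  unfolding atoms_def using sets.sets_into_space[of A "F n"] by (simp add: space_F)

lemma At_nonempty: "A \<in> At n \<Longrightarrow> A \<noteq> {}"
  unfolding atoms_def by blast

lemma At_0: "At 0 = {\<Omega>}"
proof -
  have "sets (F 0) = {{}, \<Omega>}" using binary unfolding binary_filtration_def by blast
  moreover have "\<Omega> \<noteq> {}" using measure_domain by auto
  ultimately show ?thesis unfolding atoms_def by auto
qed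

lemma At_minimal:
  assumes "A \<in> At n" "D \<in> sets (F n)" "D \<subseteq> A" "D \<noteq> {}"
  shows "D = A"
proof -
  have "\<forall>B\<in>sets (F n). B \<subseteq> A \<longrightarrow> B = {} \<or> B = A" using assms(1) by (simp add: atoms_def)
  from bspec[OF this assms(2)] assms(3,4) show ?thesis by simp
qed

lemma At_disjoint:
  assumes "A \<in> At n" "B \<in> At n" "A \<inter> B \<noteq> {}"
  shows "A = B"
proof -
  have "A \<in> sets (F n)" "B \<in> sets (F n)" using assms unfolding atoms_def by simp_all
  then have AB: "A \<inter> B \<in> sets (F n)" by (rule sets.Int)
  have "A \<inter> B = A" "A \<inter> B = B"
    using At_minimal[OF assms(1) AB Int_lower1 assms(3)] At_minimal[OF assms(2) AB Int_lower2 assms(3)] .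
  then show ?thesis by (rule trans[OF sym])
qed

lemma At_eq: "A \<in> At n \<Longrightarrow> B \<in> At n \<Longrightarrow> x \<in> A \<Longrightarrow> x \<in> B \<Longrightarrow> A = B"
  using At_disjoint by blast

lemma At_bounded: "A \<in> At n \<Longrightarrow> bounded A"
  using At_subset compact_domain compact_imp_bounded bounded_subset by metis

lemma At_measurable: "A \<in> At n \<Longrightarrow> A \<in> lmeasurable"
  using convex_atom At_bounded measurable_convex by blast

lemma domain_measurable: "\<Omega> \<in> lmeasurable"
  using compact_domain by (rule lmeasurable_compact)

text \<open>The share of the parent's volume that comparability of siblings guarantees to each
  child.\<close>

definition c1 :: real where "c1 = c0 / (1 + c0)"

lemma c1_pos: "0 < c1" and c1_less_1: "c1 < 1"
  using c0_pos unfolding c1_def by (auto simp: field_simps)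

lemma children:
  assumes A: "A \<in> At n"
  obtains A' A'' where "A' \<in> At (Suc n)" "A'' \<in> At (Suc n)" "A' \<union> A'' = A" "A' \<inter> A'' = {}"
    "c1 * vol A \<le> vol A'" "c1 * vol A \<le> vol A''" "vol A = vol A' + vol A''" "0 < vol A'" "0 < vol A''"
proof -
  obtain A' A'' where s: "siblings (F (Suc n)) A A' A''"
    using binary A unfolding binary_filtration_def by blast
  then have At: "A' \<in> At (Suc n)" "A'' \<in> At (Suc n)" and u: "A' \<union> A'' = A" "A' \<inter> A'' = {}"
    and le: "vol A' \<le> vol A''" and pos: "0 < vol A'"
    unfolding siblings_def by auto
  have sum: "vol A = vol A' + vol A''"
    using measure_Un3[OF At_measurable[OF At(1)] At_measurable[OF At(2)]] u by simp
  have c: "c0 * vol A'' \<le> vol A'" using comparable[OF A s] by simp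
  have "c0 * vol A \<le> (1 + c0) * vol A'" using c sum by (simp add: algebra_simps)
  then have 1: "c1 * vol A \<le> vol A'"
    unfolding c1_def using c0_pos by (simp add: field_simps)
  then show ?thesis using that[OF At u 1 _ sum pos] le pos by auto
qed

lemma children_eq:
  assumes "A \<in> At n" "A' \<in> At (Suc n)" "A'' \<in> At (Suc n)" "A' \<union> A'' = A"
  shows "{B \<in> At (Suc n). B \<subseteq> A} = {A', A''}"
proof -
  have "B = A' \<or> B = A''" if B: "B \<in> At (Suc n)" "B \<subseteq> A" for B
  proof -
    obtain x where "x \<in> B" using At_nonempty[OF B(1)] by blast
    then show ?thesis using At_eq[OF B(1)] assms B(2) by blast
  qed
  then show ?thesis using assms by blast
qed

lemma At_cover: "\<Union>(At n) = \<Omega>"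
proof (induction n)
  case 0
  then show ?case by (simp add: At_0)
next
  case (Suc n)
  have "\<Omega> \<subseteq> \<Union>(At (Suc n))"
  proof
    fix x assume "x \<in> \<Omega>"
    then obtain A where A: "A \<in> At n" "x \<in> A" using Suc by blast
    then show "x \<in> \<Union>(At (Suc n))" using children[OF A(1)] by (metis UnE UnionI)
  qed
  then show ?case using At_subset by blast
qed

text \<open>The upper bound comes from the sibling, which takes at least the share
  \<open>c1\<close>.\<close>

lemma parent:
  assumes B: "B \<in> At (Suc n)"
  obtains A where "A \<in> At n" "B \<subseteq> A" "c1 * vol A \<le> vol B" "vol B \<le> (1 - c1) * vol A" "0 < vol B"
proof -
  obtain x where x: "x \<in> B" using At_nonempty[OF B] by blast
  then have "x \<in> \<Union>(At n)" using At_subset[OF B] At_cover by blast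
  then obtain A where A: "A \<in> At n" "x \<in> A" by blast
  from children[OF A(1)] obtain A' A'' where
    c: "A' \<in> At (Suc n)" "A'' \<in> At (Suc n)" "A' \<union> A'' = A" "c1 * vol A \<le> vol A'" "c1 * vol A \<le> vol A''"
    "vol A = vol A' + vol A''" "0 < vol A'" "0 < vol A''" by metis
  have "B = A' \<or> B = A''" using At_eq[OF B] c(1,2,3) x A(2) by blast
  then show ?thesis
    using that[OF A(1)] c by (elim disjE) (simp_all add: left_diff_distrib Un_upper1 Un_upper2, (blast | simp)+)
qed

lemma vol_pos: "A \<in> At n \<Longrightarrow> 0 < vol A"
proof (cases n)
  case 0
  assume "A \<in> At n" then show ?thesis using 0 measure_domain by (simp add: At_0)
next
  case (Suc m)
  assume "A \<in> At n" then show ?thesis using parent[of A m] Suc by metis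
qed

lemma finite_At [simp]: "finite (At n)"
proof (induction n)
  case 0
  then show ?case by (simp add: At_0)
next
  case (Suc n)
  have "At (Suc n) \<subseteq> (\<Union>A\<in>At n. {B \<in> At (Suc n). B \<subseteq> A})"
    using parent by blast
  moreover have "finite {B \<in> At (Suc n). B \<subseteq> A}" if "A \<in> At n" for A
  proof -
    from children[OF that] obtain A' A'' where "A' \<in> At (Suc n)" "A'' \<in> At (Suc n)" "A' \<union> A'' = A" by metis
    from children_eq[OF that this] show ?thesis by simp
  qed
  ultimately show ?case using Suc by (auto intro: finite_subset)
qed

lemma ancestor:
  assumes "B \<in> At (n + k)"
  obtains A where "A \<in> At n" "B \<subseteq> A"
proof -
  have "\<exists>A\<in>At n. B \<subseteq> A"
    using assms
  proof (induction k arbitrary: B)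
    case 0
    then show ?case by auto
  next
    case (Suc k)
    then have "B \<in> At (Suc (n + k))" by simp
    from parent[OF this] obtain A where "A \<in> At (n + k)" "B \<subseteq> A" by metis
    from Suc.IH[OF this(1)] obtain D where "D \<in> At n" "A \<subseteq> D" by (elim bexE)
    with \<open>B \<subseteq> A\<close> show ?case by (intro bexI[of _ D]) auto
  qed
  then obtain A where "A \<in> At n" "B \<subseteq> A" by (elim bexE)
  then show ?thesis by (rule that)
qed

lemma ancestor_le:
  assumes "B \<in> At m" "n \<le> m"
  obtains A where "A \<in> At n" "B \<subseteq> A"
  using ancestor[of B n "m - n"] assms by auto

lemma nested_or_disjoint:
  assumes "A \<in> At n" "B \<in> At m" "n \<le> m" "x \<in> A" "x \<in> B"
  shows "B \<subseteq> A"
proof -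
  obtain A1 where "A1 \<in> At n" "B \<subseteq> A1" using ancestor_le assms by blast
  moreover have "A1 = A" using At_eq[OF \<open>A1 \<in> At n\<close> assms(1)] \<open>B \<subseteq> A1\<close> assms by blast
  ultimately show ?thesis by simp
qed

lemma vol_descendant:
  assumes "A \<in> At n" "B \<in> At (n + k)" "B \<subseteq> A"
  shows "c1 ^ k * vol A \<le> vol B" "vol B \<le> (1 - c1) ^ k * vol A"
proof -
  have "c1 ^ k * vol A \<le> vol B \<and> vol B \<le> (1 - c1) ^ k * vol A"
    using assms(2,3)
  proof (induction k arbitrary: B)
    case 0
    then have "B = A" using At_disjoint[OF assms(1)] At_nonempty by (metis add_0_right inf.absorb2)
    then show ?case by simp
  next
    case (Suc k)
    then have "B \<in> At (Suc (n + k))" by simp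
    from parent[OF this] obtain D where D: "D \<in> At (n + k)" "B \<subseteq> D" "c1 * vol D \<le> vol B" "vol B \<le> (1 - c1) * vol D"
      by metis
    obtain x where x: "x \<in> B" using At_nonempty[OF Suc.prems(1)] by blast
    have "D \<subseteq> A" using nested_or_disjoint[OF assms(1) D(1), of x] x D(2) Suc.prems by auto
    then have IH: "c1 ^ k * vol A \<le> vol D" "vol D \<le> (1 - c1) ^ k * vol A" using Suc.IH D by auto
    have "c1 * (c1 ^ k * vol A) \<le> c1 * vol D" using IH c1_pos by (intro mult_left_mono) auto
    moreover have "(1 - c1) * vol D \<le> (1 - c1) * ((1 - c1) ^ k * vol A)"
      using IH c1_less_1 by (intro mult_left_mono) auto
    ultimately show ?case using D by (simp add: algebra_simps)
  qed
  then show "c1 ^ k * vol A \<le> vol B" "vol B \<le> (1 - c1) ^ k * vol A" by auto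
qed

lemma vol_At_le: "A \<in> At n \<Longrightarrow> vol A \<le> (1 - c1) ^ n"
  using vol_descendant(2)[of \<Omega> 0 A n] At_0 At_subset measure_domain by simp

lemma Union_descendants:
  assumes "A \<in> At n" "n \<le> m"
  shows "\<Union>{B \<in> At m. B \<subseteq> A} = A"
proof -
  have "x \<in> \<Union>{B \<in> At m. B \<subseteq> A}" if "x \<in> A" for x
  proof -
    have "x \<in> \<Union>(At m)" using that At_subset[OF assms(1)] At_cover by blast
    then obtain B where "B \<in> At m" "x \<in> B" by blast
    then show ?thesis using nested_or_disjoint[OF assms(1) _ assms(2) that] by blast
  qed
  then show ?thesis by blast
qed

lemma disjoint_At: "disjoint {B \<in> At m. P B}"
  unfolding disjoint_def using At_disjoint by blast

lemma bdd_meas_At: "bdd_meas \<Omega> h \<Longrightarrow> A \<in> At n \<Longrightarrow> bdd_meas A h"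
  using bdd_meas_subset At_subset by blast

lemma Int_on_descendants:
  assumes "A \<in> At n" "n \<le> m" "bdd_meas \<Omega> h"
  shows "Int_on A h = (\<Sum>B\<in>{B \<in> At m. B \<subseteq> A}. Int_on B h)"
proof -
  have "Int_on (\<Union>{B \<in> At m. B \<subseteq> A}) h = (\<Sum>B\<in>{B \<in> At m. B \<subseteq> A}. Int_on B h)"
  proof (rule Int_on_finite_Union)
    show "bdd_meas (\<Union>{B \<in> At m. B \<subseteq> A}) h"
      using bdd_meas_At[OF assms(3,1)] by (simp only: Union_descendants[OF assms(1,2)])
    show "B \<in> lmeasurable" if "B \<in> {B \<in> At m. B \<subseteq> A}" for B using that At_measurable[of B m] by simp
  qed (simp_all add: disjoint_At)
  then show ?thesis by (simp only: Union_descendants[OF assms(1,2)])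
qed

lemma vol_descendants:
  assumes "A \<in> At n" "n \<le> m"
  shows "vol A = (\<Sum>B\<in>{B \<in> At m. B \<subseteq> A}. vol B)"
proof -
  have "vol A = Int_on A (\<lambda>x. 1)" using Int_on_const[OF At_measurable[OF assms(1)], of 1] by simp
  also have "\<dots> = (\<Sum>B\<in>{B \<in> At m. B \<subseteq> A}. Int_on B (\<lambda>x. 1))"
    by (rule Int_on_descendants[OF assms bdd_meas_const])
  also have "\<dots> = (\<Sum>B\<in>{B \<in> At m. B \<subseteq> A}. vol B)"
  proof (rule sum.cong[OF refl])
    fix B assume "B \<in> {B \<in> At m. B \<subseteq> A}"
    then show "Int_on B (\<lambda>x. 1) = vol B" using Int_on_const[OF At_measurable[of B m], of 1] by simp
  qed
  finally show ?thesis .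
qed

section \<open>The atom containing a point, and conditional expectation as a mean\<close>

definition atom_at :: "nat \<Rightarrow> 'a \<Rightarrow> 'a set" where "atom_at n x = (THE A. A \<in> At n \<and> x \<in> A)"

lemma at_eq:
  assumes "A \<in> At n" "x \<in> A"
  shows "atom_at n x = A"
  unfolding atom_at_def using assms At_eq by (intro the_equality) auto

lemma at_At: "x \<in> \<Omega> \<Longrightarrow> atom_at n x \<in> At n" and in_at: "x \<in> \<Omega> \<Longrightarrow> x \<in> atom_at n x"
  using At_cover[of n] at_eq by blast+

lemma at_mono:
  assumes "x \<in> \<Omega>" "n \<le> m"
  shows "atom_at m x \<subseteq> atom_at n x"
  using nested_or_disjoint[OF at_At at_At] assms in_at by blast

lemma bdd_meas_piecewise:
  assumes "\<And>A. A \<in> At n \<Longrightarrow> \<exists>p. bdd_meas \<Omega> p \<and> (\<forall>x\<in>A. h x = p x)"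
  shows "bdd_meas \<Omega> h"
proof -
  obtain p where p: "\<And>A. A \<in> At n \<Longrightarrow> bdd_meas \<Omega> (p A)" "\<And>A x. A \<in> At n \<Longrightarrow> x \<in> A \<Longrightarrow> h x = p A x"
    using assms by metis
  have "bdd_meas \<Omega> (\<lambda>x. \<Sum>A\<in>At n. indicat_real A x * p A x)"
    using p(1) At_measurable by (intro bdd_meas_sum bdd_meas_mult bdd_meas_indicator) auto
  moreover have "(\<Sum>A\<in>At n. indicat_real A x * p A x) = h x" if "x \<in> \<Omega>" for x
  proof -
    have "(\<Sum>A\<in>At n. indicat_real A x * p A x) = (\<Sum>A\<in>{atom_at n x}. indicat_real A x * p A x)"
      using at_eq[of _ n x] at_At[OF that, of n] by (intro sum.mono_neutral_right) (auto simp: indicator_def)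
    also have "\<dots> = h x" using p(2)[OF at_At[OF that] in_at[OF that]] in_at[OF that] by simp
    finally show ?thesis .
  qed
  ultimately show ?thesis by (subst bdd_meas_cong[of _ _ "\<lambda>x. \<Sum>A\<in>At n. indicat_real A x * p A x"]) auto
qed

lemma sets_F: "sets (F n) \<subseteq> sets lebesgue"
proof (cases n)
  case 0
  then show ?thesis using binary domain_measurable unfolding binary_filtration_def by auto
next
  case (Suc m)
  then have "sets (F n) = sigma_sets \<Omega> (At n)" using binary unfolding binary_filtration_def by blast
  also have "\<dots> \<subseteq> sets lebesgue"
    using At_measurable domain_measurable by (intro sets.sigma_sets_subset') auto
  finally show ?thesis .
qed

text \<open>A function measurable for \<open>F n\<close> is constant on atoms, since a level set
  meets an atom in a member of \<open>sets (F n)\<close>. So the identity holds at every point,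
  without an exceptional null set.\<close>

lemma cexp_eq_mean:
  assumes A: "A \<in> At n" and x: "x \<in> A" and g: "bdd_meas \<Omega> g"
  shows "cexp \<Omega> F n g x = Int_on A g / vol A"
proof -
  have sub: "subalgebra (lebesgue_on \<Omega>) (F n)"
    unfolding subalgebra_def
  proof (intro conjI subsetI)
    fix B assume B: "B \<in> sets (F n)"
    then have "B \<subseteq> \<Omega>" using sets.sets_into_space[OF B] by (simp add: space_F)
    then show "B \<in> sets (lebesgue_on \<Omega>)"
      using B sets_F domain_measurable by (subst sets_restrict_space_iff) auto
  qed (simp add: space_F space_restrict_space)
  interpret finite_measure "lebesgue_on \<Omega>" using domain_measurable by (rule finite_measure_lebesgue_on)
  interpret finite_measure_subalgebra "lebesgue_on \<Omega>" "F n" by unfold_locales (rule sub)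
  let ?h = "cexp \<Omega> F n g"
  have AF: "A \<in> sets (F n)" using A unfolding atoms_def by blast
  have "?h \<in> borel_measurable (F n)" unfolding cexp_def by simp
  then have "?h -` {?h x} \<inter> space (F n) \<in> sets (F n)" by (rule measurable_sets) auto
  then have "?h -` {?h x} \<inter> space (F n) \<inter> A \<in> sets (F n)" using AF by blast
  moreover have "x \<in> ?h -` {?h x} \<inter> space (F n) \<inter> A" using x At_subset[OF A] by (auto simp: space_F)
  ultimately have "?h -` {?h x} \<inter> space (F n) \<inter> A = A"
    by (intro At_minimal[OF A]) auto
  then have const: "\<And>y. y \<in> A \<Longrightarrow> ?h y = ?h x" by blast
  have restr: "(LINT y:A|lebesgue_on \<Omega>. k y) = Int_on A k" for k :: "'a \<Rightarrow> real"
    unfolding set_lebesgue_integral_def using domain_measurable At_subset[OF A]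
    by (subst integral_restrict_space) (auto simp: indicator_def intro!: Bochner_Integration.integral_cong)
  have "integrable (lebesgue_on \<Omega>) g"
    using bdd_meas_integrable[OF g domain_measurable] domain_measurable
    by (simp add: set_integrable_def integrable_restrict_space)
  from real_cond_exp_intA[OF this AF] have "Int_on A g = Int_on A ?h"
    unfolding restr cexp_def .
  also have "\<dots> = Int_on A (\<lambda>y. ?h x)" using const by (rule Int_on_cong)
  also have "\<dots> = ?h x * vol A" by (rule Int_on_const[OF At_measurable[OF A]])
  finally show ?thesis using vol_pos[OF A] by simp
qed

subsection \<open>Sizes and shapes of atoms\<close>

lemma diameter_pos:
  assumes "A \<in> At n"
  shows "0 < diameter A"
proof (rule ccontr)
  assume "\<not> 0 < diameter A"
  then have d: "diameter A = 0" using diameter_ge_0[OF At_bounded[OF assms]] by simp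
  obtain x where x: "x \<in> A" using At_nonempty[OF assms] by blast
  have "A \<subseteq> {x}"
  proof
    fix y assume "y \<in> A"
    then have "dist x y \<le> 0" using diameter_bounded_bound[OF At_bounded[OF assms] x] d by metis
    then show "y \<in> {x}" by simp
  qed
  then have "negligible A" using negligible_sing negligible_subset by blast
  then have "vol A = 0" by (rule negligible_imp_measure0)
  then show False using vol_pos[OF assms] by simp
qed

text \<open>Radius, relative to the diameter, of the ball that \<open>inscribed_ball\<close>
  provides in an atom of width at least \<open>c4 * diameter A\<close>.\<close>

definition c5 :: real where "c5 = c4 / 2 ^ (DIM('a) + 2)"

lemma c5_pos: "0 < c5"
  unfolding c5_def using c4_pos by simp

lemma atom_contains_ball:
  assumes "A \<in> At n"
  obtains c where "ball c (c5 * diameter A) \<subseteq> A"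
proof -
  obtain c where "ball c (width A / 2 ^ (DIM('a) + 2)) \<subseteq> A"
    using inscribed_ball convex_atom At_bounded At_measurable vol_pos assms by metis
  moreover have "c5 * diameter A \<le> width A / 2 ^ (DIM('a) + 2)"
    unfolding c5_def using fat[OF assms] by (simp add: divide_right_mono)
  then have "ball c (c5 * diameter A) \<subseteq> ball c (width A / 2 ^ (DIM('a) + 2))" by (rule subset_ball)
  ultimately have "ball c (c5 * diameter A) \<subseteq> A" by blast
  then show ?thesis by (rule that)
qed

definition V :: real where "V = unit_ball_vol (real DIM('a))"

lemma V_pos: "0 < V" unfolding V_def by simp

lemma vol_ball: "0 \<le> r \<Longrightarrow> vol (ball (c::'a) r) = V * r ^ DIM('a)"
  unfolding V_def using content_ball by simp

lemma vol_cball: "0 \<le> r \<Longrightarrow> vol (cball (c::'a) r) = V * r ^ DIM('a)"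
  unfolding V_def using content_cball by simp

lemma vol_ge_diameter:
  assumes "A \<in> At n"
  shows "V * (c5 * diameter A) ^ DIM('a) \<le> vol A"
proof -
  obtain c where c: "ball c (c5 * diameter A) \<subseteq> A" using atom_contains_ball[OF assms] .
  have "vol (ball c (c5 * diameter A)) \<le> vol A"
    using c At_measurable[OF assms] by (intro measure_mono_fmeasurable) auto
  then show ?thesis using vol_ball[of "c5 * diameter A" c] c5_pos diameter_pos[OF assms] by simp
qed

lemma vol_le_diameter:
  assumes "A \<in> At n"
  shows "vol A \<le> V * diameter A ^ DIM('a)"
proof -
  obtain x where x: "x \<in> A" using At_nonempty[OF assms] by blast
  have "A \<subseteq> cball x (diameter A)"
    using diameter_bounded_bound[OF At_bounded[OF assms] x] by auto
  then have "vol A \<le> vol (cball x (diameter A))"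
    using At_measurable[OF assms] by (intro measure_mono_fmeasurable) auto
  then show ?thesis using vol_cball[of "diameter A" x] diameter_pos[OF assms] by simp
qed

text \<open>The descendant containing the centre of the inscribed ball is taken. Volumes shrink
  geometrically and for fat atoms the volume controls the diameter, so \<open>m\<close> levels
  deeper the diameter is at most half the radius of the ball, whatever the atom.\<close>

lemma interior_descendant:
  obtains m where "0 < m" "\<And>n A. A \<in> At n \<Longrightarrow> \<exists>B\<in>At (n + m). B \<subseteq> A \<and> closure B \<subseteq> A"
proof -
  let ?d = "DIM('a)"
  have "(\<lambda>m. (1 - c1) ^ m) \<longlonglongrightarrow> 0" using c1_pos c1_less_1 by (intro LIMSEQ_power_zero) auto
  then have "\<forall>\<^sub>F m in sequentially. (1 - c1) ^ m < (c5 * c5 / 2) ^ ?d"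
    using c5_pos by (intro order_tendstoD) auto
  then obtain m0 where m0: "\<And>m. m \<ge> m0 \<Longrightarrow> (1 - c1) ^ m < (c5 * c5 / 2) ^ ?d"
    unfolding eventually_sequentially by blast
  define m where "m = Suc m0"
  \<comment> \<open>One factor \<open>c5\<close> is lost in passing from volume to diameter;
    \<open>c5 / 2\<close> is the size aimed at, relative to \<open>diameter A\<close>.\<close>
  have m: "(1 - c1) ^ m < (c5 * c5 / 2) ^ ?d" unfolding m_def by (rule m0) simp
  have "\<exists>B\<in>At (n + m). B \<subseteq> A \<and> closure B \<subseteq> A" if A: "A \<in> At n" for n A
  proof -
    let ?D = "diameter A"
    obtain c where c: "ball c (c5 * ?D) \<subseteq> A" using atom_contains_ball[OF A] .
    have D: "0 < ?D" by (rule diameter_pos[OF A])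
    have cA: "c \<in> A" using c D c5_pos by auto
    then have c\<Omega>: "c \<in> \<Omega>" using At_subset[OF A] by blast
    define B where "B = atom_at (n + m) c"
    have B: "B \<in> At (n + m)" "c \<in> B" using at_At[OF c\<Omega>] in_at[OF c\<Omega>] by (auto simp: B_def)
    have BA: "B \<subseteq> A" using nested_or_disjoint[OF A B(1) _ cA B(2)] by simp
    have "V * (c5 * diameter B) ^ ?d \<le> vol B" by (rule vol_ge_diameter[OF B(1)])
    also have "\<dots> \<le> (1 - c1) ^ m * vol A" by (rule vol_descendant(2)[OF A B(1) BA])
    also have "\<dots> \<le> (c5 * c5 / 2) ^ ?d * (V * ?D ^ ?d)"
      using m vol_le_diameter[OF A] c5_pos vol_pos[OF A] by (intro mult_mono) auto
    also have "\<dots> = V * (c5 * (c5 * ?D / 2)) ^ ?d" by (simp add: power_mult_distrib power_divide)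
    finally have "(c5 * diameter B) ^ ?d \<le> (c5 * (c5 * ?D / 2)) ^ ?d" using V_pos by simp
    then have "c5 * diameter B \<le> c5 * (c5 * ?D / 2)"
      using c5_pos D by (subst (asm) power_mono_iff) (auto simp: diameter_ge_0[OF At_bounded[OF B(1)]])
    then have dB: "diameter B \<le> c5 * ?D / 2" using c5_pos by simp
    have "B \<subseteq> cball c (diameter B)"
      using diameter_bounded_bound[OF At_bounded[OF B(1)] B(2)] by auto
    then have "closure B \<subseteq> cball c (diameter B)" by (rule closure_minimal) auto
    also have "\<dots> \<subseteq> ball c (c5 * ?D)"
    proof
      fix x assume "x \<in> cball c (diameter B)"
      then have "dist c x \<le> c5 * ?D / 2" using dB by simp
      moreover have "0 < c5 * ?D" using D c5_pos by simp
      ultimately have "dist c x < c5 * ?D" by linarith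
      then show "x \<in> ball c (c5 * ?D)" by simp
    qed
    also have "\<dots> \<subseteq> A" by (rule c)
    finally show ?thesis using B BA by blast
  qed
  then show ?thesis using that[of m] by (simp add: m_def)
qed

end

section \<open>Orthogonal projection in finite dimension\<close>

text \<open>Gram-Schmidt over the generating set, for the bilinear form that sums over
  \<open>X\<close> only. The form may be degenerate, so a vector of norm zero receives the
  coefficient 0.\<close>

lemma ex_projection_finite:
  fixes T :: "('i \<Rightarrow> real) set"
  assumes "finite X" "finite T"
  shows "\<exists>w\<in>span T. \<forall>h\<in>span T. (\<Sum>i\<in>X. (v i - w i) * h i) = 0"
proof -
  define ip where "ip x y = (\<Sum>i\<in>X. x i * y i)" for x y :: "'i \<Rightarrow> real"
  have ip_add: "ip x (y + z) = ip x y + ip x z" "ip (x + y) z = ip x z + ip y z" for x y z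
    by (simp_all add: ip_def algebra_simps sum.distrib)
  have ip_diff: "ip x (y - z) = ip x y - ip x z" "ip (x - y) z = ip x z - ip y z" for x y z
    by (simp_all add: ip_def algebra_simps sum_subtractf)
  have ip_scale: "ip x (c *\<^sub>R y) = c * ip x y" "ip (c *\<^sub>R x) y = c * ip x y" for x y c
    by (simp_all add: ip_def scaleR_fun_def sum_distrib_left mult_ac)
  have ip_zero: "ip x 0 = 0" for x by (simp add: ip_def)
  have span: "ip x h = 0" if "\<And>h. h \<in> T' \<Longrightarrow> ip x h = 0" "h \<in> span T'" for x h T'
    using that(2)
  proof (induction rule: span_induct_alt)
    case base
    show ?case by (rule ip_zero)
  next
    case (step c y z)
    then show ?case using that(1)[of y] by (simp only: ip_add ip_scale mult_zero_right add_0_right)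
  qed
  have "\<forall>v. \<exists>w\<in>span T. \<forall>h\<in>T. ip (v - w) h = 0"
    using assms(2)
  proof (induction T rule: finite_induct)
    case empty
    then show ?case by simp
  next
    case (insert a T)
    have sub: "span T \<subseteq> span (insert a T)" by (rule span_mono) blast
    obtain wa where wa: "wa \<in> span T" "\<And>h. h \<in> T \<Longrightarrow> ip (a - wa) h = 0" using insert.IH by blast
    define a' where "a' = a - wa"
    have a'T: "ip a' h = 0" if "h \<in> T" for h using wa(2) that by (simp add: a'_def)
    have aa: "a = a' + wa" by (simp add: a'_def)
    have comm: "ip x y = ip y x" for x y by (simp add: ip_def mult.commute)
    show ?case
    proof
      fix v
      obtain w0 where w0: "w0 \<in> span T" "\<And>h. h \<in> T \<Longrightarrow> ip (v - w0) h = 0" using insert.IH by blast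
      define t where "t = (if ip a' a' = 0 then 0 else ip (v - w0) a' / ip a' a')"
      define w where "w = w0 + t *\<^sub>R a'"
      have "a' \<in> span (insert a T)"
        unfolding a'_def using wa(1) sub by (intro span_diff) (auto intro: span_base)
      then have "w \<in> span (insert a T)"
        unfolding w_def using w0(1) sub by (intro span_add span_scale) auto
      moreover have wT: "ip (v - w) h = 0" if "h \<in> T" for h
        using w0(2)[OF that] a'T[OF that] by (simp add: w_def ip_diff ip_add ip_scale)
      moreover have "ip (v - w) a = 0"
      proof -
        have wwa: "ip (v - w) wa = 0" using span[of T, OF wT wa(1)] .
        have "ip (v - w) a' = 0"
        proof (cases "ip a' a' = 0")
          case True
          then have "(\<Sum>i\<in>X. (a' i)\<^sup>2) = 0" by (simp add: ip_def power2_eq_square)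
          then have "\<forall>i\<in>X. a' i = 0" using assms(1) by (simp add: sum_nonneg_eq_0_iff)
          then show ?thesis by (simp add: ip_def)
        next
          case False
          then show ?thesis by (simp add: w_def ip_diff ip_add ip_scale t_def)
        qed
        then show ?thesis using wwa by (subst aa) (simp add: ip_add)
      qed
      ultimately show "\<exists>w\<in>span (insert a T). \<forall>h\<in>insert a T. ip (v - w) h = 0" by blast
    qed
  qed
  then obtain w where "w \<in> span T" "\<And>h. h \<in> T \<Longrightarrow> ip (v - w) h = 0" by blast
  then show ?thesis using span[of T "v - w"] unfolding ip_def by (intro bexI[of _ w]) auto
qed

text \<open>Functions vanishing off the finite set \<open>X\<close> lie in the span of unit vectors,
  which makes a basis of \<open>W\<close> finite.\<close>

lemma ex_projection:
  fixes W :: "('i \<Rightarrow> real) set"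
  assumes "finite X" "subspace W" "\<And>h i. h \<in> W \<Longrightarrow> i \<notin> X \<Longrightarrow> h i = 0"
  shows "\<exists>w\<in>W. \<forall>h\<in>W. (\<Sum>i\<in>X. (v i - w i) * h i) = 0"
proof -
  define e where "e i = (\<lambda>j. if j = i then 1 else 0 :: real)" for i :: 'i
  have "W \<subseteq> span (e ` X)"
  proof
    fix h assume h: "h \<in> W"
    have "h j = (\<Sum>i\<in>X. h i *\<^sub>R e i) j" for j
    proof -
      have "(\<Sum>i\<in>X. h i *\<^sub>R e i) j = (\<Sum>i\<in>X. h i * (if j = i then 1 else 0))"
        by (induction X rule: infinite_finite_induct) (simp_all add: scaleR_fun_def e_def)
      also have "\<dots> = h j" using assms(1) assms(3)[OF h] by (simp add: if_distrib cong: if_cong)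
      finally show ?thesis by simp
    qed
    then have "h = (\<Sum>i\<in>X. h i *\<^sub>R e i)" by (rule ext)
    moreover have "(\<Sum>i\<in>X. h i *\<^sub>R e i) \<in> span (e ` X)"
      by (intro span_sum span_scale span_base) auto
    ultimately show "h \<in> span (e ` X)" by simp
  qed
  moreover obtain T where T: "T \<subseteq> W" "independent T" "W \<subseteq> span T" by (rule maximal_independent_subset)
  ultimately have "finite T" using independent_span_bound[of "e ` X" T] assms(1) by auto
  moreover have "span T = W" using T assms(2) by (simp add: span_minimal subset_antisym)
  ultimately show ?thesis using ex_projection_finite[OF assms(1), of T v] by simp
qed

section \<open>Multipliers\<close>

lemma real_polynomial_function_continuous:
  "real_polynomial_function p \<Longrightarrow> continuous_on UNIV p"
  by (induction rule: real_polynomial_function.induct)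
    (auto intro: linear_continuous_on continuous_intros)

lemma real_polynomial_function_span:
  assumes "\<And>g. g \<in> B \<Longrightarrow> real_polynomial_function g" "g \<in> span B"
  shows "real_polynomial_function g"
  using assms(2)
proof (induction rule: span_induct_alt)
  case base
  then show ?case unfolding zero_fun_def by (rule real_polynomial_function.intros(2))
next
  case (step c x y)
  have eq: "c *\<^sub>R x + y = (\<lambda>z. c * x z + y z)" by (simp add: fun_eq_iff scaleR_fun_def)
  show ?case unfolding eq
    by (rule real_polynomial_function.intros(3)[OF real_polynomial_function.intros(4)[OF
          real_polynomial_function.intros(2) assms(1)[OF step(1)]] step(2)])
qed

section \<open>Local polynomial spaces and the multiplier of a single atom\<close>

locale polynomial_tree = atom_tree +
  fixes S :: "('a \<Rightarrow> real) set" and l0 :: nat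
  assumes poly_S: "\<And>g. g \<in> S \<Longrightarrow> real_polynomial_function g"
    and finite_span_S: "\<exists>B. finite B \<and> S = span B"
    and one_in_S: "(\<lambda>x. 1) \<in> S"
    and resolving: "\<And>k. k \<ge> l0 \<Longrightarrow> sign_resolving F S k"
begin

abbreviation "S2 \<equiv> square_space S"
abbreviation "l \<equiv> sparsity_index S l0"

lemma resolving_l: "sign_resolving F S l"
proof -
  have "\<exists>k. k \<ge> l0 \<and> 2 ^ (k + 1) \<ge> dim S + dim S2"
    by (rule exI[of _ "max l0 (dim S + dim S2)"])
      (metis less_exp less_imp_le_nat max.cobounded1 max.cobounded2 order_trans power_increasing le_add1 one_le_numeral)
  then have "l \<ge> l0" unfolding sparsity_index_def by (rule LeastI2_ex) simp
  then show ?thesis by (rule resolving)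
qed

lemma subspace_S: "subspace S"
  using finite_span_S subspace_span by metis

lemma S_add: "p \<in> S \<Longrightarrow> q \<in> S \<Longrightarrow> (\<lambda>x. p x + q x) \<in> S"
  using subspace_add[OF subspace_S, of p q] by (simp add: plus_fun_def)

lemma S_diff: "p \<in> S \<Longrightarrow> q \<in> S \<Longrightarrow> (\<lambda>x. p x - q x) \<in> S"
  using subspace_diff[OF subspace_S, of p q] by (simp add: fun_diff_def)

lemma S_scale: "p \<in> S \<Longrightarrow> (\<lambda>x. c * p x) \<in> S"
  using subspace_scale[OF subspace_S, of p c] by (simp add: scaleR_fun_def)

lemma S_const: "(\<lambda>x. c) \<in> S"
  using S_scale[OF one_in_S, of c] by simp

lemma S2_add: "p \<in> S2 \<Longrightarrow> q \<in> S2 \<Longrightarrow> (\<lambda>x. p x + q x) \<in> S2"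
  unfolding square_space_def using span_add[of p _ q] by (simp add: plus_fun_def)

lemma S2_diff: "p \<in> S2 \<Longrightarrow> q \<in> S2 \<Longrightarrow> (\<lambda>x. p x - q x) \<in> S2"
  unfolding square_space_def using span_diff[of p _ q] by (simp add: fun_diff_def)

lemma S2_scale: "p \<in> S2 \<Longrightarrow> (\<lambda>x. c * p x) \<in> S2"
  unfolding square_space_def using span_scale[of p _ c] by (simp add: scaleR_fun_def)

lemma S2_zero: "(\<lambda>x. 0) \<in> S2"
  unfolding square_space_def zero_fun_def[symmetric] by (rule span_zero)

lemma S2_mult: "p \<in> S \<Longrightarrow> q \<in> S \<Longrightarrow> (\<lambda>x. p x * q x) \<in> S2"
  unfolding square_space_def by (rule span_base) blast

lemma S_in_S2: "p \<in> S \<Longrightarrow> p \<in> S2"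
  using S2_mult[OF _ one_in_S] by simp

lemma poly_S2: "u \<in> S2 \<Longrightarrow> real_polynomial_function u"
  unfolding square_space_def
  by (rule real_polynomial_function_span) (auto intro: poly_S)

lemma continuous_S2: "u \<in> S2 \<Longrightarrow> continuous_on UNIV u"
  using poly_S2 real_polynomial_function_continuous by blast

lemma bdd_S2: "u \<in> S2 \<Longrightarrow> bdd_meas \<Omega> u"
  using continuous_S2 compact_domain compact_imp_bounded bdd_meas_continuous by blast

lemma bdd_S: "u \<in> S \<Longrightarrow> bdd_meas \<Omega> u"
  using bdd_S2 S_in_S2 by blast

text \<open>A common degree bound for \<open>S2\<close>, which contains \<open>S\<close>; the Remez
  constants are taken for this degree.\<close>

definition N :: nat where "N = (SOME N. \<forall>u\<in>S2. line_poly N u)"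

lemma line_poly_S2: "u \<in> S2 \<Longrightarrow> line_poly N u"
proof -
  obtain B where B: "finite B" "S = span B" using finite_span_S by blast
  then obtain M where M: "\<forall>g\<in>S. line_poly M g"
    using line_poly_span[of B] poly_S span_base by metis
  have "line_poly (M + M) u" if "u \<in> S2" for u
    using that unfolding square_space_def
  proof (induction rule: span_induct_alt)
    case base
    then show ?case using line_poly_const[of _ 0] by (simp add: zero_fun_def)
  next
    case (step c x y)
    have eq: "c *\<^sub>R x + y = (\<lambda>z. c * x z + y z)" by (simp add: fun_eq_iff scaleR_fun_def)
    have "line_poly (M + M) x" using step(1) M line_poly_mult by blast
    then show ?case unfolding eq using step(2) by (intro line_poly_add line_poly_cmult)
  qed
  then have "\<forall>u\<in>S2. line_poly N u" unfolding N_def by (intro someI_ex[of "\<lambda>N. \<forall>u\<in>S2. line_poly N u"]) blast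
  then show "u \<in> S2 \<Longrightarrow> line_poly N u" by blast
qed

text \<open>Each descendant has at least the share \<open>c1 ^ k\<close> of the volume. Their number
  is the loss in Cauchy-Schwarz when the multipliers are built.\<close>

lemma card_descendants:
  assumes "A \<in> At n"
  shows "card {B \<in> At (n + k). B \<subseteq> A} * c1 ^ k \<le> 1"
proof -
  have "(\<Sum>B\<in>{B \<in> At (n + k). B \<subseteq> A}. c1 ^ k * vol A) \<le> (\<Sum>B\<in>{B \<in> At (n + k). B \<subseteq> A}. vol B)"
    by (rule sum_mono) (use vol_descendant(1)[OF assms] in blast)
  also have "\<dots> = vol A" using vol_descendants[OF assms, of "n + k"] by simp
  finally have "(card {B \<in> At (n + k). B \<subseteq> A} * c1 ^ k) * vol A \<le> 1 * vol A" by (simp add: mult_ac)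
  then show ?thesis using mult_le_cancel_right_pos[OF vol_pos[OF assms]] by blast
qed

lemma descendants_children:
  assumes "A \<in> At n" "A' \<in> At (Suc n)" "A'' \<in> At (Suc n)" "A' \<union> A'' = A" "A' \<inter> A'' = {}" "Suc n \<le> m"
  shows "{B \<in> At m. B \<subseteq> A} = {B \<in> At m. B \<subseteq> A'} \<union> {B \<in> At m. B \<subseteq> A''}"
    "{B \<in> At m. B \<subseteq> A'} \<inter> {B \<in> At m. B \<subseteq> A''} = {}"
proof -
  have "B \<subseteq> A' \<or> B \<subseteq> A''" if B: "B \<in> At m" "B \<subseteq> A" for B
  proof -
    obtain x where "x \<in> B" using At_nonempty[OF B(1)] by blast
    then show ?thesis
      using nested_or_disjoint[OF assms(2) B(1) assms(6), of x] nested_or_disjoint[OF assms(3) B(1) assms(6), of x]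
        B(2) assms(4) by blast
  qed
  then show "{B \<in> At m. B \<subseteq> A} = {B \<in> At m. B \<subseteq> A'} \<union> {B \<in> At m. B \<subseteq> A''}" using assms(4) by blast
  show "{B \<in> At m. B \<subseteq> A'} \<inter> {B \<in> At m. B \<subseteq> A''} = {}" using assms(5) At_nonempty by blast
qed

text \<open>As \<open>g\<close> is orthogonal to \<open>S\<close>, its \<open>L\<^sup>2\<close>-norm is at most that of \<open>g - p1\<close>, which vanishes on \<open>A'\<close>.\<close>

lemma abs_integral_le_jump:
  assumes A: "A \<in> At n" "A' \<in> At (Suc n)" "A'' \<in> At (Suc n)" "A' \<union> A'' = A"
    and p: "p1 \<in> S" "p2 \<in> S" and g: "bdd_meas \<Omega> g" "\<And>x. x \<in> A' \<Longrightarrow> g x = p1 x" "\<And>x. x \<in> A'' \<Longrightarrow> g x = p2 x"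
    and orth: "\<And>q. q \<in> S \<Longrightarrow> Int_on A (\<lambda>x. g x * q x) = 0"
    and D: "0 \<le> D" "\<And>x. x \<in> A \<Longrightarrow> \<bar>p1 x - p2 x\<bar> \<le> D"
  shows "Int_on A (\<lambda>x. \<bar>g x\<bar>) \<le> D * vol A"
proof -
  note mA = At_measurable[OF A(1)]
  have bg: "bdd_meas A g" and bp: "bdd_meas A p1" using bdd_meas_At[OF _ A(1)] g(1) bdd_S p(1) by auto
  have le: "\<bar>g x - p1 x\<bar> \<le> D" if "x \<in> A" for x
  proof (cases "x \<in> A'")
    case True
    then show ?thesis using g(2) D(1) by simp
  next
    case False
    then have "x \<in> A''" using that A(4) by blast
    then show ?thesis using g(3) D(2)[OF that] by simp
  qed
  have "Int_on A (\<lambda>x. (g x)\<^sup>2) = Int_on A (\<lambda>x. (g x - p1 x)\<^sup>2 + 2 * (g x * p1 x) - (p1 x)\<^sup>2)"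
    by (rule Int_on_cong) (simp add: power2_eq_square algebra_simps)
  also have "\<dots> = Int_on A (\<lambda>x. (g x - p1 x)\<^sup>2) + 2 * Int_on A (\<lambda>x. g x * p1 x) - Int_on A (\<lambda>x. (p1 x)\<^sup>2)"
  proof -
    have b: "bdd_meas A (\<lambda>x. (g x - p1 x)\<^sup>2)" "bdd_meas A (\<lambda>x. 2 * (g x * p1 x))" "bdd_meas A (\<lambda>x. (p1 x)\<^sup>2)"
      using bg bp by auto
    show ?thesis
      unfolding Int_on_diff[OF bdd_meas_add[OF b(1,2)] b(3) mA] Int_on_add[OF b(1,2) mA] by simp
  qed
  also have "\<dots> \<le> Int_on A (\<lambda>x. (g x - p1 x)\<^sup>2)" using orth[OF p(1)] Int_on_nonneg[of A "\<lambda>x. (p1 x)\<^sup>2"] by simp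
  also have "\<dots> \<le> Int_on A (\<lambda>x. D\<^sup>2)"
    using bg bp mA le by (intro Int_on_mono) (auto simp: abs_le_square_iff[symmetric] D(1))
  also have "\<dots> = D\<^sup>2 * vol A" by (rule Int_on_const[OF mA])
  finally have g2: "Int_on A (\<lambda>x. (g x)\<^sup>2) \<le> D\<^sup>2 * vol A" .
  \<comment> \<open>Young's inequality replaces Cauchy-Schwarz; working with \<open>e\<close> above
    \<open>D\<close> avoids a division by zero when \<open>D = 0\<close>.\<close>
  have bound: "Int_on A (\<lambda>x. \<bar>g x\<bar>) \<le> e * vol A" if e: "D < e" for e
  proof -
    have e0: "0 < e" using e D(1) by simp
    have "Int_on A (\<lambda>x. \<bar>g x\<bar>) \<le> Int_on A (\<lambda>x. (1 / (2 * e)) * (g x)\<^sup>2 + e / 2)"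
    proof (rule Int_on_mono[OF _ _ mA])
      fix x
      have "0 \<le> (\<bar>g x\<bar> - e)\<^sup>2" by simp
      then have "2 * e * \<bar>g x\<bar> \<le> (g x)\<^sup>2 + e\<^sup>2" by (simp add: power2_eq_square algebra_simps)
      then show "\<bar>g x\<bar> \<le> (1 / (2 * e)) * (g x)\<^sup>2 + e / 2" using e0 by (simp add: field_simps power2_eq_square)
    qed (intro bdd_meas_add bdd_meas_mult bdd_meas_power bdd_meas_abs bdd_meas_const bg)+
    also have "\<dots> = (1 / (2 * e)) * Int_on A (\<lambda>x. (g x)\<^sup>2) + e / 2 * vol A"
    proof -
      have b: "bdd_meas A (\<lambda>x. (1 / (2 * e)) * (g x)\<^sup>2)"
        by (intro bdd_meas_mult bdd_meas_power bdd_meas_const bg)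
      show ?thesis unfolding Int_on_add[OF b bdd_meas_const mA] Int_on_const[OF mA] by simp
    qed
    also have "\<dots> \<le> (1 / (2 * e)) * (e\<^sup>2 * vol A) + e / 2 * vol A"
    proof -
      have "D\<^sup>2 * vol A \<le> e\<^sup>2 * vol A" using e D(1) by (intro mult_right_mono power_mono) auto
      with g2 have "Int_on A (\<lambda>x. (g x)\<^sup>2) \<le> e\<^sup>2 * vol A" by linarith
      then show ?thesis using e0 by (intro add_right_mono mult_left_mono) auto
    qed
    also have "\<dots> = e * vol A" using e0 by (simp add: power2_eq_square)
    finally show ?thesis .
  qed
  have "Int_on A (\<lambda>x. \<bar>g x\<bar>) / vol A \<le> D"
  proof (rule dense_ge)
    fix e assume "D < e"
    from bound[OF this] show "Int_on A (\<lambda>x. \<bar>g x\<bar>) / vol A \<le> e"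
      using vol_pos[OF A(1)] by (simp add: pos_divide_le_eq)
  qed
  then show ?thesis using vol_pos[OF A(1)] by (simp add: field_simps)
qed

text \<open>The vector of integrals of \<open>g\<close> over the descendants is projected off the
  test vectors of \<open>g * q + u\<close>, with \<open>q\<close> of mean zero and \<open>u\<close>
  in \<open>S2\<close>; the normalized residual is the multiplier, and orthogonality gives both
  identities. The point is that the residual is not small. It is the integral vector of
  \<open>g * (1 - q) - u\<close>, which agrees on each child with an element of \<open>S2\<close>,
  so the sign resolving property bounds this function in the mean. Comparing the two children
  eliminates \<open>u\<close> and leaves the jump \<open>p1 - p2\<close>, which dominates
  \<open>g\<close>.\<close>

lemma multiplier_exists:
  obtains c where "0 < c" "\<And>n A A' A'' p1 p2 g. A \<in> At n \<Longrightarrow> A' \<in> At (Suc n) \<Longrightarrow> A'' \<in> At (Suc n)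
    \<Longrightarrow> A' \<union> A'' = A \<Longrightarrow> A' \<inter> A'' = {} \<Longrightarrow> p1 \<in> S \<Longrightarrow> p2 \<in> S \<Longrightarrow> bdd_meas \<Omega> g
    \<Longrightarrow> (\<And>x. x \<in> A' \<Longrightarrow> g x = p1 x) \<Longrightarrow> (\<And>x. x \<in> A'' \<Longrightarrow> g x = p2 x)
    \<Longrightarrow> (\<And>q. q \<in> S \<Longrightarrow> Int_on A (\<lambda>x. g x * q x) = 0)
    \<Longrightarrow> \<exists>\<psi> \<rho>. (\<forall>B. \<bar>\<psi> B\<bar> \<le> 1) \<and> 0 \<le> \<rho> \<and> c * Int_on A (\<lambda>x. \<bar>g x\<bar>) \<le> \<rho> * vol A
      \<and> (\<forall>u\<in>S2. (\<Sum>B\<in>{B \<in> At (Suc n + l). B \<subseteq> A}. \<psi> B * Int_on B u) = 0)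
      \<and> (\<forall>q\<in>S. (\<Sum>B\<in>{B \<in> At (Suc n + l). B \<subseteq> A}. \<psi> B * Int_on B (\<lambda>x. g x * q x)) = \<rho> * Int_on A q)"
proof -
  obtain cs where cs: "0 < cs" "\<forall>j. \<forall>A\<in>At j. \<forall>u\<in>S2.
      cs * Int_on A (\<lambda>x. \<bar>u x\<bar>) \<le> (\<Sum>B\<in>{B \<in> At (j + l). B \<subseteq> A}. \<bar>Int_on B u\<bar>)"
    using resolving_l unfolding sign_resolving_def by blast
  from remez_integral[OF c1_pos, of N, where 'a='a] obtain C1 where C1: "0 < C1"
    "\<forall>A E (p::'a \<Rightarrow> real) x. convex A \<longrightarrow> bounded A \<longrightarrow> A \<in> lmeasurable
     \<longrightarrow> E \<in> lmeasurable \<longrightarrow> E \<subseteq> A \<longrightarrow> c1 * vol A \<le> vol E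
     \<longrightarrow> line_poly N p \<longrightarrow> continuous_on UNIV p \<longrightarrow> x \<in> A \<longrightarrow> \<bar>p x\<bar> * vol A \<le> C1 * Int_on E (\<lambda>y. \<bar>p y\<bar>)"
    by (elim exE conjE)
  from remez_product_integral[of N, where 'a='a] obtain C2 where C2: "0 < C2"
    "\<forall>A (p::'a \<Rightarrow> real) q x y. convex A \<longrightarrow> bounded A \<longrightarrow> A \<in> lmeasurable
     \<longrightarrow> line_poly N p \<longrightarrow> continuous_on UNIV p \<longrightarrow> line_poly N q \<longrightarrow> continuous_on UNIV q \<longrightarrow> x \<in> A \<longrightarrow> y \<in> A
     \<longrightarrow> \<bar>p x\<bar> * \<bar>q y\<bar> * vol A \<le> C2 * Int_on A (\<lambda>z. \<bar>p z * q z\<bar>)"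
    by (elim exE conjE)
  \<comment> \<open>\<open>C1 * C2 / cs\<close> bounds the integral of \<open>\<bar>g\<bar>\<close>
    by the size \<open>s\<close> of the residual, and \<open>c1 ^ Suc l\<close> is a lower bound for
    the reciprocal of the number of descendants.\<close>
  define c where "c = c1 ^ Suc l * cs / (C1 * C2)"
  have c: "0 < c" unfolding c_def using c1_pos cs C1 C2 by simp
  show ?thesis
  proof (rule that[OF c])
    fix n A A' A'' p1 p2 g
    assume A: "A \<in> At n" and A': "A' \<in> At (Suc n)" and A'': "A'' \<in> At (Suc n)"
      and un: "A' \<union> A'' = A" and dis: "A' \<inter> A'' = {}" and p1: "p1 \<in> S" and p2: "p2 \<in> S" and bg: "bdd_meas \<Omega> g"
      and g1: "\<And>x. x \<in> A' \<Longrightarrow> g x = p1 x" and g2: "\<And>x. x \<in> A'' \<Longrightarrow> g x = p2 x"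
      and orth: "\<And>q. q \<in> S \<Longrightarrow> Int_on A (\<lambda>x. g x * q x) = 0"
    \<comment> \<open>These atoms lie \<open>l\<close> levels below the children, so that the sign
      resolving property applies to each child separately.\<close>
    define X where "X = {B \<in> At (Suc n + l). B \<subseteq> A}"
    have finX: "finite X" by (simp add: X_def)
    have XB1: "B \<in> lmeasurable" if "B \<in> X" for B
      using that At_measurable[of B "Suc n + l"] by (simp add: X_def)
    have XB2: "bdd_meas B h" if "B \<in> X" "bdd_meas \<Omega> h" for B h
      using that bdd_meas_At[of h B "Suc n + l"] by (simp add: X_def)
    define vec where "vec h = (\<lambda>B. if B \<in> X then Int_on B h else 0)" for h
    have vec_add: "vec (\<lambda>x. h x + k x) = vec h + vec k" if "bdd_meas \<Omega> h" "bdd_meas \<Omega> k" for h k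
    proof (rule ext)
      fix B show "vec (\<lambda>x. h x + k x) B = (vec h + vec k) B"
        using Int_on_add[OF XB2 XB2 XB1, OF _ that(1) _ that(2)] by (simp add: vec_def)
    qed
    have vec_scale: "vec (\<lambda>x. a * h x) = a *\<^sub>R vec h" for a h
      by (auto simp: vec_def fun_eq_iff scaleR_fun_def)
    \<comment> \<open>Constants are left out of the test functions: they carry the drift that the
      multiplier has to keep.\<close>
    define S0 where "S0 = {q \<in> S. Int_on A q = 0}"
    have bS: "bdd_meas A q" if "q \<in> S" for q using bdd_meas_At[OF bdd_S[OF that] A] .
    note mA = At_measurable[OF A]
    define W where "W = {vec (\<lambda>x. g x * q x + u x) | q u. q \<in> S0 \<and> u \<in> S2}"
    have bgq: "bdd_meas \<Omega> (\<lambda>x. g x * q x + u x)" if "q \<in> S" "u \<in> S2" for q u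
      using bg bdd_S[OF that(1)] bdd_S2[OF that(2)] by auto
    have S0S: "S0 \<subseteq> S" by (auto simp: S0_def)
    have WI: "vec (\<lambda>x. g x * q x + u x) \<in> W" if "q \<in> S0" "u \<in> S2" for q u
      unfolding W_def by (intro CollectI exI[of _ q] exI[of _ u] conjI refl that)
    have WE: "\<exists>q u. h = vec (\<lambda>x. g x * q x + u x) \<and> q \<in> S0 \<and> u \<in> S2" if "h \<in> W" for h
      using that unfolding W_def by (rule CollectD)
    have "subspace W"
    proof (rule subspaceI)
      have z: "(\<lambda>x. 0) \<in> S0" using S_const[of 0] by (simp add: S0_def)
      have v0: "vec (\<lambda>x. g x * 0 + 0) = 0" by (simp add: vec_def fun_eq_iff)
      show "0 \<in> W" unfolding v0[symmetric] by (rule WI[OF z S2_zero])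
    next
      fix h k assume "h \<in> W" "k \<in> W"
      then obtain q u q' u' where *: "h = vec (\<lambda>x. g x * q x + u x)" "q \<in> S0" "u \<in> S2"
        "k = vec (\<lambda>x. g x * q' x + u' x)" "q' \<in> S0" "u' \<in> S2" using WE by metis
      have "h + k = vec (\<lambda>x. (g x * q x + u x) + (g x * q' x + u' x))"
        using * S0S by (subst vec_add) (auto intro!: bgq)
      also have "\<dots> = vec (\<lambda>x. g x * (q x + q' x) + (u x + u' x))" by (simp add: algebra_simps)
      finally have "h + k = vec (\<lambda>x. g x * (q x + q' x) + (u x + u' x))" .
      moreover have "(\<lambda>x. q x + q' x) \<in> S0"
        using * bS mA S_add by (simp add: S0_def Int_on_add)
      moreover have "(\<lambda>x. u x + u' x) \<in> S2" using * S2_add by blast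
      ultimately show "h + k \<in> W" using WI[of "\<lambda>x. q x + q' x" "\<lambda>x. u x + u' x"] by simp
    next
      fix a h assume "h \<in> W"
      then obtain q u where *: "h = vec (\<lambda>x. g x * q x + u x)" "q \<in> S0" "u \<in> S2" using WE by metis
      have "a *\<^sub>R h = vec (\<lambda>x. g x * (a * q x) + a * u x)"
        unfolding *(1) vec_scale[symmetric] by (simp add: algebra_simps)
      moreover have "(\<lambda>x. a * q x) \<in> S0" using * S_scale by (simp add: S0_def)
      moreover have "(\<lambda>x. a * u x) \<in> S2" using * S2_scale by blast
      ultimately show "a *\<^sub>R h \<in> W" using WI[of "\<lambda>x. a * q x" "\<lambda>x. a * u x"] by simp
    qed
    moreover have "h B = 0" if "h \<in> W" "B \<notin> X" for h B using that by (auto simp: W_def vec_def)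
    ultimately obtain w where w: "w \<in> W" "\<And>h. h \<in> W \<Longrightarrow> (\<Sum>B\<in>X. (vec g B - w B) * h B) = 0"
      using ex_projection[OF finX, of W "vec g"] by blast
    obtain q u where q: "q \<in> S" "Int_on A q = 0" and u: "u \<in> S2" and wq: "w = vec (\<lambda>x. g x * q x + u x)"
      using WE[OF w(1)] unfolding S0_def by blast
    define z where "z = (\<lambda>x. g x - (g x * q x + u x))"
    define Z where "Z B = Int_on B z" for B
    have ZX: "vec g B - w B = Z B" if "B \<in> X" for B
      using that XB1[OF that] XB2[OF that] bg bgq[OF q(1) u] by (simp add: vec_def wq Z_def z_def Int_on_diff)
    have Zorth: "(\<Sum>B\<in>X. Z B * Int_on B (\<lambda>x. g x * q' x + u' x)) = 0" if "q' \<in> S0" "u' \<in> S2" for q' u'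
    proof -
      have "(\<Sum>B\<in>X. Z B * Int_on B (\<lambda>x. g x * q' x + u' x)) =
          (\<Sum>B\<in>X. (vec g B - w B) * vec (\<lambda>x. g x * q' x + u' x) B)"
      proof (rule sum.cong[OF refl])
        fix B assume B: "B \<in> X"
        show "Z B * Int_on B (\<lambda>x. g x * q' x + u' x) = (vec g B - w B) * vec (\<lambda>x. g x * q' x + u' x) B"
          unfolding ZX[OF B] using B by (simp add: vec_def)
      qed
      then show ?thesis using w(2)[OF WI[OF that]] by simp
    qed
    have bz: "bdd_meas \<Omega> z" unfolding z_def using bg bgq[OF q(1) u] by auto
    define s where "s = (\<Sum>B\<in>X. \<bar>Z B\<bar>)"
    have s0: "0 \<le> s" unfolding s_def by (simp add: sum_nonneg)
    \<comment> \<open>Polynomials that agree with \<open>z\<close> on one child each. Being defined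
      on all of \<open>A\<close>, they can be compared there.\<close>
    define z1 where "z1 = (\<lambda>x. p1 x * (1 - q x) - u x)"
    define z2 where "z2 = (\<lambda>x. p2 x * (1 - q x) - u x)"
    have q1: "(\<lambda>x. 1 - q x) \<in> S" using S_diff[OF one_in_S q(1)] .
    have zS: "z1 \<in> S2" "z2 \<in> S2" unfolding z1_def z2_def using S2_diff S2_mult p1 p2 q1 u by blast+
    have zz1: "z x = z1 x" if "x \<in> A'" for x using g1[OF that] by (simp add: z_def z1_def algebra_simps)
    have zz2: "z x = z2 x" if "x \<in> A''" for x using g2[OF that] by (simp add: z_def z2_def algebra_simps)
    have part: "cs * Int_on E (\<lambda>x. \<bar>v x\<bar>) \<le> (\<Sum>B\<in>{B \<in> At (Suc n + l). B \<subseteq> E}. \<bar>Z B\<bar>)"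
      if E: "E \<in> At (Suc n)" and v: "v \<in> S2" and vz: "\<And>x. x \<in> E \<Longrightarrow> z x = v x" for E v
    proof -
      have "Z B = Int_on B v" if "B \<subseteq> E" for B unfolding Z_def using vz that by (intro Int_on_cong) blast
      then have eq: "(\<Sum>B\<in>{B \<in> At (Suc n + l). B \<subseteq> E}. \<bar>Z B\<bar>) = (\<Sum>B\<in>{B \<in> At (Suc n + l). B \<subseteq> E}. \<bar>Int_on B v\<bar>)"
        by (intro sum.cong) auto
      show ?thesis unfolding eq using cs(2)[rule_format, OF E v] .
    qed
    have "s = (\<Sum>B\<in>{B \<in> At (Suc n + l). B \<subseteq> A'}. \<bar>Z B\<bar>) + (\<Sum>B\<in>{B \<in> At (Suc n + l). B \<subseteq> A''}. \<bar>Z B\<bar>)"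
      unfolding s_def X_def descendants_children(1)[OF A A' A'' un dis le_add1]
      by (rule sum.union_disjoint) (use descendants_children(2)[OF A A' A'' un dis le_add1] in auto)
    then have s_ge: "cs * (Int_on A' (\<lambda>x. \<bar>z1 x\<bar>) + Int_on A'' (\<lambda>x. \<bar>z2 x\<bar>)) \<le> s"
      using part[OF A' zS(1) zz1] part[OF A'' zS(2) zz2] by (simp add: distrib_left)
    have cA: "convex A" "bounded A" using convex_atom[OF A] At_bounded[OF A] .
    have volge: "c1 * vol A \<le> vol E" if "E \<in> At (Suc n)" "E \<subseteq> A" for E
      using vol_descendant(1)[OF A, of E 1] that by simp
    have rem: "\<bar>v x\<bar> * vol A \<le> C1 * Int_on E (\<lambda>y. \<bar>v y\<bar>)"
      if "E \<in> At (Suc n)" "E \<subseteq> A" "v \<in> S2" "x \<in> A" for E v x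
      using C1(2)[rule_format, OF cA mA At_measurable[OF that(1)] that(2) volge[OF that(1,2)]
          line_poly_S2[OF that(3)] continuous_S2[OF that(3)] that(4)] .
    \<comment> \<open>\<open>u\<close> cancels in \<open>z1 - z2\<close>, and Remez extends the
      bound for each of the two from its child to all of \<open>A\<close>.\<close>
    have sup: "\<bar>(p1 x - p2 x) * (1 - q x)\<bar> \<le> C1 * s / (cs * vol A)" if x: "x \<in> A" for x
    proof -
      have "(p1 x - p2 x) * (1 - q x) = z1 x - z2 x" by (simp add: z1_def z2_def algebra_simps)
      then have "\<bar>(p1 x - p2 x) * (1 - q x)\<bar> * vol A \<le> (\<bar>z1 x\<bar> + \<bar>z2 x\<bar>) * vol A"
        by (intro mult_right_mono) auto
      also have "\<dots> \<le> C1 * (Int_on A' (\<lambda>x. \<bar>z1 x\<bar>) + Int_on A'' (\<lambda>x. \<bar>z2 x\<bar>))"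
      proof -
        have "A' \<subseteq> A" "A'' \<subseteq> A" using un by auto
        from rem[OF A' this(1) zS(1) x] rem[OF A'' this(2) zS(2) x]
        show ?thesis by (simp add: distrib_left distrib_right)
      qed
      also have "\<dots> \<le> C1 * (s / cs)"
        using s_ge cs(1) C1(1) by (intro mult_left_mono) (auto simp: field_simps)
      finally show ?thesis using vol_pos[OF A] cs(1) by (simp add: field_simps)
    qed
    have bq: "bdd_meas A (\<lambda>x. 1 - q x)" using bS[OF q1] .
    \<comment> \<open>As \<open>q\<close> has mean zero, \<open>1 - q\<close> is at least 1
      somewhere; the Remez inequality for products then allows it to be divided out.\<close>
    have "Int_on A (\<lambda>x. 1 - q x) = 1 * vol A"
      using bS[OF q(1)] mA q(2) by (subst Int_on_diff) (auto simp: Int_on_const)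
    then obtain y where y: "y \<in> A" "1 \<le> 1 - q y"
      using Int_on_ge_imp_point_ge[OF bq mA vol_pos[OF A], of 1] by auto
    have pS: "(\<lambda>x. p1 x - p2 x) \<in> S" using S_diff[OF p1 p2] .
    define D where "D = C2 * (C1 * s / (cs * vol A))"
    have D0: "0 \<le> D" unfolding D_def using C1(1) C2(1) s0 cs(1) vol_pos[OF A] by simp
    have "\<bar>p1 x - p2 x\<bar> \<le> D" if x: "x \<in> A" for x
    proof -
      have "\<bar>p1 x - p2 x\<bar> * vol A = \<bar>p1 x - p2 x\<bar> * 1 * vol A" by simp
      also have "\<dots> \<le> \<bar>p1 x - p2 x\<bar> * \<bar>1 - q y\<bar> * vol A"
        using y(2) by (intro mult_right_mono mult_left_mono) auto
      also have "\<dots> \<le> C2 * Int_on A (\<lambda>z. \<bar>(p1 z - p2 z) * (1 - q z)\<bar>)"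
        using C2(2)[rule_format, OF cA mA line_poly_S2[OF S_in_S2[OF pS]] continuous_S2[OF S_in_S2[OF pS]]
          line_poly_S2[OF S_in_S2[OF q1]] continuous_S2[OF S_in_S2[OF q1]] x y(1)] .
      also have "\<dots> \<le> C2 * Int_on A (\<lambda>z. C1 * s / (cs * vol A))"
      proof (rule mult_left_mono)
        show "Int_on A (\<lambda>z. \<bar>(p1 z - p2 z) * (1 - q z)\<bar>) \<le> Int_on A (\<lambda>z. C1 * s / (cs * vol A))"
          using bq bS[OF pS] by (intro Int_on_mono[OF _ _ mA sup]) auto
      qed (use C2(1) in simp)
      also have "\<dots> = D * vol A" by (simp add: Int_on_const[OF mA] D_def)
      finally show ?thesis using mult_le_cancel_right_pos[OF vol_pos[OF A]] by blast
    qed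
    from abs_integral_le_jump[OF A A' A'' un p1 p2 bg g1 g2 orth D0 this]
    have "Int_on A (\<lambda>x. \<bar>g x\<bar>) \<le> D * vol A" by simp
    also have "\<dots> = C1 * C2 * s / cs" using vol_pos[OF A] unfolding D_def by simp
    finally have Is: "Int_on A (\<lambda>x. \<bar>g x\<bar>) \<le> C1 * C2 * s / cs" .
    \<comment> \<open>Division by the sum \<open>s\<close> gives the bound by 1. If
      \<open>s = 0\<close>, the estimate just proved makes the integral of
      \<open>\<bar>g\<bar>\<close> vanish and the zero multiplier will do.\<close>
    define \<psi> where "\<psi> B = (if B \<in> X \<and> s \<noteq> 0 then Z B / s else 0)" for B
    define R where "R = (\<Sum>B\<in>X. \<psi> B * Int_on B g)"
    have psi_le: "\<bar>\<psi> B\<bar> \<le> 1" for B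
    proof (cases "B \<in> X \<and> s \<noteq> 0")
      case True
      then have "\<bar>Z B\<bar> \<le> s" unfolding s_def using finX by (intro member_le_sum) auto
      then show ?thesis using True s0 by (simp add: \<psi>_def divide_le_eq_1)
    qed (simp add: \<psi>_def)
    have psi_orth: "(\<Sum>B\<in>X. \<psi> B * Int_on B (\<lambda>x. g x * q' x + u' x)) = 0" if "q' \<in> S0" "u' \<in> S2" for q' u'
    proof (cases "s = 0")
      case False
      have "(\<Sum>B\<in>X. \<psi> B * Int_on B (\<lambda>x. g x * q' x + u' x)) = (\<Sum>B\<in>X. Z B * Int_on B (\<lambda>x. g x * q' x + u' x)) / s"
        unfolding sum_divide_distrib using False by (intro sum.cong) (auto simp: \<psi>_def)
      then show ?thesis using Zorth[OF that] by simp
    qed (simp add: \<psi>_def)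
    have psi_S2: "(\<Sum>B\<in>X. \<psi> B * Int_on B u') = 0" if "u' \<in> S2" for u'
    proof -
      have "(\<lambda>x. 0) \<in> S0" using S_const[of 0] by (simp add: S0_def)
      from psi_orth[OF this that] show ?thesis by simp
    qed
    have psi_q: "(\<Sum>B\<in>X. \<psi> B * Int_on B (\<lambda>x. g x * q' x)) = R / vol A * Int_on A q'" if q': "q' \<in> S" for q'
    proof -
      \<comment> \<open>A test function is its mean plus an element of \<open>S0\<close>, so only
        the pairing of \<open>\<psi>\<close> with \<open>g\<close> itself survives.\<close>
      define m where "m = Int_on A q' / vol A"
      have "Int_on A (\<lambda>x. q' x - m) = 0"
        using bS[OF q'] mA vol_pos[OF A] by (subst Int_on_diff) (auto simp: Int_on_const m_def)
      then have "(\<lambda>x. q' x - m) \<in> S0" using S_diff[OF q' S_const] by (simp add: S0_def)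
      from psi_orth[OF this S2_zero] have e: "(\<Sum>B\<in>X. \<psi> B * Int_on B (\<lambda>x. g x * (q' x - m))) = 0" by simp
      have "Int_on B (\<lambda>x. g x * q' x) = Int_on B (\<lambda>x. g x * (q' x - m)) + m * Int_on B g" if B: "B \<in> X" for B
      proof -
        have "Int_on B (\<lambda>x. g x * q' x) = Int_on B (\<lambda>x. g x * (q' x - m) + m * g x)"
          by (rule Int_on_cong) (simp add: algebra_simps)
        also have "\<dots> = Int_on B (\<lambda>x. g x * (q' x - m)) + m * Int_on B g"
        proof -
          note b = XB2[OF B bg] XB2[OF B bdd_S[OF q']]
          have b1: "bdd_meas B (\<lambda>x. g x * (q' x - m))" and b2: "bdd_meas B (\<lambda>x. m * g x)"
            using b by (auto intro!: bdd_meas_mult bdd_meas_diff)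
          show ?thesis unfolding Int_on_add[OF b1 b2 XB1[OF B]] by simp
        qed
        finally show ?thesis .
      qed
      then have "(\<Sum>B\<in>X. \<psi> B * Int_on B (\<lambda>x. g x * q' x)) =
          (\<Sum>B\<in>X. \<psi> B * Int_on B (\<lambda>x. g x * (q' x - m)) + m * (\<psi> B * Int_on B g))"
        by (intro sum.cong) (auto simp: algebra_simps)
      also have "\<dots> = m * R" unfolding sum.distrib e by (simp add: R_def sum_distrib_left)
      finally show ?thesis by (simp add: m_def)
    qed
    have R_ge: "c * Int_on A (\<lambda>x. \<bar>g x\<bar>) \<le> R" and R0: "0 \<le> R"
    proof -
      have "s * c1 ^ Suc l \<le> R"
      proof (cases "s = 0")
        case False
        then have sp: "0 < s" using s0 by simp
        have qS0: "q \<in> S0" using q by (simp add: S0_def)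
        have "Int_on B z = Int_on B g - Int_on B (\<lambda>x. g x * q x + u x)" if "B \<in> X" for B
          unfolding z_def by (rule Int_on_diff[OF XB2[OF that bg] XB2[OF that bgq[OF q(1) u]] XB1[OF that]])
        then have "(\<Sum>B\<in>X. \<psi> B * Z B) = (\<Sum>B\<in>X. \<psi> B * Int_on B g - \<psi> B * Int_on B (\<lambda>x. g x * q x + u x))"
          by (intro sum.cong) (auto simp: Z_def right_diff_distrib)
        \<comment> \<open>\<open>z\<close> differs from \<open>g\<close> by a test function, to
          which \<open>\<psi>\<close> is orthogonal; so \<open>R\<close> becomes a sum of squares
          over \<open>s\<close>.\<close>
        then have RZ: "(\<Sum>B\<in>X. \<psi> B * Z B) = R"
          using psi_orth[OF qS0 u] by (simp add: sum_subtractf R_def)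
        have Rs: "R = (\<Sum>B\<in>X. (Z B)\<^sup>2) / s"
          unfolding RZ[symmetric] sum_divide_distrib using False by (intro sum.cong) (auto simp: \<psi>_def power2_eq_square)
        have "s\<^sup>2 \<le> (\<Sum>B\<in>X. (Z B)\<^sup>2) * card X"
          using sum_squared_le_sum_of_squares[of "\<lambda>B. \<bar>Z B\<bar>" X] by (simp add: s_def)
        then have "s\<^sup>2 \<le> (R * s) * card X" using sp Rs by (simp add: field_simps)
        then have 1: "s \<le> R * card X" using sp by (simp add: power2_eq_square mult_ac)
        have "R \<ge> 0" using Rs sp by (simp add: sum_nonneg)
        have "s * c1 ^ Suc l \<le> R * card X * c1 ^ Suc l" using 1 c1_pos by (intro mult_right_mono) auto
        also have "\<dots> = R * (card X * c1 ^ Suc l)" by simp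
        also have "\<dots> \<le> R * 1"
          using card_descendants[OF A, of "Suc l"] \<open>R \<ge> 0\<close> by (intro mult_left_mono) (auto simp: X_def)
        finally show ?thesis by simp
      qed (simp add: R_def \<psi>_def)
      moreover have "c * Int_on A (\<lambda>x. \<bar>g x\<bar>) \<le> s * c1 ^ Suc l"
      proof -
        have "c * Int_on A (\<lambda>x. \<bar>g x\<bar>) \<le> c * (C1 * C2 * s / cs)" using Is c by (intro mult_left_mono) auto
        also have "\<dots> = s * c1 ^ Suc l" unfolding c_def using C1(1) C2(1) cs(1) by (simp add: field_simps)
        finally show ?thesis .
      qed
      moreover have "0 \<le> s * c1 ^ Suc l" using s0 c1_pos by simp
      ultimately show "c * Int_on A (\<lambda>x. \<bar>g x\<bar>) \<le> R" "0 \<le> R" by linarith+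
    qed
    show "\<exists>\<psi> \<rho>. (\<forall>B. \<bar>\<psi> B\<bar> \<le> 1) \<and> 0 \<le> \<rho> \<and> c * Int_on A (\<lambda>x. \<bar>g x\<bar>) \<le> \<rho> * vol A
      \<and> (\<forall>u\<in>S2. (\<Sum>B\<in>{B \<in> At (Suc n + l). B \<subseteq> A}. \<psi> B * Int_on B u) = 0)
      \<and> (\<forall>q\<in>S. (\<Sum>B\<in>{B \<in> At (Suc n + l). B \<subseteq> A}. \<psi> B * Int_on B (\<lambda>x. g x * q x)) = \<rho> * Int_on A q)"
      unfolding X_def[symmetric]
      using psi_le psi_S2 psi_q R_ge R0 vol_pos[OF A]
      by (intro exI[of _ \<psi>] exI[of _ "R / vol A"]) auto
  qed
qed

end

section \<open>Increments of the smartingale and their multipliers\<close>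

locale sparse_smartingale = polynomial_tree +
  fixes f :: "nat \<Rightarrow> 'a \<Rightarrow> real" and L :: real
  assumes smart: "smartingale \<Omega> F S f"
    and sparse: "nu_sparse \<Omega> (sparsity_index S l0) f"
    and bounded_increments: "\<And>n x. n \<ge> 1 \<Longrightarrow> x \<in> \<Omega> \<Longrightarrow> \<bar>increment f n x\<bar> \<le> L"
begin

text \<open>The index is shifted: \<open>D k\<close> leads from level \<open>k\<close> to level
  \<open>Suc k\<close>. It is piecewise in \<open>S\<close> on \<open>At (Suc k)\<close> and
  orthogonal to \<open>S\<close> on the atoms of \<open>At k\<close>.\<close>

definition D :: "nat \<Rightarrow> 'a \<Rightarrow> real" where "D k = increment f (Suc k)"

definition active :: "nat \<Rightarrow> bool" where "active k \<longleftrightarrow> (\<exists>x\<in>\<Omega>. D k x \<noteq> 0)"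

definition pw :: "nat \<Rightarrow> ('a \<Rightarrow> real) \<Rightarrow> bool" where
  "pw n h \<longleftrightarrow> (\<forall>A\<in>At n. \<exists>g\<in>S. \<forall>x\<in>A. h x = g x)"

lemma D_eq: "D k x = f (Suc k) x - f k x"
  by (simp add: D_def increment_def)

lemma D_bound: "x \<in> \<Omega> \<Longrightarrow> \<bar>D k x\<bar> \<le> L"
  unfolding D_def by (rule bounded_increments) simp_all

lemma L_nonneg: "0 \<le> L"
proof -
  obtain x where "x \<in> \<Omega>" using At_nonempty[of \<Omega> 0] At_0 by auto
  then show ?thesis using D_bound[of x 0] by linarith
qed

lemma pwD: "pw n h \<Longrightarrow> A \<in> At n \<Longrightarrow> \<exists>g\<in>S. \<forall>x\<in>A. h x = g x"
  unfolding pw_def by (rule bspec)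

lemma pw_add: "pw n g \<Longrightarrow> pw n h \<Longrightarrow> pw n (\<lambda>x. g x + h x)"
  unfolding pw_def
proof
  fix A assume "\<forall>A\<in>At n. \<exists>p\<in>S. \<forall>x\<in>A. g x = p x" "\<forall>A\<in>At n. \<exists>q\<in>S. \<forall>x\<in>A. h x = q x" "A \<in> At n"
  then obtain p q where p: "p \<in> S" "\<forall>x\<in>A. g x = p x" and q: "q \<in> S" "\<forall>x\<in>A. h x = q x" by metis
  show "\<exists>r\<in>S. \<forall>x\<in>A. g x + h x = r x" by (rule bexI[OF _ S_add[OF p(1) q(1)]]) (simp add: p(2) q(2))
qed

lemma pw_scale:
  assumes "pw n h" "\<And>A x y. A \<in> At n \<Longrightarrow> x \<in> A \<Longrightarrow> y \<in> A \<Longrightarrow> a x = a y"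
  shows "pw n (\<lambda>x. a x * h x)"
  unfolding pw_def
proof
  fix A assume A: "A \<in> At n"
  obtain g where g: "g \<in> S" "\<And>x. x \<in> A \<Longrightarrow> h x = g x" using pwD[OF assms(1) A] by metis
  obtain y where y: "y \<in> A" using At_nonempty[OF A] by blast
  show "\<exists>r\<in>S. \<forall>x\<in>A. a x * h x = r x"
  proof (intro bexI[OF _ S_scale[OF g(1), of "a y"]] ballI)
    fix x assume x: "x \<in> A"
    show "a x * h x = a y * g x" using assms(2)[OF A x y] g(2)[OF x] by simp
  qed
qed

lemma pw_const: "(\<And>A x y. A \<in> At n \<Longrightarrow> x \<in> A \<Longrightarrow> y \<in> A \<Longrightarrow> a x = a y) \<Longrightarrow> pw n a"
proof -
  assume a: "\<And>A x y. A \<in> At n \<Longrightarrow> x \<in> A \<Longrightarrow> y \<in> A \<Longrightarrow> a x = a y"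
  have "pw n (\<lambda>x. 1)" unfolding pw_def using one_in_S by auto
  from pw_scale[OF this a] show ?thesis by simp
qed

lemma pw_diff: "pw n g \<Longrightarrow> pw n h \<Longrightarrow> pw n (\<lambda>x. g x - h x)"
  using pw_add[of n g "\<lambda>x. (- 1) * h x"] pw_scale[of n h "\<lambda>x. - 1"] by simp

lemma pw_mono:
  assumes "pw n h" "n \<le> m"
  shows "pw m h"
  unfolding pw_def
proof
  fix B assume "B \<in> At m"
  then obtain A where A: "A \<in> At n" "B \<subseteq> A" using ancestor_le[OF _ assms(2)] by metis
  obtain g where g: "g \<in> S" "\<And>x. x \<in> A \<Longrightarrow> h x = g x" using pwD[OF assms(1) A(1)] by metis
  show "\<exists>g\<in>S. \<forall>x\<in>B. h x = g x" by (rule bexI[OF _ g(1)]) (use g(2) A(2) in blast)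
qed

lemma pw_bdd: "pw n h \<Longrightarrow> bdd_meas \<Omega> h"
proof (rule bdd_meas_piecewise[of n])
  fix A assume h: "pw n h" and A: "A \<in> At n"
  obtain g where g: "g \<in> S" "\<And>x. x \<in> A \<Longrightarrow> h x = g x" using pwD[OF h A] by metis
  show "\<exists>p. bdd_meas \<Omega> p \<and> (\<forall>x\<in>A. h x = p x)"
    using g(2) by (intro exI[of _ g] conjI bdd_S[OF g(1)]) blast
qed

lemma projection_f: "is_projection (F n) S (f (Suc n)) (f n)"
proof -
  have "\<forall>n\<ge>1. is_projection (F (n - 1)) S (f n) (f (n - 1))"
    using smart unfolding smartingale_def by (rule conjunct2)
  from this[rule_format, of "Suc n"] show ?thesis by simp
qed

lemma pw_f: "pw n (f n)"
  using projection_f[of n] unfolding is_projection_def piecewise_space_def pw_def by simp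

lemma D_orth: "A \<in> At k \<Longrightarrow> q \<in> S \<Longrightarrow> Int_on A (\<lambda>x. D k x * q x) = 0"
proof -
  assume A: "A \<in> At k" and q: "q \<in> S"
  from projection_f[of k] show ?thesis unfolding is_projection_def D_eq using A q by simp
qed

lemma pw_D: "pw (Suc k) (D k)"
proof -
  have "D k = (\<lambda>x. f (Suc k) x - f k x)" by (rule ext) (rule D_eq)
  then show ?thesis using pw_diff[OF pw_f pw_mono[OF pw_f[of k], of "Suc k"]] by simp
qed

lemma bdd_D: "bdd_meas \<Omega> (D k)"
  using pw_bdd[OF pw_D] .

lemma inactive_D: "\<not> active k \<Longrightarrow> x \<in> \<Omega> \<Longrightarrow> D k x = 0"
  unfolding active_def by blast

text \<open>The gap \<open>l + 1\<close> is the number of levels from \<open>At i\<close> down to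
  the atoms on which the multiplier of \<open>D i\<close> is constant. So this multiplier is
  constant on the atoms of \<open>At k\<close>.\<close>

lemma active_gap:
  assumes "active i" "active k" "i < k"
  shows "Suc i + l \<le> k"
proof -
  have "(\<exists>x\<in>\<Omega>. increment f (Suc i) x \<noteq> 0) \<and> (\<exists>x\<in>\<Omega>. increment f (Suc k) x \<noteq> 0)"
    using assms(1,2) unfolding active_def D_def by simp
  moreover have "\<forall>n\<ge>1. \<forall>m\<ge>1. (\<exists>x\<in>\<Omega>. increment f n x \<noteq> 0) \<and> (\<exists>x\<in>\<Omega>. increment f m x \<noteq> 0) \<longrightarrow>
        n = m \<or> \<bar>int n - int m\<bar> \<ge> int l + 1"
    using sparse unfolding nu_sparse_def .
  ultimately have "Suc i = Suc k \<or> \<bar>int (Suc i) - int (Suc k)\<bar> \<ge> int l + 1"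
    by (metis le_add2 plus_1_eq_Suc Suc_le_mono le0 One_nat_def)
  then show ?thesis using assms(3) by linarith
qed

text \<open>Local multipliers are glued along the atoms of level \<open>k\<close>. Inactive indices
  get multiplier and drift zero, so that they change neither weight nor drift.\<close>

lemma multipliers_exist:
  obtains c \<phi> \<rho> where "0 < c" "\<And>k x. \<bar>\<phi> k x\<bar> \<le> (1::real)" "\<And>k. bdd_meas \<Omega> (\<phi> k)"
    "\<And>k x. \<not> active k \<Longrightarrow> x \<in> \<Omega> \<Longrightarrow> \<phi> k x = 0" "\<And>k x. \<not> active k \<Longrightarrow> x \<in> \<Omega> \<Longrightarrow> \<rho> k x = (0::real)"
    "\<And>k B x y. B \<in> At (Suc k + l) \<Longrightarrow> x \<in> B \<Longrightarrow> y \<in> B \<Longrightarrow> \<phi> k x = \<phi> k y"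
    "\<And>k A x y. A \<in> At k \<Longrightarrow> x \<in> A \<Longrightarrow> y \<in> A \<Longrightarrow> \<rho> k x = \<rho> k y"
    "\<And>k A u. A \<in> At k \<Longrightarrow> u \<in> S2 \<Longrightarrow> Int_on A (\<lambda>x. \<phi> k x * u x) = 0"
    "\<And>k x. x \<in> \<Omega> \<Longrightarrow> 0 \<le> \<rho> k x"
    "\<And>k A q y. A \<in> At k \<Longrightarrow> q \<in> S \<Longrightarrow> y \<in> A \<Longrightarrow> Int_on A (\<lambda>x. \<phi> k x * (D k x * q x)) = \<rho> k y * Int_on A q"
    "\<And>k A y. A \<in> At k \<Longrightarrow> y \<in> A \<Longrightarrow> c * Int_on A (\<lambda>x. \<bar>D k x\<bar>) \<le> \<rho> k y * vol A"
proof (rule multiplier_exists)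
  fix c :: real
  assume c: "0 < c" and ex: "\<And>n A A' A'' p1 p2 g. A \<in> At n \<Longrightarrow> A' \<in> At (Suc n) \<Longrightarrow> A'' \<in> At (Suc n)
    \<Longrightarrow> A' \<union> A'' = A \<Longrightarrow> A' \<inter> A'' = {} \<Longrightarrow> p1 \<in> S \<Longrightarrow> p2 \<in> S \<Longrightarrow> bdd_meas \<Omega> g
    \<Longrightarrow> (\<And>x. x \<in> A' \<Longrightarrow> g x = p1 x) \<Longrightarrow> (\<And>x. x \<in> A'' \<Longrightarrow> g x = p2 x)
    \<Longrightarrow> (\<And>q. q \<in> S \<Longrightarrow> Int_on A (\<lambda>x. g x * q x) = 0)
    \<Longrightarrow> \<exists>\<psi> \<rho>. (\<forall>B. \<bar>\<psi> B\<bar> \<le> 1) \<and> 0 \<le> \<rho> \<and> c * Int_on A (\<lambda>x. \<bar>g x\<bar>) \<le> \<rho> * vol A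
      \<and> (\<forall>u\<in>S2. (\<Sum>B\<in>{B \<in> At (Suc n + l). B \<subseteq> A}. \<psi> B * Int_on B u) = 0)
      \<and> (\<forall>q\<in>S. (\<Sum>B\<in>{B \<in> At (Suc n + l). B \<subseteq> A}. \<psi> B * Int_on B (\<lambda>x. g x * q x)) = \<rho> * Int_on A q)"
  define good where "good k A \<psi> r \<longleftrightarrow> (\<forall>B. \<bar>\<psi> B\<bar> \<le> 1) \<and> 0 \<le> r \<and> c * Int_on A (\<lambda>x. \<bar>D k x\<bar>) \<le> r * vol A
      \<and> (\<forall>u\<in>S2. (\<Sum>B\<in>{B \<in> At (Suc k + l). B \<subseteq> A}. \<psi> B * Int_on B u) = 0)
      \<and> (\<forall>q\<in>S. (\<Sum>B\<in>{B \<in> At (Suc k + l). B \<subseteq> A}. \<psi> B * Int_on B (\<lambda>x. D k x * q x)) = r * Int_on A q)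
      \<and> (\<not> active k \<longrightarrow> (\<forall>B. \<psi> B = 0) \<and> r = 0)"
    for k A and \<psi> :: "'a set \<Rightarrow> real" and r :: real
  have ex_good: "\<exists>\<psi> r. good k A \<psi> r" if A: "A \<in> At k" for k A
  proof (cases "active k")
    case True
    obtain A' A'' where c': "A' \<in> At (Suc k)" "A'' \<in> At (Suc k)" "A' \<union> A'' = A" "A' \<inter> A'' = {}"
      using children[OF A] by metis
    obtain p1 where p1: "p1 \<in> S" "\<And>x. x \<in> A' \<Longrightarrow> D k x = p1 x" using pwD[OF pw_D c'(1)] by metis
    obtain p2 where p2: "p2 \<in> S" "\<And>x. x \<in> A'' \<Longrightarrow> D k x = p2 x" using pwD[OF pw_D c'(2)] by metis
    from ex[OF A c' p1(1) p2(1) bdd_D p1(2) p2(2) D_orth[OF A]] show ?thesis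
      using True unfolding good_def by simp
  next
    case False
    have D0: "D k x = 0" if "x \<in> A" for x using inactive_D[OF False] that At_subset[OF A] by blast
    have "Int_on A (\<lambda>x. \<bar>D k x\<bar>) = Int_on A (\<lambda>x. 0)" by (rule Int_on_cong) (simp add: D0)
    then have "good k A (\<lambda>B. 0) 0" unfolding good_def by simp
    then show ?thesis by blast
  qed
  define \<psi> where "\<psi> k A = (SOME \<psi>. \<exists>r. good k A \<psi> r)" for k A
  define r where "r k A = (SOME r. good k A (\<psi> k A) r)" for k A
  have g: "good k A (\<psi> k A) (r k A)" if "A \<in> At k" for k A
    unfolding r_def by (rule someI_ex, unfold \<psi>_def, rule someI_ex[OF ex_good[OF that]])
  \<comment> \<open>The local choices are only meaningful for atoms; the value 0 off
    \<open>\<Omega>\<close> keeps the bound by 1 valid everywhere.\<close>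
  define \<phi> where "\<phi> k x = (if x \<in> \<Omega> then \<psi> k (atom_at k x) (atom_at (Suc k + l) x) else 0)" for k x
  define \<rho> where "\<rho> k x = r k (atom_at k x)" for k x
  have phi_B: "\<phi> k x = \<psi> k A B" if "A \<in> At k" "B \<in> At (Suc k + l)" "B \<subseteq> A" "x \<in> B" for k A B x
    using that At_subset[of A k] at_eq[of A k x] at_eq[of B "Suc k + l" x] unfolding \<phi>_def by auto
  have rho_A: "\<rho> k x = r k A" if "A \<in> At k" "x \<in> A" for k A x
    using at_eq[OF that] unfolding \<rho>_def by simp
  have phi_const: "\<phi> k x = \<phi> k y" if B: "B \<in> At (Suc k + l)" "x \<in> B" "y \<in> B" for k B x y
  proof -
    have "k \<le> Suc k + l" by simp
    from ancestor_le[OF B(1) this] obtain A where "A \<in> At k" "B \<subseteq> A" by metis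
    then show ?thesis using phi_B[OF _ B(1)] B by simp
  qed
  have phi_bdd: "bdd_meas \<Omega> (\<phi> k)" for k
  proof (rule bdd_meas_piecewise[of "Suc k + l"])
    fix B assume B: "B \<in> At (Suc k + l)"
    obtain y where y: "y \<in> B" using At_nonempty[OF B] by blast
    show "\<exists>p. bdd_meas \<Omega> p \<and> (\<forall>x\<in>B. \<phi> k x = p x)"
      using phi_const[OF B _ y] by (intro exI[of _ "\<lambda>x. \<phi> k y"] conjI bdd_meas_const) blast
  qed
  have phi_int: "Int_on A (\<lambda>x. \<phi> k x * h x) = (\<Sum>B\<in>{B \<in> At (Suc k + l). B \<subseteq> A}. \<psi> k A B * Int_on B h)"
    if A: "A \<in> At k" and h: "bdd_meas \<Omega> h" for k A h
  proof -
    have "Int_on A (\<lambda>x. \<phi> k x * h x) = (\<Sum>B\<in>{B \<in> At (Suc k + l). B \<subseteq> A}. Int_on B (\<lambda>x. \<phi> k x * h x))"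
      by (rule Int_on_descendants[OF A _ bdd_meas_mult[OF phi_bdd h]]) simp
    also have "\<dots> = (\<Sum>B\<in>{B \<in> At (Suc k + l). B \<subseteq> A}. \<psi> k A B * Int_on B h)"
    proof (rule sum.cong[OF refl])
      fix B assume "B \<in> {B \<in> At (Suc k + l). B \<subseteq> A}"
      then have B: "B \<in> At (Suc k + l)" "B \<subseteq> A" by auto
      have "Int_on B (\<lambda>x. \<phi> k x * h x) = Int_on B (\<lambda>x. \<psi> k A B * h x)"
        by (rule Int_on_cong) (simp add: phi_B[OF A B])
      then show "Int_on B (\<lambda>x. \<phi> k x * h x) = \<psi> k A B * Int_on B h" by simp
    qed
    finally show ?thesis .
  qed
  show ?thesis
  proof (rule that[of c \<phi> \<rho>])
    show "0 < c" by (rule c)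
    show "bdd_meas \<Omega> (\<phi> k)" for k by (rule phi_bdd)
    show "\<bar>\<phi> k x\<bar> \<le> 1" for k x
    proof (cases "x \<in> \<Omega>")
      case True
      then show ?thesis using g[OF at_At[OF True], of k] unfolding \<phi>_def good_def by simp
    qed (simp add: \<phi>_def)
    show "\<phi> k x = 0" if "\<not> active k" "x \<in> \<Omega>" for k x
      using g[OF at_At[OF that(2)], of k] that unfolding \<phi>_def good_def by simp
    show "\<rho> k x = 0" if "\<not> active k" "x \<in> \<Omega>" for k x
      using g[OF at_At[OF that(2)], of k] that unfolding \<rho>_def good_def by simp
    show "0 \<le> \<rho> k x" if "x \<in> \<Omega>" for k x
      using g[OF at_At[OF that], of k] unfolding \<rho>_def good_def by simp
    show "\<phi> k x = \<phi> k y" if "B \<in> At (Suc k + l)" "x \<in> B" "y \<in> B" for k B x y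
      using phi_const[OF that] .
    show "\<rho> k x = \<rho> k y" if "A \<in> At k" "x \<in> A" "y \<in> A" for k A x y
      using rho_A that by simp
    show "Int_on A (\<lambda>x. \<phi> k x * u x) = 0" if "A \<in> At k" "u \<in> S2" for k A u
      unfolding phi_int[OF that(1) bdd_S2[OF that(2)]] using g[OF that(1)] that(2) unfolding good_def by blast
    show "Int_on A (\<lambda>x. \<phi> k x * (D k x * q x)) = \<rho> k y * Int_on A q" if "A \<in> At k" "q \<in> S" "y \<in> A" for k A q y
      unfolding phi_int[OF that(1) bdd_meas_mult[OF bdd_D bdd_S[OF that(2)]]] rho_A[OF that(1,3)]
      using g[OF that(1)] that(2) unfolding good_def by blast
    show "c * Int_on A (\<lambda>x. \<bar>D k x\<bar>) \<le> \<rho> k y * vol A" if "A \<in> At k" "y \<in> A" for k A y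
      unfolding rho_A[OF that] using g[OF that(1)] unfolding good_def by blast
  qed
qed

end

section \<open>The weighted square function\<close>

locale multiplied = sparse_smartingale +
  fixes c6 \<epsilon> :: real and \<phi> \<rho> :: "nat \<Rightarrow> 'a \<Rightarrow> real"
  assumes c6_pos: "0 < c6"
    and phi_le: "\<And>k x. \<bar>\<phi> k x\<bar> \<le> 1" and bdd_phi: "\<And>k. bdd_meas \<Omega> (\<phi> k)"
    and phi_inactive: "\<And>k x. \<not> active k \<Longrightarrow> x \<in> \<Omega> \<Longrightarrow> \<phi> k x = 0"
    and rho_inactive: "\<And>k x. \<not> active k \<Longrightarrow> x \<in> \<Omega> \<Longrightarrow> \<rho> k x = 0"
    and phi_const: "\<And>k B x y. B \<in> At (Suc k + l) \<Longrightarrow> x \<in> B \<Longrightarrow> y \<in> B \<Longrightarrow> \<phi> k x = \<phi> k y"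
    and rho_const: "\<And>k A x y. A \<in> At k \<Longrightarrow> x \<in> A \<Longrightarrow> y \<in> A \<Longrightarrow> \<rho> k x = \<rho> k y"
    and phi_orth: "\<And>k A u. A \<in> At k \<Longrightarrow> u \<in> S2 \<Longrightarrow> Int_on A (\<lambda>x. \<phi> k x * u x) = 0"
    and rho_nonneg: "\<And>k x. x \<in> \<Omega> \<Longrightarrow> 0 \<le> \<rho> k x"
    and phi_D: "\<And>k A q y. A \<in> At k \<Longrightarrow> q \<in> S \<Longrightarrow> y \<in> A
      \<Longrightarrow> Int_on A (\<lambda>x. \<phi> k x * (D k x * q x)) = \<rho> k y * Int_on A q"
    and D_le_rho: "\<And>k A y. A \<in> At k \<Longrightarrow> y \<in> A \<Longrightarrow> c6 * Int_on A (\<lambda>x. \<bar>D k x\<bar>) \<le> \<rho> k y * vol A"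
    and eps_pos: "0 < \<epsilon>" and eps_le: "\<epsilon> \<le> 1 / 2"
begin

lemma Int_on_local_eq:
  assumes "A \<in> At n" "n \<le> m" "bdd_meas \<Omega> g" "bdd_meas \<Omega> h"
    "\<And>B. B \<in> At m \<Longrightarrow> B \<subseteq> A \<Longrightarrow> Int_on B g = Int_on B h"
  shows "Int_on A g = Int_on A h"
  unfolding Int_on_descendants[OF assms(1,2,3)] Int_on_descendants[OF assms(1,2,4)]
  by (rule sum.cong) (use assms(5) in auto)

lemma Int_on_local_le:
  assumes "A \<in> At n" "n \<le> m" "bdd_meas \<Omega> g" "bdd_meas \<Omega> h"
    "\<And>B. B \<in> At m \<Longrightarrow> B \<subseteq> A \<Longrightarrow> Int_on B g \<le> Int_on B h"
  shows "Int_on A g \<le> Int_on A h"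
  unfolding Int_on_descendants[OF assms(1,2,3)] Int_on_descendants[OF assms(1,2,4)]
  by (rule sum_mono) (use assms(5) in auto)

lemma rho_const_le:
  assumes "A \<in> At n" "j \<le> n" "x \<in> A" "y \<in> A"
  shows "\<rho> j x = \<rho> j y"
proof -
  obtain B where "B \<in> At j" "A \<subseteq> B" using ancestor_le[OF assms(1,2)] by metis
  then show ?thesis using rho_const[of B j x y] assms by blast
qed

text \<open>With \<open>q = 1\<close> the multiplier identity makes \<open>\<rho> k x\<close> the
  mean of \<open>\<phi> k * D k\<close> over the atom.\<close>

lemma rho_le: "x \<in> \<Omega> \<Longrightarrow> \<rho> k x \<le> L"
proof -
  assume x: "x \<in> \<Omega>"
  let ?A = "atom_at k x"
  note A = at_At[OF x, of k] in_at[OF x, of k]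
  note mA = At_measurable[OF A(1)]
  have bp: "bdd_meas ?A (\<phi> k)" "bdd_meas ?A (D k)" using bdd_meas_At[OF _ A(1)] bdd_phi bdd_D by auto
  have "\<rho> k x * vol ?A = Int_on ?A (\<lambda>x. \<phi> k x * (D k x * 1))"
    using phi_D[OF A(1) one_in_S A(2)] Int_on_const[OF mA, of 1] by simp
  also have "\<dots> \<le> Int_on ?A (\<lambda>x. L)"
  proof (rule Int_on_mono[OF _ _ mA])
    fix z assume "z \<in> ?A"
    then have z: "z \<in> \<Omega>" using At_subset[OF A(1)] by blast
    have "\<phi> k z * (D k z * 1) \<le> \<bar>\<phi> k z\<bar> * \<bar>D k z\<bar>" by (simp add: abs_mult[symmetric])
    also have "\<dots> \<le> 1 * L" using phi_le D_bound[OF z] by (intro mult_mono) auto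
    finally show "\<phi> k z * (D k z * 1) \<le> L" by simp
  qed (use bp in auto)
  also have "\<dots> = L * vol ?A" by (rule Int_on_const[OF mA])
  finally show "\<rho> k x \<le> L" using mult_le_cancel_right_pos[OF vol_pos[OF A(1)]] by blast
qed

text \<open>A Riesz product over the multipliers, used as the density of a measure on
  \<open>\<Omega>\<close>.\<close>

definition W :: "nat \<Rightarrow> 'a \<Rightarrow> real" where "W n x = (\<Prod>k<n. 1 + \<epsilon> * \<phi> k x)"

lemma W_0: "W 0 x = 1" by (simp add: W_def)

lemma W_Suc: "W (Suc n) x = W n x * (1 + \<epsilon> * \<phi> n x)"
  by (simp add: W_def)

lemma factor_bounds: "1 - \<epsilon> \<le> 1 + \<epsilon> * \<phi> k x" "1 + \<epsilon> * \<phi> k x \<le> 1 + \<epsilon>"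
proof -
  have "\<bar>\<epsilon> * \<phi> k x\<bar> \<le> \<epsilon> * 1" unfolding abs_mult using phi_le eps_pos by (intro mult_mono) auto
  then show "1 - \<epsilon> \<le> 1 + \<epsilon> * \<phi> k x" "1 + \<epsilon> * \<phi> k x \<le> 1 + \<epsilon>" by auto
qed

lemma factor_pos: "0 < 1 + \<epsilon> * \<phi> k x"
  using factor_bounds(1)[of k x] eps_le by linarith

lemma W_pos: "0 < W n x"
  unfolding W_def using factor_pos by (intro prod_pos) auto

lemma W_le: "W n x \<le> (1 + \<epsilon>) ^ n"
proof -
  have "W n x \<le> (\<Prod>k<n. 1 + \<epsilon>)"
    unfolding W_def using factor_bounds factor_pos by (intro prod_mono) (auto simp: less_imp_le)
  then show ?thesis by simp
qed

lemma bdd_W: "bdd_meas \<Omega> (W n)"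
  unfolding W_def using bdd_phi by (intro bdd_meas_prod bdd_meas_add bdd_meas_mult) auto

text \<open>By \<open>active_gap\<close> every active factor before \<open>n\<close> is constant on
  the atoms of level \<open>n\<close>; the inactive factors equal 1.\<close>

lemma W_const:
  assumes "active n" "A \<in> At n" "x \<in> A" "y \<in> A"
  shows "W n x = W n y"
  unfolding W_def
proof (rule prod.cong[OF refl])
  fix i assume "i \<in> {..<n}"
  then have i: "i < n" by simp
  have "\<phi> i x = \<phi> i y"
  proof (cases "active i")
    case True
    from ancestor_le[OF assms(2) active_gap[OF True assms(1) i]] obtain B
      where "B \<in> At (Suc i + l)" "A \<subseteq> B" by metis
    then show ?thesis using phi_const[of B i x y] assms by blast
  next
    case False
    have "x \<in> \<Omega>" "y \<in> \<Omega>" using At_subset[OF assms(2)] assms(3,4) by blast+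
    then show ?thesis by (simp add: phi_inactive[OF False])
  qed
  then show "1 + \<epsilon> * \<phi> i x = 1 + \<epsilon> * \<phi> i y" by simp
qed

lemma W_inactive: "\<not> active n \<Longrightarrow> x \<in> \<Omega> \<Longrightarrow> W (Suc n) x = W n x"
  by (simp add: W_Suc phi_inactive)

text \<open>Between active indices only the latest active factor can still vary within an atom, and
  it lies between \<open>1 - \<epsilon>\<close> and \<open>1 + \<epsilon>\<close>.\<close>

lemma W_comparable: "A \<in> At n \<Longrightarrow> \<exists>w>0. \<forall>x\<in>A. w * (1 - \<epsilon>) \<le> W n x \<and> W n x \<le> w * (1 + \<epsilon>)"
proof (induction n arbitrary: A)
  case 0
  then show ?case using eps_pos by (intro exI[of _ 1]) (simp add: W_0)
next
  case (Suc n)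
  obtain E where E: "E \<in> At n" "A \<subseteq> E" using parent[OF Suc.prems] by metis
  show ?case
  proof (cases "active n")
    case True
    obtain y where y: "y \<in> A" using At_nonempty[OF Suc.prems] by blast
    show ?thesis
    proof (intro exI[of _ "W n y"] conjI ballI)
      show "0 < W n y" by (rule W_pos)
      fix x assume "x \<in> A"
      then have "W n x = W n y" using W_const[OF True E(1), of x y] E(2) y by blast
      then show "W n y * (1 - \<epsilon>) \<le> W (Suc n) x" "W (Suc n) x \<le> W n y * (1 + \<epsilon>)"
        unfolding W_Suc using factor_bounds W_pos[of n y] by (simp_all add: mult_left_mono less_imp_le)
    qed
  next
    case False
    obtain w where w: "0 < w" "\<forall>x\<in>E. w * (1 - \<epsilon>) \<le> W n x \<and> W n x \<le> w * (1 + \<epsilon>)" using Suc.IH[OF E(1)] by blast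
    have "W (Suc n) x = W n x" if "x \<in> A" for x
      using W_inactive[OF False] that At_subset[OF Suc.prems] by blast
    then show ?thesis using w E(2) by (intro exI[of _ w]) auto
  qed
qed

text \<open>At an active index \<open>W n\<close> is constant on \<open>A\<close>, and the new
  factor adds a multiple of the integral of \<open>\<phi> n * u\<close>, which vanishes.\<close>

lemma W_step:
  assumes A: "A \<in> At n" and u: "u \<in> S2"
  shows "Int_on A (\<lambda>x. W (Suc n) x * u x) = Int_on A (\<lambda>x. W n x * u x)"
proof (cases "active n")
  case True
  obtain y where y: "y \<in> A" using At_nonempty[OF A] by blast
  have w: "W n x = W n y" if "x \<in> A" for x using W_const[OF True A that y] .
  note bu = bdd_meas_At[OF bdd_S2[OF u] A]
  have bpu: "bdd_meas A (\<lambda>x. \<epsilon> * (\<phi> n x * u x))"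
    by (intro bdd_meas_mult bdd_meas_const bu bdd_meas_At[OF bdd_phi A])
  have "Int_on A (\<lambda>x. W (Suc n) x * u x) = Int_on A (\<lambda>x. W n y * (u x + \<epsilon> * (\<phi> n x * u x)))"
    by (rule Int_on_cong) (simp add: W_Suc w algebra_simps)
  also have "\<dots> = W n y * (Int_on A u + \<epsilon> * Int_on A (\<lambda>x. \<phi> n x * u x))"
    using Int_on_add[OF bu bpu At_measurable[OF A]] by simp
  also have "\<dots> = Int_on A (\<lambda>x. W n y * u x)" using phi_orth[OF A u] by simp
  also have "\<dots> = Int_on A (\<lambda>x. W n x * u x)" by (rule Int_on_cong) (simp add: w)
  finally show ?thesis .
next
  case False
  show ?thesis
    by (rule Int_on_cong) (use W_inactive[OF False] At_subset[OF A] in auto)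
qed

lemma W_step_piecewise:
  assumes A: "A \<in> At n" "n \<le> m" and h: "bdd_meas \<Omega> h" "\<And>B. B \<in> At m \<Longrightarrow> \<exists>u\<in>S2. \<forall>x\<in>B. h x = u x"
  shows "Int_on A (\<lambda>x. W (Suc m) x * h x) = Int_on A (\<lambda>x. W m x * h x)"
proof (rule Int_on_local_eq[OF A bdd_meas_mult[OF bdd_W h(1)] bdd_meas_mult[OF bdd_W h(1)]])
  fix B assume B: "B \<in> At m"
  obtain u where u: "u \<in> S2" "\<And>x. x \<in> B \<Longrightarrow> h x = u x" using h(2)[OF B] by metis
  have "Int_on B (\<lambda>x. W (Suc m) x * h x) = Int_on B (\<lambda>x. W (Suc m) x * u x)"
    by (rule Int_on_cong) (simp add: u(2))
  also have "\<dots> = Int_on B (\<lambda>x. W m x * u x)" by (rule W_step[OF B u(1)])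
  also have "\<dots> = Int_on B (\<lambda>x. W m x * h x)" by (rule Int_on_cong) (simp add: u(2))
  finally show "Int_on B (\<lambda>x. W (Suc m) x * h x) = Int_on B (\<lambda>x. W m x * h x)" .
qed

text \<open>\<open>b\<close> serves as a telescoping majorant: the increments of the energy of \<open>G\<close> are bounded by those
  of \<open>b\<close>.\<close>

definition M :: "nat \<Rightarrow> 'a \<Rightarrow> real" where "M k x = (\<Sum>j<k. \<epsilon> * \<rho> j x)"
text \<open>The damping includes the drift of step \<open>k\<close> itself: \<open>M (Suc k)\<close>
  is still constant on the atoms of level \<open>k\<close>, and with it the energy of the step is
  bounded by a difference of consecutive values of \<open>b\<close>.\<close>

definition H :: "nat \<Rightarrow> 'a \<Rightarrow> real" where "H k x = 1 / (1 + M (Suc k) x) * (D k x - \<epsilon> * \<rho> k x)"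
definition G :: "nat \<Rightarrow> 'a \<Rightarrow> real" where "G n x = (\<Sum>k<n. H k x)"
definition b :: "nat \<Rightarrow> 'a \<Rightarrow> real" where "b k x = 1 / (1 + M k x)"

lemma M_Suc: "M (Suc k) x = M k x + \<epsilon> * \<rho> k x" by (simp add: M_def)

lemma M_nonneg: "x \<in> \<Omega> \<Longrightarrow> 0 \<le> M k x"
  unfolding M_def using rho_nonneg eps_pos by (intro sum_nonneg) auto

lemma M_const:
  assumes "A \<in> At n" "k \<le> Suc n" "x \<in> A" "y \<in> A"
  shows "M k x = M k y"
  unfolding M_def
proof (rule sum.cong[OF refl])
  fix j assume "j \<in> {..<k}"
  then have "j \<le> n" using assms(2) by auto
  then show "\<epsilon> * \<rho> j x = \<epsilon> * \<rho> j y" using rho_const_le[OF assms(1) _ assms(3,4)] by simp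
qed

lemma b_const: "A \<in> At n \<Longrightarrow> k \<le> Suc n \<Longrightarrow> x \<in> A \<Longrightarrow> y \<in> A \<Longrightarrow> b k x = b k y"
  unfolding b_def using M_const[of A n k x y] by simp

lemma pw_b: "k \<le> Suc n \<Longrightarrow> pw n (b k)"
  by (rule pw_const) (rule b_const)

lemma bdd_b: "bdd_meas \<Omega> (b k)"
  using pw_bdd[OF pw_b[of k k]] by simp

lemma pw_H: "pw (Suc k) (H k)"
proof -
  have r: "pw (Suc k) (\<lambda>x. \<epsilon> * \<rho> k x)"
  proof (rule pw_const)
    fix A x y assume "A \<in> At (Suc k)" "x \<in> A" "y \<in> A"
    then show "\<epsilon> * \<rho> k x = \<epsilon> * \<rho> k y" using rho_const_le[of A "Suc k" k x y] by simp
  qed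
  have a: "1 / (1 + M (Suc k) x) = 1 / (1 + M (Suc k) y)" if "A \<in> At (Suc k)" "x \<in> A" "y \<in> A" for A x y
    using M_const[OF that(1) _ that(2,3), of "Suc k"] by simp
  show ?thesis
    unfolding H_def using pw_scale[OF pw_diff[OF pw_D r] a] .
qed

lemma G_Suc: "G (Suc n) x = G n x + H n x" by (simp add: G_def)

lemma pw_G: "m \<le> n \<Longrightarrow> pw n (G m)"
proof (induction m)
  case 0
  have "pw n (\<lambda>x. 0)" by (rule pw_const) simp
  then show ?case by (simp add: G_def)
next
  case (Suc m)
  have "pw n (\<lambda>x. G m x + H m x)" using Suc pw_mono[OF pw_H, of m n] by (intro pw_add) auto
  then show ?case by (simp add: G_Suc[abs_def])
qed

lemma bdd_H: "bdd_meas \<Omega> (H k)" using pw_bdd[OF pw_H] .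
lemma bdd_G: "bdd_meas \<Omega> (G k)" using pw_bdd[OF pw_G[OF order_refl]] .

lemma H_inactive: "\<not> active k \<Longrightarrow> x \<in> \<Omega> \<Longrightarrow> H k x = 0"
  by (simp add: H_def inactive_D rho_inactive)

text \<open>In the expansion of
  \<open>(1 + \<epsilon> * \<phi> k) * (D k - \<epsilon> * \<rho> k)\<close> against
  \<open>q\<close>, the terms with \<open>D k\<close> alone and with \<open>\<phi> k\<close> times a
  constant vanish, and the multiplier identity cancels the subtracted drift. This dictates the
  amount \<open>\<epsilon> * \<rho> k\<close>.\<close>

lemma W_H_orth:
  assumes A: "A \<in> At k" and q: "pw k q"
  shows "Int_on A (\<lambda>x. W (Suc k) x * (H k x * q x)) = 0"
proof (cases "active k")
  case True
  obtain y where y: "y \<in> A" using At_nonempty[OF A] by blast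
  obtain g where g: "g \<in> S" "\<And>x. x \<in> A \<Longrightarrow> q x = g x" using pwD[OF q A] by metis
  note mA = At_measurable[OF A]
  let ?w = "W k y" and ?m = "1 / (1 + M (Suc k) y)" and ?r = "\<rho> k y"
  have bb: "bdd_meas A g" "bdd_meas A (D k)" "bdd_meas A (\<phi> k)"
    using bdd_meas_At[OF _ A] bdd_S[OF g(1)] bdd_D bdd_phi by auto
  have b1: "bdd_meas A (\<lambda>x. D k x * g x)" and b2: "bdd_meas A (\<lambda>x. (\<epsilon> * ?r) * g x)"
    and b3: "bdd_meas A (\<lambda>x. \<epsilon> * (\<phi> k x * (D k x * g x)))" and b4: "bdd_meas A (\<lambda>x. (\<epsilon>\<^sup>2 * ?r) * (\<phi> k x * g x))"
    by (intro bdd_meas_mult bdd_meas_const bb)+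
  have alg: "w * (1 + \<epsilon> * p) * (m * (d - \<epsilon> * r) * h) =
      (w * m) * (d * h - (\<epsilon> * r) * h + \<epsilon> * (p * (d * h)) - (\<epsilon>\<^sup>2 * r) * (p * h))" for w p m d r h :: real
    by (simp add: algebra_simps power2_eq_square)
  have "Int_on A (\<lambda>x. W (Suc k) x * (H k x * q x)) = Int_on A (\<lambda>x. (?w * ?m) *
      (D k x * g x - (\<epsilon> * ?r) * g x + \<epsilon> * (\<phi> k x * (D k x * g x)) - (\<epsilon>\<^sup>2 * ?r) * (\<phi> k x * g x)))"
  proof (rule Int_on_cong)
    fix x assume x: "x \<in> A"
    have e: "W k x = ?w" "M (Suc k) x = M (Suc k) y" "\<rho> k x = ?r" "q x = g x"
      using W_const[OF True A x y] M_const[OF A order_refl x y] rho_const[OF A x y] g(2)[OF x] by auto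
    show "W (Suc k) x * (H k x * q x) = (?w * ?m) *
      (D k x * g x - (\<epsilon> * ?r) * g x + \<epsilon> * (\<phi> k x * (D k x * g x)) - (\<epsilon>\<^sup>2 * ?r) * (\<phi> k x * g x))"
      unfolding W_Suc H_def e by (rule alg)
  qed
  also have "\<dots> = (?w * ?m) * (Int_on A (\<lambda>x. D k x * g x) - (\<epsilon> * ?r) * Int_on A g
      + \<epsilon> * Int_on A (\<lambda>x. \<phi> k x * (D k x * g x)) - (\<epsilon>\<^sup>2 * ?r) * Int_on A (\<lambda>x. \<phi> k x * g x))"
    unfolding set_integral_mult_right Int_on_diff[OF bdd_meas_add[OF bdd_meas_diff[OF b1 b2] b3] b4 mA]
      Int_on_add[OF bdd_meas_diff[OF b1 b2] b3 mA] Int_on_diff[OF b1 b2 mA] ..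
  also have "\<dots> = 0"
    unfolding D_orth[OF A g(1)] phi_D[OF A g(1) y] phi_orth[OF A S_in_S2[OF g(1)]] by simp
  finally show ?thesis .
next
  case False
  have "Int_on A (\<lambda>x. W (Suc k) x * (H k x * q x)) = Int_on A (\<lambda>x. 0)"
    by (rule Int_on_cong) (use H_inactive[OF False] At_subset[OF A] in auto)
  then show ?thesis by simp
qed

text \<open>\<open>2 * L / c6\<close> stems from \<open>D k\<close>,
  \<open>2 * \<epsilon>\<^sup>2 * L\<close> from the drift and \<open>1 + \<epsilon>\<close> from
  the new factor of the weight; division by \<open>\<epsilon>\<close> turns \<open>\<rho>\<close>
  into the step of \<open>M\<close>.\<close>

definition Ce :: real where "Ce = (1 + \<epsilon>) * (2 * L / c6 + 2 * \<epsilon>\<^sup>2 * L) / \<epsilon>"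

lemma Ce_nonneg: "0 \<le> Ce"
  unfolding Ce_def using eps_pos c6_pos L_nonneg by simp

text \<open>As the increments are bounded, \<open>(D k x)\<^sup>2\<close> is at most
  \<open>L * \<bar>D k x\<bar>\<close>, whose integral is controlled by the drift. So the energy of
  a step is at most a multiple of \<open>\<epsilon> * \<rho>\<close> over the squared
  damping.\<close>

lemma energy_local:
  assumes A: "A \<in> At k"
  shows "Int_on A (\<lambda>x. W (Suc k) x * (H k x)\<^sup>2) \<le> Ce * Int_on A (\<lambda>x. W k x * (b k x - b (Suc k) x))"
proof (cases "active k")
  case True
  obtain y where y: "y \<in> A" using At_nonempty[OF A] by blast
  note mA = At_measurable[OF A]
  have y\<Omega>: "y \<in> \<Omega>" using At_subset[OF A] y by blast
  define w m0 m r where "w = W k y" and "m0 = 1 + M k y" and "m = 1 + M (Suc k) y" and "r = \<rho> k y"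
  have pos: "0 < w" "0 < m0" "0 \<le> r" "r \<le> L"
    using W_pos M_nonneg[OF y\<Omega>, of k] rho_nonneg[OF y\<Omega>] rho_le[OF y\<Omega>] by (auto simp: w_def m0_def r_def)
  have "0 \<le> \<epsilon> * r" using pos(3) eps_pos by simp
  then have m: "m = m0 + \<epsilon> * r" "0 < m" using pos(2) by (simp_all add: m_def m0_def M_Suc r_def)
  have bb: "bdd_meas A (\<lambda>x. \<bar>D k x\<bar>)" "bdd_meas A (H k)" "bdd_meas A (W (Suc k))"
    using bdd_meas_At[OF _ A] bdd_D bdd_H bdd_W by auto
  let ?K = "w * (1 + \<epsilon>) / m\<^sup>2"
  have K0: "0 \<le> ?K" using pos eps_pos by simp
  have "Int_on A (\<lambda>x. W (Suc k) x * (H k x)\<^sup>2) \<le> Int_on A (\<lambda>x. ?K * (2 * L * \<bar>D k x\<bar> + 2 * (\<epsilon> * r)\<^sup>2))"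
  proof (rule Int_on_mono[OF _ _ mA])
    show "bdd_meas A (\<lambda>x. W (Suc k) x * (H k x)\<^sup>2)" by (intro bdd_meas_mult bdd_meas_power bb)
    show "bdd_meas A (\<lambda>x. ?K * (2 * L * \<bar>D k x\<bar> + 2 * (\<epsilon> * r)\<^sup>2))"
      by (intro bdd_meas_mult bdd_meas_add bdd_meas_const bb)
    fix x assume x: "x \<in> A"
    then have x\<Omega>: "x \<in> \<Omega>" using At_subset[OF A] by blast
    have e: "W k x = w" "1 + M (Suc k) x = m" "\<rho> k x = r"
      using W_const[OF True A x y] M_const[OF A order_refl x y] rho_const[OF A x y] by (auto simp: w_def m_def r_def)
    have "(D k x - \<epsilon> * r)\<^sup>2 \<le> 2 * (D k x)\<^sup>2 + 2 * (\<epsilon> * r)\<^sup>2"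
      using zero_le_power2[of "D k x + \<epsilon> * r"] by (simp add: power2_eq_square algebra_simps)
    also have "(D k x)\<^sup>2 \<le> L * \<bar>D k x\<bar>"
    proof -
      have "(D k x)\<^sup>2 = \<bar>D k x\<bar> * \<bar>D k x\<bar>" by (simp add: power2_eq_square)
      also have "\<dots> \<le> L * \<bar>D k x\<bar>" using D_bound[OF x\<Omega>] by (rule mult_right_mono) simp
      finally show ?thesis .
    qed
    finally have "(D k x - \<epsilon> * r)\<^sup>2 \<le> 2 * L * \<bar>D k x\<bar> + 2 * (\<epsilon> * r)\<^sup>2" by simp
    moreover have "W (Suc k) x \<le> w * (1 + \<epsilon>)"
      unfolding W_Suc e using factor_bounds(2) pos by (intro mult_left_mono) auto
    ultimately have "W (Suc k) x * (D k x - \<epsilon> * r)\<^sup>2 \<le> (w * (1 + \<epsilon>)) * (2 * L * \<bar>D k x\<bar> + 2 * (\<epsilon> * r)\<^sup>2)"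
      using pos eps_pos by (intro mult_mono) auto
    then have "W (Suc k) x * (D k x - \<epsilon> * r)\<^sup>2 / m\<^sup>2 \<le> (w * (1 + \<epsilon>)) * (2 * L * \<bar>D k x\<bar> + 2 * (\<epsilon> * r)\<^sup>2) / m\<^sup>2"
      by (rule divide_right_mono) simp
    then show "W (Suc k) x * (H k x)\<^sup>2 \<le> ?K * (2 * L * \<bar>D k x\<bar> + 2 * (\<epsilon> * r)\<^sup>2)"
      unfolding H_def e by (simp add: power_mult_distrib power_divide)
  qed
  also have "\<dots> = ?K * (2 * L * Int_on A (\<lambda>x. \<bar>D k x\<bar>) + 2 * (\<epsilon> * r)\<^sup>2 * vol A)"
  proof -
    have b2: "bdd_meas A (\<lambda>x. 2 * L * \<bar>D k x\<bar>)" by (intro bdd_meas_mult bdd_meas_const bb)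
    show ?thesis
      unfolding set_integral_mult_right Int_on_add[OF b2 bdd_meas_const mA] Int_on_const[OF mA]
      by (simp only: mult.assoc)
  qed
  also have "\<dots> \<le> ?K * ((2 * L / c6 + 2 * \<epsilon>\<^sup>2 * L) * (r * vol A))"
  proof (rule mult_left_mono[OF _ K0])
    have "c6 * Int_on A (\<lambda>x. \<bar>D k x\<bar>) \<le> r * vol A" using D_le_rho[OF A y] by (simp add: r_def)
    then have "Int_on A (\<lambda>x. \<bar>D k x\<bar>) \<le> r * vol A / c6" using c6_pos by (simp add: field_simps)
    then have "2 * L * Int_on A (\<lambda>x. \<bar>D k x\<bar>) \<le> 2 * L * (r * vol A / c6)"
      using L_nonneg by (intro mult_left_mono) auto
    moreover have "2 * (\<epsilon> * r)\<^sup>2 * vol A \<le> 2 * \<epsilon>\<^sup>2 * L * (r * vol A)"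
    proof -
      have "r * r \<le> L * r" using pos by (intro mult_right_mono)
      then have "2 * \<epsilon>\<^sup>2 * vol A * (r * r) \<le> 2 * \<epsilon>\<^sup>2 * vol A * (L * r)" by (intro mult_left_mono) auto
      then show ?thesis by (simp add: power_mult_distrib power2_eq_square mult_ac)
    qed
    ultimately show "2 * L * Int_on A (\<lambda>x. \<bar>D k x\<bar>) + 2 * (\<epsilon> * r)\<^sup>2 * vol A
        \<le> (2 * L / c6 + 2 * \<epsilon>\<^sup>2 * L) * (r * vol A)"
      by (simp add: distrib_right)
  qed
  also have "\<dots> = Ce * (w * (\<epsilon> * r / m\<^sup>2) * vol A)"
    unfolding Ce_def using eps_pos by simp
  also have "\<dots> \<le> Ce * (w * (1 / m0 - 1 / m) * vol A)"
  proof -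
    \<comment> \<open>Replacing one factor \<open>m\<close> by the smaller \<open>m0\<close> turns
      the bound into a difference of consecutive values of \<open>b\<close>.\<close>
    have "\<epsilon> * r / m\<^sup>2 \<le> \<epsilon> * r / (m0 * m)"
      using pos m eps_pos unfolding power2_eq_square
      by (intro divide_left_mono mult_right_mono) auto
    also have "\<dots> = 1 / m0 - 1 / m" using pos m by (simp add: field_simps)
    finally show ?thesis using Ce_nonneg pos by (intro mult_left_mono mult_right_mono) auto
  qed
  also have "w * (1 / m0 - 1 / m) * vol A = Int_on A (\<lambda>x. w * (1 / m0 - 1 / m))"
    by (rule Int_on_const[OF mA, symmetric])
  also have "\<dots> = Int_on A (\<lambda>x. W k x * (b k x - b (Suc k) x))"
  proof (rule Int_on_cong)
    fix x assume x: "x \<in> A"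
    have "W k x = w" "b k x = 1 / m0" "b (Suc k) x = 1 / m"
      using W_const[OF True A x y] M_const[OF A _ x y, of k] M_const[OF A order_refl x y]
      by (auto simp: w_def m0_def m_def b_def)
    then show "w * (1 / m0 - 1 / m) = W k x * (b k x - b (Suc k) x)" by simp
  qed
  finally show ?thesis .
next
  case False
  have "Int_on A (\<lambda>x. W (Suc k) x * (H k x)\<^sup>2) = Int_on A (\<lambda>x. 0)"
    by (rule Int_on_cong) (use H_inactive[OF False] At_subset[OF A] in auto)
  moreover have "Int_on A (\<lambda>x. W k x * (b k x - b (Suc k) x)) = Int_on A (\<lambda>x. 0)"
    by (rule Int_on_cong) (use rho_inactive[OF False] At_subset[OF A] in \<open>auto simp: b_def M_Suc\<close>)
  ultimately show ?thesis by simp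
qed

section \<open>The energy over the whole domain\<close>

lemma domain_At: "\<Omega> \<in> At 0" by (simp add: At_0)

definition \<beta> :: "nat \<Rightarrow> real" where "\<beta> k = Int_on \<Omega> (\<lambda>x. W k x * b k x)"

lemma energy_global: "Int_on \<Omega> (\<lambda>x. W (Suc k) x * (H k x)\<^sup>2) \<le> Ce * (\<beta> k - \<beta> (Suc k))"
proof -
  have bd: "bdd_meas \<Omega> (\<lambda>x. W k x * b k x)" "bdd_meas \<Omega> (\<lambda>x. W k x * b (Suc k) x)"
    by (intro bdd_meas_mult bdd_W bdd_b)+
  have "Int_on \<Omega> (\<lambda>x. W (Suc k) x * (H k x)\<^sup>2) \<le> Int_on \<Omega> (\<lambda>x. Ce * (W k x * (b k x - b (Suc k) x)))"
  proof (rule Int_on_local_le[OF domain_At le0[of k]])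
    show "bdd_meas \<Omega> (\<lambda>x. W (Suc k) x * (H k x)\<^sup>2)" by (intro bdd_meas_mult bdd_meas_power bdd_W bdd_H)
    show "bdd_meas \<Omega> (\<lambda>x. Ce * (W k x * (b k x - b (Suc k) x)))"
      by (intro bdd_meas_mult bdd_meas_const bdd_meas_diff bdd_W bdd_b)
    fix B assume "B \<in> At k"
    from energy_local[OF this]
    show "Int_on B (\<lambda>x. W (Suc k) x * (H k x)\<^sup>2) \<le> Int_on B (\<lambda>x. Ce * (W k x * (b k x - b (Suc k) x)))" by simp
  qed
  also have "\<dots> = Ce * Int_on \<Omega> (\<lambda>x. W k x * b k x - W k x * b (Suc k) x)"
    by (subst set_integral_mult_right) (simp add: right_diff_distrib)
  also have "\<dots> = Ce * (\<beta> k - Int_on \<Omega> (\<lambda>x. W k x * b (Suc k) x))"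
    unfolding Int_on_diff[OF bd domain_measurable] \<beta>_def ..
  \<comment> \<open>\<open>b (Suc k)\<close> is constant on the atoms of level \<open>k\<close>, so
    the weight may be advanced and the difference telescopes.\<close>
  also have "Int_on \<Omega> (\<lambda>x. W k x * b (Suc k) x) = \<beta> (Suc k)"
    unfolding \<beta>_def
  proof (rule W_step_piecewise[OF domain_At le0 bdd_b, symmetric])
    fix B assume "B \<in> At k"
    from pwD[OF pw_b[OF order_refl] this] obtain u where "u \<in> S" "\<forall>x\<in>B. b (Suc k) x = u x" by metis
    then show "\<exists>u\<in>S2. \<forall>x\<in>B. b (Suc k) x = u x" using S_in_S2 by blast
  qed
  finally show ?thesis .
qed

text \<open>Pythagoras for the partial sums: the cross term vanishes by \<open>W_H_orth\<close>, and
  the weight under the earlier square can be advanced because this square is piecewise in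
  \<open>S2\<close>.\<close>

lemma square_step:
  assumes A: "A \<in> At n" "n \<le> j" "m \<le> j"
  shows "Int_on A (\<lambda>x. W (Suc j) x * (G (Suc j) x - G m x)\<^sup>2) =
    Int_on A (\<lambda>x. W j x * (G j x - G m x)\<^sup>2) + Int_on A (\<lambda>x. W (Suc j) x * (H j x)\<^sup>2)"
proof -
  note mA = At_measurable[OF A(1)]
  let ?q = "\<lambda>x. G j x - G m x"
  have q: "pw j ?q" using pw_diff[OF pw_G[OF order_refl] pw_G[OF A(3)]] .
  note bq = pw_bdd[OF q]
  have bs: "bdd_meas \<Omega> (\<lambda>x. W (Suc j) x * (?q x)\<^sup>2)" "bdd_meas \<Omega> (\<lambda>x. 2 * (W (Suc j) x * (H j x * ?q x)))"
    "bdd_meas \<Omega> (\<lambda>x. W (Suc j) x * (H j x)\<^sup>2)"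
    by (intro bdd_meas_mult bdd_meas_power bdd_meas_const bdd_W bdd_H bq)+
  note bA = bs[THEN bdd_meas_At[OF _ A(1)]]
  have "Int_on A (\<lambda>x. W (Suc j) x * (G (Suc j) x - G m x)\<^sup>2) =
      Int_on A (\<lambda>x. W (Suc j) x * (?q x)\<^sup>2 + 2 * (W (Suc j) x * (H j x * ?q x)) + W (Suc j) x * (H j x)\<^sup>2)"
    by (rule Int_on_cong) (simp add: G_Suc power2_eq_square algebra_simps)
  also have "\<dots> = Int_on A (\<lambda>x. W (Suc j) x * (?q x)\<^sup>2) + 2 * Int_on A (\<lambda>x. W (Suc j) x * (H j x * ?q x))
      + Int_on A (\<lambda>x. W (Suc j) x * (H j x)\<^sup>2)"
    unfolding Int_on_add[OF bdd_meas_add[OF bA(1,2)] bA(3) mA] Int_on_add[OF bA(1,2) mA] set_integral_mult_right ..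
  also have "Int_on A (\<lambda>x. W (Suc j) x * (H j x * ?q x)) = Int_on A (\<lambda>x. 0)"
  proof (rule Int_on_local_eq[OF A(1,2)])
    show "bdd_meas \<Omega> (\<lambda>x. W (Suc j) x * (H j x * ?q x))" by (intro bdd_meas_mult bdd_W bdd_H bq)
    fix B assume "B \<in> At j"
    from W_H_orth[OF this q] show "Int_on B (\<lambda>x. W (Suc j) x * (H j x * ?q x)) = Int_on B (\<lambda>x. 0)" by simp
  qed simp
  also have "Int_on A (\<lambda>x. W (Suc j) x * (?q x)\<^sup>2) = Int_on A (\<lambda>x. W j x * (?q x)\<^sup>2)"
  proof (rule W_step_piecewise[OF A(1,2) bdd_meas_power[OF bq]])
    fix B assume B: "B \<in> At j"
    obtain u where u: "u \<in> S" "\<forall>x\<in>B. ?q x = u x" using pwD[OF q B] by metis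
    show "\<exists>v\<in>S2. \<forall>x\<in>B. (?q x)\<^sup>2 = v x"
      by (rule bexI[OF _ S2_mult[OF u(1) u(1)]]) (use u(2) in \<open>simp add: power2_eq_square\<close>)
  qed
  finally show ?thesis by simp
qed

lemma square_mono:
  assumes A: "A \<in> At n" "n \<le> j" "m \<le> j"
  shows "Int_on A (\<lambda>x. W j x * (G j x - G m x)\<^sup>2) \<le> Int_on A (\<lambda>x. W (j + i) x * (G (j + i) x - G m x)\<^sup>2)"
proof (induction i)
  case 0
  show ?case by simp
next
  case (Suc i)
  have "0 \<le> Int_on A (\<lambda>x. W (Suc (j + i)) x * (H (j + i) x)\<^sup>2)"
    using W_pos by (intro Int_on_nonneg mult_nonneg_nonneg) (auto simp: less_imp_le)
  then show ?case using Suc square_step[OF A(1), of "j + i" m] A by simp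
qed

lemma square_le: "Int_on \<Omega> (\<lambda>x. W (m + i) x * (G (m + i) x - G m x)\<^sup>2) \<le> Ce * (\<beta> m - \<beta> (m + i))"
proof (induction i)
  case 0
  show ?case by simp
next
  case (Suc i)
  have "Ce * (\<beta> m - \<beta> (m + i)) + Ce * (\<beta> (m + i) - \<beta> (Suc (m + i))) = Ce * (\<beta> m - \<beta> (m + Suc i))"
    by (simp add: algebra_simps)
  then show ?case using Suc square_step[OF domain_At, of "m + i" m] energy_global[of "m + i"] by simp
qed

lemma beta_nonneg: "0 \<le> \<beta> k"
  unfolding \<beta>_def b_def using W_pos M_nonneg
  by (intro Int_on_nonneg mult_nonneg_nonneg) (auto simp: less_imp_le add_nonneg_nonneg)

text \<open>\<open>\<beta>\<close> decreases and is nonnegative, so the energy beyond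
  \<open>m\<close> is bounded by a tail of a convergent sequence. For \<open>Ce = 0\<close> the
  energy bound says nothing about the monotonicity of \<open>\<beta>\<close>, but then all energies
  vanish.\<close>

lemma energy_small:
  assumes "0 < \<delta>"
  shows "\<exists>m. \<forall>J\<ge>m. Int_on \<Omega> (\<lambda>x. W J x * (G J x - G m x)\<^sup>2) \<le> \<delta>"
proof (cases "Ce = 0")
  case True
  have "Int_on \<Omega> (\<lambda>x. W J x * (G J x - G 0 x)\<^sup>2) \<le> \<delta>" for J
    using square_le[of 0 J] True assms by simp
  then show ?thesis by (intro exI[of _ 0]) blast
next
  case False
  then have Ce: "0 < Ce" using Ce_nonneg by simp
  have dec: "\<beta> (Suc k) \<le> \<beta> k" for k
  proof -
    have "0 \<le> Int_on \<Omega> (\<lambda>x. W (Suc k) x * (H k x)\<^sup>2)"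
      using W_pos by (intro Int_on_nonneg mult_nonneg_nonneg) (auto simp: less_imp_le)
    then have "0 \<le> Ce * (\<beta> k - \<beta> (Suc k))" using energy_global[of k] by linarith
    then show ?thesis using Ce by (simp add: zero_le_mult_iff)
  qed
  have "decseq \<beta>" using dec by (rule decseq_SucI)
  then obtain B where "\<beta> \<longlonglongrightarrow> B" using decseq_convergent[of \<beta> 0] beta_nonneg by blast
  then have "Cauchy \<beta>" by (rule LIMSEQ_imp_Cauchy)
  moreover have "0 < \<delta> / Ce" using assms Ce by simp
  ultimately obtain m where m: "\<And>i j. i \<ge> m \<Longrightarrow> j \<ge> m \<Longrightarrow> norm (\<beta> i - \<beta> j) < \<delta> / Ce"
    using CauchyD by metis
  have "Int_on \<Omega> (\<lambda>x. W J x * (G J x - G m x)\<^sup>2) \<le> \<delta>" if "J \<ge> m" for J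
  proof -
    have "Int_on \<Omega> (\<lambda>x. W J x * (G J x - G m x)\<^sup>2) \<le> Ce * (\<beta> m - \<beta> J)"
      using square_le[of m "J - m"] that by simp
    also have "\<beta> m - \<beta> J \<le> \<delta> / Ce" using m[OF order_refl that] by simp
    then have "Ce * (\<beta> m - \<beta> J) \<le> Ce * (\<delta> / Ce)" using Ce by (intro mult_left_mono) auto
    also have "\<dots> = \<delta>" using Ce by simp
    finally show ?thesis .
  qed
  then show ?thesis by blast
qed

end

lemma (in atom_tree) antichain_sum_le:
  assumes C: "\<And>n. C n \<subseteq> At n" and anti: "\<And>n n' A B. n < n' \<Longrightarrow> A \<in> C n \<Longrightarrow> B \<in> C n' \<Longrightarrow> A \<inter> B = {}"
    and Y: "\<And>n A. A \<in> C n \<Longrightarrow> A \<subseteq> Y" "Y \<in> lmeasurable" and h: "bdd_meas Y h" "\<And>x. x \<in> Y \<Longrightarrow> 0 \<le> h x"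
  shows "(\<Sum>n<J. \<Sum>A\<in>C n. Int_on A h) \<le> Int_on Y h"
proof -
  have fin: "finite (C n)" for n using finite_subset[OF C finite_At] .
  have ne: "A \<noteq> {}" if "A \<in> C n" for A n using that C At_nonempty by blast
  have disj: "C n \<inter> C n' = {}" if "n \<noteq> n'" for n n'
  proof (rule ccontr)
    assume "C n \<inter> C n' \<noteq> {}"
    then obtain A where A: "A \<in> C n" "A \<in> C n'" by blast
    have "A \<inter> A = {}" using anti[of n n' A A] anti[of n' n A A] A that by (metis linorder_neqE_nat)
    then show False using ne[OF A(1)] by simp
  qed
  let ?U = "\<Union>n<J. C n"
  have "(\<Sum>n<J. \<Sum>A\<in>C n. Int_on A h) = (\<Sum>A\<in>?U. Int_on A h)"
    by (rule sum.UNION_disjoint[symmetric]) (use fin disj in auto)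
  also have "\<dots> = Int_on (\<Union>?U) h"
  proof (rule Int_on_finite_Union[symmetric])
    have sub: "\<Union>?U \<subseteq> Y" using Y(1) by blast
    show "bdd_meas (\<Union>?U) h" using h(1) sub by (rule bdd_meas_subset)
    show "finite ?U" using fin by simp
    show "B \<in> lmeasurable" if "B \<in> ?U" for B using that C At_measurable by blast
    show "disjoint ?U"
      unfolding disjoint_def
    proof (intro ballI impI)
      fix A B assume "A \<in> ?U" "B \<in> ?U" and AB: "A \<noteq> B"
      then obtain n n' where n: "A \<in> C n" "B \<in> C n'" by blast
      consider "n < n'" | "n' < n" | "n = n'" by linarith
      then show "A \<inter> B = {}"
      proof cases
        case 1
        then show ?thesis using anti n by blast
      next
        case 2
        then have "B \<inter> A = {}" using anti n by blast
        then show ?thesis by blast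
      next
        case 3
        then have "A \<in> At n" "B \<in> At n" using C n by blast+
        then show ?thesis using At_disjoint AB by metis
      qed
    qed
  qed
  also have "\<dots> \<le> Int_on Y h"
  proof (rule Int_on_mono_set[OF h(1) Y(2) _ _ h(2)])
    show "\<Union>?U \<in> lmeasurable"
      using fin C At_measurable by (intro fmeasurable.finite_Union) blast+
    show "\<Union>?U \<subseteq> Y" using Y(1) by blast
  qed
  finally show ?thesis .
qed

section \<open>Branches avoiding exceptional families of atoms\<close>

context multiplied
begin

text \<open>The mass of an atom. By \<open>Q_future\<close> later weights give the same value, so
  \<open>Q\<close> is additive along the tree.\<close>

definition Q :: "nat \<Rightarrow> 'a set \<Rightarrow> real" where "Q n A = Int_on A (W n)"

lemma Q_0: "Q 0 \<Omega> = 1"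
proof -
  have "Q 0 \<Omega> = Int_on \<Omega> (\<lambda>x. 1)" unfolding Q_def by (rule Int_on_cong) (rule W_0)
  then show ?thesis using Int_on_const[OF domain_measurable, of 1] measure_domain by simp
qed

lemma Q_comparable:
  assumes A: "A \<in> At n"
  obtains w where "0 < w" "\<And>x. x \<in> A \<Longrightarrow> w / 2 \<le> W n x" "\<And>x. x \<in> A \<Longrightarrow> W n x \<le> 3 / 2 * w"
proof -
  from W_comparable[OF A] obtain w where w: "0 < w" "\<forall>x\<in>A. w * (1 - \<epsilon>) \<le> W n x \<and> W n x \<le> w * (1 + \<epsilon>)" by blast
  have "w * (1 / 2) \<le> w * (1 - \<epsilon>)" "w * (1 + \<epsilon>) \<le> w * (3 / 2)"
    using w(1) eps_le by (auto intro!: mult_left_mono)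
  then have "w / 2 \<le> W n x" "W n x \<le> 3 / 2 * w" if "x \<in> A" for x
    using w(2) that by (auto simp: mult.commute dest!: bspec[of A _ x])
  then show ?thesis using w(1) by (intro that[of w])
qed

lemma Q_bounds:
  assumes A: "A \<in> At n" and w: "\<And>x. x \<in> A \<Longrightarrow> w / 2 \<le> W n x" "\<And>x. x \<in> A \<Longrightarrow> W n x \<le> 3 / 2 * w"
  shows "w / 2 * vol A \<le> Q n A" "Q n A \<le> 3 / 2 * w * vol A"
proof -
  note mA = At_measurable[OF A]
  note bW = bdd_meas_At[OF bdd_W A]
  show "w / 2 * vol A \<le> Q n A"
    unfolding Q_def Int_on_const[OF mA, symmetric] by (rule Int_on_mono[OF bdd_meas_const bW mA w(1)])
  show "Q n A \<le> 3 / 2 * w * vol A"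
    unfolding Q_def Int_on_const[OF mA, symmetric] by (rule Int_on_mono[OF bW bdd_meas_const mA w(2)])
qed

lemma Q_pos: "A \<in> At n \<Longrightarrow> 0 < Q n A"
proof -
  assume A: "A \<in> At n"
  obtain w where w: "0 < w" "\<And>x. x \<in> A \<Longrightarrow> w / 2 \<le> W n x" "\<And>x. x \<in> A \<Longrightarrow> W n x \<le> 3 / 2 * w"
    using Q_comparable[OF A] by metis
  have "0 < w / 2 * vol A" using w(1) vol_pos[OF A] by simp
  then show "0 < Q n A" using Q_bounds(1)[OF A w(2,3)] by linarith
qed

lemma Q_le: "A \<in> At n \<Longrightarrow> Q n A \<le> (1 + \<epsilon>) ^ n * vol A"
  unfolding Q_def
  using Int_on_mono[OF bdd_meas_At[OF bdd_W] bdd_meas_const At_measurable, of A n n n "(1 + \<epsilon>) ^ n"] W_le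
  by (simp add: Int_on_const[OF At_measurable])

lemma Q_future: "A \<in> At n \<Longrightarrow> Int_on A (W (n + k)) = Q n A"
proof (induction k)
  case 0
  then show ?case by (simp add: Q_def)
next
  case (Suc k)
  have "\<exists>u\<in>S2. \<forall>x\<in>B. (1::real) = u x" for B :: "'a set" using S_in_S2[OF one_in_S] by auto
  from W_step_piecewise[OF Suc.prems _ bdd_meas_const this, of "n + k"] Suc show ?case by simp
qed

lemma Q_descendants:
  assumes "A \<in> At n"
  shows "Q n A = (\<Sum>B\<in>{B \<in> At (n + k). B \<subseteq> A}. Q (n + k) B)"
  using Int_on_descendants[OF assms _ bdd_W, of "n + k" "n + k"] Q_future[OF assms, of k] by (simp add: Q_def)

lemma Q_children:
  assumes "A \<in> At n" "A' \<in> At (Suc n)" "A'' \<in> At (Suc n)" "A' \<union> A'' = A" "A' \<inter> A'' = {}"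
  shows "Q n A = Q (Suc n) A' + Q (Suc n) A''"
proof -
  have "bdd_meas (A' \<union> A'') (W (Suc n))" using bdd_meas_At[OF bdd_W assms(1)] assms(4) by simp
  from Int_on_Un[OF this At_measurable[OF assms(2)] At_measurable[OF assms(3)] assms(5)]
  show ?thesis using Q_future[OF assms(1), of 1] assms(4) by (simp add: Q_def)
qed

text \<open>Within an atom the weight varies by a factor of at most 3, the new factor is at least
  \<open>1 / 2\<close>, and the child has the share \<open>c1\<close> of the volume.\<close>

lemma Q_child_ge:
  assumes A: "A \<in> At n" and B: "B \<in> At (Suc n)" "B \<subseteq> A"
  shows "c1 / 6 * Q n A \<le> Q (Suc n) B"
proof -
  obtain w where w: "0 < w" "\<And>x. x \<in> A \<Longrightarrow> w / 2 \<le> W n x" "\<And>x. x \<in> A \<Longrightarrow> W n x \<le> 3 / 2 * w"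
    using Q_comparable[OF A] by metis
  have "w / 4 * vol B = Int_on B (\<lambda>x. w / 4)" by (rule Int_on_const[OF At_measurable[OF B(1)], symmetric])
  also have "\<dots> \<le> Q (Suc n) B"
    unfolding Q_def
  proof (rule Int_on_mono[OF bdd_meas_const bdd_meas_At[OF bdd_W B(1)] At_measurable[OF B(1)]])
    fix x assume "x \<in> B"
    then have x: "x \<in> A" using B by blast
    have "w / 2 * (1 / 2) \<le> W n x * (1 + \<epsilon> * \<phi> n x)"
      using w(1) w(2)[OF x] factor_bounds(1)[of n x] eps_le by (intro mult_mono) auto
    then show "w / 4 \<le> W (Suc n) x" by (simp add: W_Suc)
  qed
  finally have 1: "w / 4 * vol B \<le> Q (Suc n) B" .
  have "c1 * vol A \<le> vol B" using vol_descendant(1)[OF A, of B 1] B by simp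
  then have "w / 4 * (c1 * vol A) \<le> w / 4 * vol B" using w(1) by (intro mult_left_mono) auto
  moreover have "c1 / 6 * Q n A \<le> c1 / 6 * (3 / 2 * w * vol A)"
    using Q_bounds(2)[OF A w(2,3)] c1_pos by (intro mult_left_mono) auto
  ultimately show ?thesis using 1 by (simp add: mult_ac)
qed

lemma Q_descendant_ge:
  assumes A: "A \<in> At n"
  shows "B \<in> At (n + k) \<Longrightarrow> B \<subseteq> A \<Longrightarrow> (c1 / 6) ^ k * Q n A \<le> Q (n + k) B"
proof (induction k arbitrary: B)
  case 0
  then have "B = A" using At_disjoint[OF A] At_nonempty by (metis add_0_right inf.absorb2)
  then show ?case by simp
next
  case (Suc k)
  then have B: "B \<in> At (Suc (n + k))" by simp
  from parent[OF this] obtain E where E: "E \<in> At (n + k)" "B \<subseteq> E" by metis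
  obtain x where x: "x \<in> B" using At_nonempty[OF B] by blast
  have "E \<subseteq> A" using nested_or_disjoint[OF A E(1), of x] x E(2) Suc.prems by auto
  then have IH: "(c1 / 6) ^ k * Q n A \<le> Q (n + k) E" using Suc.IH E by blast
  have "c1 / 6 * ((c1 / 6) ^ k * Q n A) \<le> c1 / 6 * Q (n + k) E" using IH c1_pos by (intro mult_left_mono) auto
  also have "\<dots> \<le> Q (Suc (n + k)) B" by (rule Q_child_ge[OF E(1) B E(2)])
  finally show ?case by (simp add: mult_ac)
qed

text \<open>Total mass of the members of the families from level \<open>n\<close> on that lie inside
  \<open>A\<close>, nested members being counted separately. Values in \<open>ennreal\<close> spare
  all questions of convergence.\<close>

definition kap :: "(nat \<Rightarrow> 'a set set) \<Rightarrow> nat \<Rightarrow> 'a set \<Rightarrow> ennreal" where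
  "kap C n A = (\<Sum>j. ennreal (\<Sum>B\<in>{B \<in> At (n + j). B \<in> C (n + j) \<and> B \<subseteq> A}. Q (n + j) B))"

lemma kap_ge:
  assumes "A \<in> At n" "A \<in> C n"
  shows "ennreal (Q n A) \<le> kap C n A"
proof -
  have same: "B = A" if "B \<in> At n" "B \<subseteq> A" for B
    using At_disjoint[OF that(1) assms(1)] At_nonempty[OF that(1)] that(2) by (simp add: inf.absorb1)
  have "{B \<in> At n. B \<in> C n \<and> B \<subseteq> A} = {A}"
  proof
    show "{B \<in> At n. B \<in> C n \<and> B \<subseteq> A} \<subseteq> {A}" using same by blast
    show "{A} \<subseteq> {B \<in> At n. B \<in> C n \<and> B \<subseteq> A}" using assms by blast
  qed
  then have "(\<Sum>B\<in>{B \<in> At (n + 0). B \<in> C (n + 0) \<and> B \<subseteq> A}. Q (n + 0) B) = Q n A"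
    by (simp only: add_0_right) simp
  then show ?thesis unfolding kap_def
    using sum_le_suminf[OF summableI, of "{0}" "\<lambda>j. ennreal (\<Sum>B\<in>{B \<in> At (n + j). B \<in> C (n + j) \<and> B \<subseteq> A}. Q (n + j) B)"]
    by simp
qed

lemma kap_split:
  assumes A: "A \<in> At n" "A' \<in> At (Suc n)" "A'' \<in> At (Suc n)" "A' \<union> A'' = A" "A' \<inter> A'' = {}"
    and notin: "A \<notin> C n"
  shows "kap C n A = kap C (Suc n) A' + kap C (Suc n) A''"
proof -
  let ?g = "\<lambda>j. ennreal (\<Sum>B\<in>{B \<in> At (n + j). B \<in> C (n + j) \<and> B \<subseteq> A}. Q (n + j) B)"
  have same: "B = A" if "B \<in> At n" "B \<subseteq> A" for B
    using At_disjoint[OF that(1) A(1)] At_nonempty[OF that(1)] that(2) by (simp add: inf.absorb1)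
  then have e: "{B \<in> At n. B \<in> C n \<and> B \<subseteq> A} = {}" using notin by blast
  have g0: "?g 0 = 0" by (simp only: add_0_right e sum.empty ennreal_0)
  have gS: "?g (Suc j) = ennreal (\<Sum>B\<in>{B \<in> At (Suc n + j). B \<in> C (Suc n + j) \<and> B \<subseteq> A'}. Q (Suc n + j) B)
      + ennreal (\<Sum>B\<in>{B \<in> At (Suc n + j). B \<in> C (Suc n + j) \<and> B \<subseteq> A''}. Q (Suc n + j) B)" for j
  proof -
    have le: "Suc n \<le> Suc n + j" by simp
    note d = descendants_children[OF A le]
    have eq: "{B \<in> At (Suc n + j). B \<in> C (Suc n + j) \<and> B \<subseteq> A} =
        {B \<in> At (Suc n + j). B \<in> C (Suc n + j) \<and> B \<subseteq> A'} \<union> {B \<in> At (Suc n + j). B \<in> C (Suc n + j) \<and> B \<subseteq> A''}"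
      using d(1) by blast
    have "(\<Sum>B\<in>{B \<in> At (Suc n + j). B \<in> C (Suc n + j) \<and> B \<subseteq> A}. Q (Suc n + j) B) =
        (\<Sum>B\<in>{B \<in> At (Suc n + j). B \<in> C (Suc n + j) \<and> B \<subseteq> A'}. Q (Suc n + j) B)
        + (\<Sum>B\<in>{B \<in> At (Suc n + j). B \<in> C (Suc n + j) \<and> B \<subseteq> A''}. Q (Suc n + j) B)"
      unfolding eq by (rule sum.union_disjoint) (use d(2) in auto)
    moreover have "0 \<le> (\<Sum>B\<in>{B \<in> At (Suc n + j). B \<in> C (Suc n + j) \<and> B \<subseteq> E}. Q (Suc n + j) B)" for E
      by (rule sum_nonneg) (use Q_pos[of _ "Suc n + j"] in \<open>auto simp: less_imp_le\<close>)
    ultimately show ?thesis by (simp add: ennreal_plus[symmetric] del: ennreal_plus)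
  qed
  have "kap C n A = (\<Sum>j. ?g (Suc j))"
    unfolding kap_def using suminf_offset[of ?g 1, OF summableI] g0 by simp
  also have "\<dots> = kap C (Suc n) A' + kap C (Suc n) A''"
    unfolding gS kap_def by (rule suminf_add[symmetric]) auto
  finally show ?thesis .
qed

definition branch :: "(nat \<Rightarrow> 'a set) \<Rightarrow> bool" where
  "branch X \<longleftrightarrow> (\<forall>n. X n \<in> At n) \<and> (\<forall>n. X (Suc n) \<subseteq> X n)"

text \<open>\<open>kap\<close> and \<open>Q\<close> are both additive over the two children of an atom outside the families, so
  one of the children inherits the strict inequality between them.\<close>

lemma branch_avoiding:
  assumes "(\<Sum>i. kap (C i) 0 \<Omega>) < 1"
  shows "\<exists>X. branch X \<and> (\<forall>i n. X n \<notin> C i n)"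
proof -
  define P where "P n A \<longleftrightarrow> A \<in> At n \<and> (\<Sum>i. kap (C i) n A) < ennreal (Q n A)" for n A
  have P_notin: "A \<notin> C i n" if "P n A" for n A i
  proof
    assume "A \<in> C i n"
    then have "ennreal (Q n A) \<le> kap (C i) n A" using that by (intro kap_ge) (auto simp: P_def)
    also have "\<dots> < ennreal (Q n A)" using that ennreal_suminf_lessD[of "\<lambda>i. kap (C i) n A" "ennreal (Q n A)" i] by (simp add: P_def)
    finally show False by simp
  qed
  have step: "\<exists>B. P (Suc n) B \<and> B \<subseteq> A" if PA: "P n A" for n A
  proof -
    have A: "A \<in> At n" using PA by (simp add: P_def)
    obtain A' A'' where c: "A' \<in> At (Suc n)" "A'' \<in> At (Suc n)" "A' \<union> A'' = A" "A' \<inter> A'' = {}"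
      using children[OF A] by metis
    have "kap (C i) n A = kap (C i) (Suc n) A' + kap (C i) (Suc n) A''" for i
      by (rule kap_split[where C = "C i", OF A c P_notin[OF PA]])
    then have "(\<Sum>i. kap (C i) n A) = (\<Sum>i. kap (C i) (Suc n) A' + kap (C i) (Suc n) A'')" by simp
    also have "\<dots> = (\<Sum>i. kap (C i) (Suc n) A') + (\<Sum>i. kap (C i) (Suc n) A'')"
      by (rule suminf_add[symmetric]) auto
    finally have lt: "(\<Sum>i. kap (C i) (Suc n) A') + (\<Sum>i. kap (C i) (Suc n) A'')
        < ennreal (Q (Suc n) A') + ennreal (Q (Suc n) A'')"
      using PA Q_children[OF A c] Q_pos[OF c(1)] Q_pos[OF c(2)] by (simp add: P_def)
    have "P (Suc n) A' \<or> P (Suc n) A''"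
    proof (rule ccontr)
      assume "\<not> ?thesis"
      then have "ennreal (Q (Suc n) A') \<le> (\<Sum>i. kap (C i) (Suc n) A')" "ennreal (Q (Suc n) A'') \<le> (\<Sum>i. kap (C i) (Suc n) A'')"
        using c by (auto simp: P_def not_less)
      from add_mono[OF this] lt show False by simp
    qed
    then show ?thesis using c(3) by blast
  qed
  have "P 0 \<Omega>" using assms domain_At by (simp add: P_def Q_0)
  then obtain X where X: "\<forall>n. P n (X n) \<and> X (Suc n) \<subseteq> X n"
    using dependent_nat_choice[of P "\<lambda>n A B. B \<subseteq> A"] step by blast
  show ?thesis
  proof (intro exI[of _ X] conjI allI)
    show "branch X" using X by (simp add: branch_def P_def)
    show "X n \<notin> C i n" for i n using X P_notin by simp
  qed
qed

lemma kap_le: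
  assumes "\<And>J. (\<Sum>n<J. \<Sum>B\<in>{B \<in> At n. B \<in> C n}. Q n B) \<le> K"
  shows "kap C 0 \<Omega> \<le> ennreal K"
  unfolding kap_def
proof (rule suminf_le_const[OF summableI])
  fix J
  have nn: "0 \<le> (\<Sum>B\<in>{B \<in> At n. B \<in> C n}. Q n B)" for n
    by (rule sum_nonneg) (use Q_pos[of _ n] in \<open>auto simp: less_imp_le\<close>)
  have "{B \<in> At n. B \<in> C n \<and> B \<subseteq> \<Omega>} = {B \<in> At n. B \<in> C n}" for n using At_subset by blast
  then have "(\<Sum>j<J. ennreal (\<Sum>B\<in>{B \<in> At (0 + j). B \<in> C (0 + j) \<and> B \<subseteq> \<Omega>}. Q (0 + j) B)) =
      (\<Sum>j<J. ennreal (\<Sum>B\<in>{B \<in> At j. B \<in> C j}. Q j B))" by simp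
  also have "\<dots> = ennreal (\<Sum>n<J. \<Sum>B\<in>{B \<in> At n. B \<in> C n}. Q n B)" using nn by (intro sum_ennreal) auto
  also have "\<dots> \<le> ennreal K" using assms by (rule ennreal_leI)
  finally show "(\<Sum>j<J. ennreal (\<Sum>B\<in>{B \<in> At (0 + j). B \<in> C (0 + j) \<and> B \<subseteq> \<Omega>}. Q (0 + j) B)) \<le> ennreal K" .
qed

lemma kap_Un: "kap (\<lambda>n. C n \<union> C' n) n A \<le> kap C n A + kap C' n A"
proof -
  have le: "ennreal (\<Sum>B\<in>{B \<in> At m. B \<in> C m \<union> C' m \<and> B \<subseteq> A}. Q m B) \<le>
     ennreal (\<Sum>B\<in>{B \<in> At m. B \<in> C m \<and> B \<subseteq> A}. Q m B) + ennreal (\<Sum>B\<in>{B \<in> At m. B \<in> C' m \<and> B \<subseteq> A}. Q m B)" for m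
  proof -
    have nn: "0 \<le> sum (Q m) {B \<in> At m. R B}" for R
      by (rule sum_nonneg) (use Q_pos[of _ m] in \<open>auto simp: less_imp_le\<close>)
    have eq: "{B \<in> At m. B \<in> C m \<union> C' m \<and> B \<subseteq> A} = {B \<in> At m. B \<in> C m \<and> B \<subseteq> A} \<union> {B \<in> At m. B \<in> C' m \<and> B \<subseteq> A}" by blast
    have "sum (Q m) {B \<in> At m. B \<in> C m \<union> C' m \<and> B \<subseteq> A} \<le>
        sum (Q m) {B \<in> At m. B \<in> C m \<and> B \<subseteq> A} + sum (Q m) {B \<in> At m. B \<in> C' m \<and> B \<subseteq> A}"
      unfolding eq
    proof (subst sum.union_inter[symmetric])
      have "0 \<le> sum (Q m) ({B \<in> At m. B \<in> C m \<and> B \<subseteq> A} \<inter> {B \<in> At m. B \<in> C' m \<and> B \<subseteq> A})"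
        by (rule sum_nonneg) (use Q_pos[of _ m] in \<open>auto simp: less_imp_le\<close>)
      then show "sum (Q m) ({B \<in> At m. B \<in> C m \<and> B \<subseteq> A} \<union> {B \<in> At m. B \<in> C' m \<and> B \<subseteq> A}) \<le>
        sum (Q m) ({B \<in> At m. B \<in> C m \<and> B \<subseteq> A} \<union> {B \<in> At m. B \<in> C' m \<and> B \<subseteq> A}) +
        sum (Q m) ({B \<in> At m. B \<in> C m \<and> B \<subseteq> A} \<inter> {B \<in> At m. B \<in> C' m \<and> B \<subseteq> A})" by simp
    qed simp_all
    then show ?thesis using nn by (simp add: ennreal_plus[symmetric] ennreal_leI del: ennreal_plus)
  qed
  have "kap (\<lambda>n. C n \<union> C' n) n A \<le> (\<Sum>j. ennreal (\<Sum>B\<in>{B \<in> At (n + j). B \<in> C (n + j) \<and> B \<subseteq> A}. Q (n + j) B)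
      + ennreal (\<Sum>B\<in>{B \<in> At (n + j). B \<in> C' (n + j) \<and> B \<subseteq> A}. Q (n + j) B))"
    unfolding kap_def by (rule suminf_le[OF le]) auto
  also have "\<dots> = kap C n A + kap C' n A"
    unfolding kap_def by (rule suminf_add[symmetric]) auto
  finally show ?thesis .
qed

end

section \<open>Families of small mass that carry the exceptional events\<close>

context multiplied
begin

lemma branch_At: "branch X \<Longrightarrow> X n \<in> At n"
  by (simp add: branch_def)

lemma branch_subset:
  assumes "branch X" "n \<le> m"
  shows "X m \<subseteq> X n"
proof (rule lift_Suc_antimono_le[OF _ assms(2)])
  show "X (Suc n) \<subseteq> X n" for n using assms(1) by (simp add: branch_def)
qed

lemma branch_unique: "branch X \<Longrightarrow> n \<le> m \<Longrightarrow> A \<in> At n \<Longrightarrow> X m \<subseteq> A \<Longrightarrow> A = X n"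
proof -
  assume b: "branch X" and nm: "n \<le> m" and A: "A \<in> At n" "X m \<subseteq> A"
  obtain x where "x \<in> X m" using At_nonempty[OF branch_At[OF b]] by blast
  then show "A = X n" using At_eq[OF A(1) branch_At[OF b], of x] A(2) branch_subset[OF b nm] by blast
qed

text \<open>On the atom the squared difference is a polynomial in \<open>S2\<close> and the weight
  is comparable to a constant, so Remez bounds the value at any single point by the mean.\<close>

lemma sup_square_le:
  "\<exists>K>0. \<forall>n m A x t. A \<in> At n \<longrightarrow> m \<le> n \<longrightarrow> x \<in> A \<longrightarrow> 0 < t \<longrightarrow> t < \<bar>G n x - G m x\<bar>
     \<longrightarrow> t\<^sup>2 * Q n A \<le> K * Int_on A (\<lambda>x. W n x * (G n x - G m x)\<^sup>2)"
proof -
  have one: "0 < (1::real)" by simp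
  from remez_integral[OF one, of N, where 'a='a] obtain C where C: "0 < C"
    "\<forall>A E (p::'a \<Rightarrow> real) x. convex A \<longrightarrow> bounded A \<longrightarrow> A \<in> lmeasurable
     \<longrightarrow> E \<in> lmeasurable \<longrightarrow> E \<subseteq> A \<longrightarrow> 1 * vol A \<le> vol E
     \<longrightarrow> line_poly N p \<longrightarrow> continuous_on UNIV p \<longrightarrow> x \<in> A \<longrightarrow> \<bar>p x\<bar> * vol A \<le> C * Int_on E (\<lambda>y. \<bar>p y\<bar>)"
    by (elim exE conjE)
  show ?thesis
  proof (intro exI[of _ "3 * C"] conjI allI impI)
    show "0 < 3 * C" using C(1) by simp
    fix n m A x and t :: real
    assume A: "A \<in> At n" and mn: "m \<le> n" and x: "x \<in> A" and t: "0 < t" "t < \<bar>G n x - G m x\<bar>"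
    note mA = At_measurable[OF A]
    obtain u where u: "u \<in> S" "\<And>x. x \<in> A \<Longrightarrow> G n x - G m x = u x"
      using pwD[OF pw_diff[OF pw_G[OF order_refl] pw_G[OF mn]] A] by metis
    define p where "p = (\<lambda>x. u x * u x)"
    have p: "p \<in> S2" unfolding p_def by (rule S2_mult[OF u(1) u(1)])
    obtain w where w: "0 < w" "\<And>x. x \<in> A \<Longrightarrow> w / 2 \<le> W n x" "\<And>x. x \<in> A \<Longrightarrow> W n x \<le> 3 / 2 * w"
      using Q_comparable[OF A] by metis
    have "\<bar>p x\<bar> * vol A \<le> C * Int_on A (\<lambda>y. \<bar>p y\<bar>)"
      using C(2)[rule_format, OF convex_atom[OF A] At_bounded[OF A] mA mA order_refl _ line_poly_S2[OF p] continuous_S2[OF p] x] by simp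
    then have 1: "(u x)\<^sup>2 * vol A \<le> C * Int_on A (\<lambda>y. (u y)\<^sup>2)"
      by (simp add: p_def power2_eq_square)
    have "t * t \<le> \<bar>u x\<bar> * \<bar>u x\<bar>" using t u(2)[OF x] by (intro mult_mono) auto
    then have "t\<^sup>2 \<le> (u x)\<^sup>2" by (simp add: power2_eq_square)
    then have "t\<^sup>2 * vol A \<le> (u x)\<^sup>2 * vol A" by (rule mult_right_mono) simp
    with 1 have 2: "t\<^sup>2 * vol A \<le> C * Int_on A (\<lambda>y. (u y)\<^sup>2)" by linarith
    have 3: "w / 2 * Int_on A (\<lambda>y. (u y)\<^sup>2) \<le> Int_on A (\<lambda>x. W n x * (G n x - G m x)\<^sup>2)"
    proof -
      have bu: "bdd_meas A u" using bdd_meas_At[OF bdd_S[OF u(1)] A] .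
      have "w / 2 * Int_on A (\<lambda>y. (u y)\<^sup>2) = Int_on A (\<lambda>y. w / 2 * (u y)\<^sup>2)" by simp
      also have "\<dots> \<le> Int_on A (\<lambda>x. W n x * (u x)\<^sup>2)"
      proof (rule Int_on_mono[OF _ _ mA])
        show "bdd_meas A (\<lambda>y. w / 2 * (u y)\<^sup>2)" by (intro bdd_meas_mult bdd_meas_power bdd_meas_const bu)
        show "bdd_meas A (\<lambda>x. W n x * (u x)\<^sup>2)" by (intro bdd_meas_mult bdd_meas_power bdd_meas_At[OF bdd_W A] bu)
        show "w / 2 * (u x)\<^sup>2 \<le> W n x * (u x)\<^sup>2" if "x \<in> A" for x
          using w(2)[OF that] by (rule mult_right_mono) simp
      qed
      also have "\<dots> = Int_on A (\<lambda>x. W n x * (G n x - G m x)\<^sup>2)"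
        by (rule Int_on_cong) (simp add: u(2))
      finally show ?thesis .
    qed
    have "t\<^sup>2 * Q n A \<le> t\<^sup>2 * (3 / 2 * w * vol A)"
      using Q_bounds(2)[OF A w(2,3)] by (intro mult_left_mono) auto
    also have "\<dots> = 3 / 2 * w * (t\<^sup>2 * vol A)" by simp
    also have "\<dots> \<le> 3 / 2 * w * (C * Int_on A (\<lambda>y. (u y)\<^sup>2))" using 2 w(1) by (intro mult_left_mono) auto
    also have "\<dots> = 3 * C * (w / 2 * Int_on A (\<lambda>y. (u y)\<^sup>2))" by simp
    also have "\<dots> \<le> 3 * C * Int_on A (\<lambda>x. W n x * (G n x - G m x)\<^sup>2)" using 3 C(1) by (intro mult_left_mono) auto
    finally show "t\<^sup>2 * Q n A \<le> 3 * C * Int_on A (\<lambda>x. W n x * (G n x - G m x)\<^sup>2)" .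
  qed
qed

text \<open>A maximal inequality by stopping: \<open>C\<close> collects the first atoms on which the
  difference exceeds \<open>t\<close> somewhere. They form an antichain, and by
  \<open>square_mono\<close> their energies are bounded by the energy at one common later level,
  which is small for a suitable \<open>m\<close>.\<close>

lemma oscillation_family:
  assumes t: "0 < t" and \<delta>: "0 < \<delta>"
  shows "\<exists>C m. kap C 0 \<Omega> \<le> ennreal \<delta> \<and>
    (\<forall>X. branch X \<longrightarrow> (\<forall>n. X n \<notin> C n) \<longrightarrow> (\<forall>n>m. \<forall>x\<in>X n. \<bar>G n x - G m x\<bar> \<le> t))"
proof -
  from sup_square_le obtain K where K: "0 < K" "\<forall>n m A x t. A \<in> At n \<longrightarrow> m \<le> n \<longrightarrow> x \<in> A \<longrightarrow> 0 < t \<longrightarrow> t < \<bar>G n x - G m x\<bar>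
     \<longrightarrow> t\<^sup>2 * Q n A \<le> K * Int_on A (\<lambda>x. W n x * (G n x - G m x)\<^sup>2)"
    by (elim exE conjE)
  have "0 < \<delta> * t\<^sup>2 / K" using t \<delta> K(1) by simp
  from energy_small[OF this] obtain m where
    m: "\<forall>J\<ge>m. Int_on \<Omega> (\<lambda>x. W J x * (G J x - G m x)\<^sup>2) \<le> \<delta> * t\<^sup>2 / K" by (elim exE)
  define bad where "bad n A \<longleftrightarrow> m < n \<and> (\<exists>x\<in>A. t < \<bar>G n x - G m x\<bar>)" for n A
  define C where "C n = {A \<in> At n. bad n A \<and> (\<forall>n'<n. \<forall>A'\<in>At n'. A \<subseteq> A' \<longrightarrow> \<not> bad n' A')}" for n
  have CAt: "C n \<subseteq> At n" for n by (auto simp: C_def)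
  have anti: "A \<inter> B = {}" if "n < n'" and A: "A \<in> C n" and B: "B \<in> C n'" for n n' A B
  proof (rule ccontr)
    assume "A \<inter> B \<noteq> {}"
    then obtain x where "x \<in> A" "x \<in> B" by blast
    moreover have "A \<in> At n" "B \<in> At n'" using A B CAt by blast+
    ultimately have "B \<subseteq> A" using nested_or_disjoint[of A n B n' x] that(1) by simp
    moreover have "bad n A" using A by (simp add: C_def)
    ultimately show False using B that(1) \<open>A \<in> At n\<close> by (auto simp: C_def)
  qed
  have "kap C 0 \<Omega> \<le> ennreal \<delta>"
  proof (rule kap_le)
    fix J
    \<comment> \<open>The level \<open>m + J\<close> is beyond or equal to each
      \<open>n < J\<close>, so all stopped atoms are compared with the same integrand.\<close>
    define h where "h = (\<lambda>x. W (m + J) x * (G (m + J) x - G m x)\<^sup>2)"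
    have bh: "bdd_meas \<Omega> h" unfolding h_def by (intro bdd_meas_mult bdd_meas_power bdd_meas_diff bdd_W bdd_G)
    have h0: "0 \<le> h x" for x unfolding h_def using W_pos[of "m + J" x] by simp
    have "t\<^sup>2 * (\<Sum>n<J. \<Sum>B\<in>{B \<in> At n. B \<in> C n}. Q n B) = (\<Sum>n<J. \<Sum>B\<in>C n. t\<^sup>2 * Q n B)"
      unfolding sum_distrib_left using CAt by (intro sum.cong) auto
    also have "\<dots> \<le> (\<Sum>n<J. \<Sum>B\<in>C n. K * Int_on B h)"
    proof (intro sum_mono)
      fix n B assume n: "n \<in> {..<J}" and B: "B \<in> C n"
      have BA: "B \<in> At n" using B CAt by blast
      from B obtain x where x: "m < n" "x \<in> B" "t < \<bar>G n x - G m x\<bar>" unfolding C_def bad_def by blast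
      have "t\<^sup>2 * Q n B \<le> K * Int_on B (\<lambda>x. W n x * (G n x - G m x)\<^sup>2)"
        using K(2)[rule_format, OF BA less_imp_le[OF x(1)] x(2) t x(3)] .
      also have "\<dots> \<le> K * Int_on B h"
      proof (rule mult_left_mono)
        have "n + (m + J - n) = m + J" using n by simp
        then show "Int_on B (\<lambda>x. W n x * (G n x - G m x)\<^sup>2) \<le> Int_on B h"
          unfolding h_def using square_mono[OF BA order_refl less_imp_le[OF x(1)], of "m + J - n"] by simp
      qed (use K(1) in simp)
      finally show "t\<^sup>2 * Q n B \<le> K * Int_on B h" .
    qed
    also have "\<dots> = K * (\<Sum>n<J. \<Sum>B\<in>C n. Int_on B h)" by (simp add: sum_distrib_left)
    also have "\<dots> \<le> K * Int_on \<Omega> h"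
    proof (rule mult_left_mono)
      show "(\<Sum>n<J. \<Sum>B\<in>C n. Int_on B h) \<le> Int_on \<Omega> h"
      proof (rule antichain_sum_le[OF CAt anti _ domain_measurable bh h0])
        show "A \<subseteq> \<Omega>" if "A \<in> C n" for n A using that CAt At_subset by blast
      qed
    qed (use K(1) in simp)
    also have "\<dots> \<le> K * (\<delta> * t\<^sup>2 / K)"
      unfolding h_def using m K(1) by (intro mult_left_mono) auto
    also have "\<dots> = t\<^sup>2 * \<delta>" using K(1) by simp
    finally show "(\<Sum>n<J. \<Sum>B\<in>{B \<in> At n. B \<in> C n}. Q n B) \<le> \<delta>" using t by simp
  qed
  moreover have "\<bar>G n x - G m x\<bar> \<le> t"
    if X: "branch X" "\<forall>n. X n \<notin> C n" and n: "m < n" "x \<in> X n" for X n x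
  proof (rule ccontr)
    assume "\<not> \<bar>G n x - G m x\<bar> \<le> t"
    then have "bad n (X n)" unfolding bad_def using n by (auto simp: not_le)
    then obtain k where k: "bad k (X k)" "\<And>j. j < k \<Longrightarrow> \<not> bad j (X j)"
      using exists_least_iff[of "\<lambda>n. bad n (X n)"] by blast
    have "X k \<in> C k"
      unfolding C_def
    proof (intro CollectI conjI allI impI ballI)
      fix n' A' assume "n' < k" "A' \<in> At n'" "X k \<subseteq> A'"
      then have "A' = X n'" using branch_unique[OF X(1), of n' k A'] by simp
      then show "\<not> bad n' A'" using k(2) \<open>n' < k\<close> by simp
    qed (use branch_At[OF X(1)] k in auto)
    then show False using X(2) by blast
  qed
  ultimately show ?thesis by blast
qed

text \<open>Every atom contains the closure of a descendant \<open>m\<close> levels deeper, which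
  carries at least the share \<open>\<sigma>\<close> of its mass. The atoms that fail to pass to
  such a descendant in \<open>k\<close> successive blocks of \<open>m\<close> levels after level
  \<open>i\<close> therefore have total mass at most \<open>(1 - \<sigma>) ^ k\<close>.\<close>

lemma interior_family:
  assumes \<delta>: "0 < \<delta>"
  shows "\<exists>C. kap C 0 \<Omega> \<le> ennreal \<delta> \<and>
    (\<forall>X. branch X \<longrightarrow> (\<forall>n. X n \<notin> C n) \<longrightarrow> (\<exists>n\<ge>i. \<exists>n'. closure (X n') \<subseteq> X n))"
proof -
  obtain m where m: "0 < m" "\<And>n A. A \<in> At n \<Longrightarrow> \<exists>B\<in>At (n + m). B \<subseteq> A \<and> closure B \<subseteq> A"
    using interior_descendant by metis
  define \<sigma> where "\<sigma> = (c1 / 6) ^ m"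
  have \<sigma>: "0 < \<sigma>" "\<sigma> < 1"
    unfolding \<sigma>_def using c1_pos c1_less_1 m(1) by (auto intro: power_less_one_iff[THEN iffD2])
  define E where "E = rec_nat (At i) (\<lambda>k T. {B \<in> At (i + Suc k * m). \<exists>A\<in>T. B \<subseteq> A \<and> \<not> closure B \<subseteq> A})"
  have E0: "E 0 = At i" and ES: "E (Suc k) = {B \<in> At (i + Suc k * m). \<exists>A\<in>E k. B \<subseteq> A \<and> \<not> closure B \<subseteq> A}" for k
    by (simp_all add: E_def)
  have EAt: "E k \<subseteq> At (i + k * m)" for k
    by (cases k) (auto simp: E0 ES)
  have finE: "finite (E k)" for k using finite_subset[OF EAt finite_At] .
  have bound: "(\<Sum>B\<in>E k. Q (i + k * m) B) \<le> (1 - \<sigma>) ^ k" for k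
  proof (induction k)
    case 0
    have "{B \<in> At i. B \<subseteq> \<Omega>} = At i" using At_subset by blast
    then show ?case using Q_descendants[OF domain_At, of i] by (simp add: E0 Q_0)
  next
    case (Suc k)
    let ?n = "i + k * m"
    have lev: "i + Suc k * m = ?n + m" by simp
    have "(\<Sum>B\<in>E (Suc k). Q (?n + m) B) \<le> (\<Sum>B\<in>(\<Union>A\<in>E k. {B \<in> At (?n + m). B \<subseteq> A \<and> \<not> closure B \<subseteq> A}). Q (?n + m) B)"
    proof (rule sum_mono2)
      show "finite (\<Union>A\<in>E k. {B \<in> At (?n + m). B \<subseteq> A \<and> \<not> closure B \<subseteq> A})" using finE by simp
      show "E (Suc k) \<subseteq> (\<Union>A\<in>E k. {B \<in> At (?n + m). B \<subseteq> A \<and> \<not> closure B \<subseteq> A})"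
        unfolding ES lev by blast
      show "0 \<le> Q (?n + m) B" if "B \<in> (\<Union>A\<in>E k. {B \<in> At (?n + m). B \<subseteq> A \<and> \<not> closure B \<subseteq> A}) - E (Suc k)" for B
        using that Q_pos[of B "?n + m"] by (auto simp: less_imp_le)
    qed
    also have "\<dots> \<le> (\<Sum>A\<in>E k. \<Sum>B\<in>{B \<in> At (?n + m). B \<subseteq> A \<and> \<not> closure B \<subseteq> A}. Q (?n + m) B)"
    proof (rule eq_refl, rule sum.UNION_disjoint[OF finE])
      show "\<forall>A\<in>E k. \<forall>A1\<in>E k. A \<noteq> A1 \<longrightarrow> {B \<in> At (?n + m). B \<subseteq> A \<and> \<not> closure B \<subseteq> A} \<inter>
         {B \<in> At (?n + m). B \<subseteq> A1 \<and> \<not> closure B \<subseteq> A1} = {}"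
      proof (intro ballI impI)
        fix A A1 assume "A \<in> E k" "A1 \<in> E k" "A \<noteq> A1"
        then have "A \<inter> A1 = {}" using EAt At_disjoint[of A ?n A1] by blast
        then show "{B \<in> At (?n + m). B \<subseteq> A \<and> \<not> closure B \<subseteq> A} \<inter>
         {B \<in> At (?n + m). B \<subseteq> A1 \<and> \<not> closure B \<subseteq> A1} = {}" using At_nonempty by blast
      qed
    qed simp
    also have "\<dots> \<le> (\<Sum>A\<in>E k. (1 - \<sigma>) * Q ?n A)"
    proof (rule sum_mono)
      fix A assume "A \<in> E k"
      then have A: "A \<in> At ?n" using EAt by blast
      obtain B where B: "B \<in> At (?n + m)" "B \<subseteq> A" "closure B \<subseteq> A" using m(2)[OF A] by blast
      have "(\<Sum>B\<in>{B \<in> At (?n + m). B \<subseteq> A \<and> \<not> closure B \<subseteq> A}. Q (?n + m) B)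
          \<le> (\<Sum>B\<in>{B \<in> At (?n + m). B \<subseteq> A} - {B}. Q (?n + m) B)"
      proof (rule sum_mono2)
        show "0 \<le> Q (?n + m) D" if "D \<in> {B \<in> At (?n + m). B \<subseteq> A} - {B} - {B \<in> At (?n + m). B \<subseteq> A \<and> \<not> closure B \<subseteq> A}" for D
          using that Q_pos[of D "?n + m"] by (auto simp: less_imp_le)
      qed (use B in auto)
      also have "\<dots> = Q ?n A - Q (?n + m) B"
        unfolding Q_descendants[OF A, of m] using B by (subst sum_diff1) auto
      also have "\<dots> \<le> (1 - \<sigma>) * Q ?n A"
        using Q_descendant_ge[OF A B(1,2)] by (simp add: \<sigma>_def algebra_simps)
      finally show "(\<Sum>B\<in>{B \<in> At (?n + m). B \<subseteq> A \<and> \<not> closure B \<subseteq> A}. Q (?n + m) B) \<le> (1 - \<sigma>) * Q ?n A" .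
    qed
    also have "\<dots> = (1 - \<sigma>) * (\<Sum>A\<in>E k. Q ?n A)" by (simp add: sum_distrib_left)
    also have "\<dots> \<le> (1 - \<sigma>) * (1 - \<sigma>) ^ k" using Suc \<sigma> by (intro mult_left_mono) auto
    finally show ?case unfolding lev by simp
  qed
  obtain k where k: "(1 - \<sigma>) ^ k < \<delta>"
    using real_arch_pow_inv[OF \<delta>, of "1 - \<sigma>"] \<sigma> by auto
  define C where "C n = (if n = i + k * m then E k else {})" for n
  have "kap C 0 \<Omega> \<le> ennreal \<delta>"
  proof (rule kap_le)
    fix J
    have nn: "0 \<le> (\<Sum>B\<in>E k. Q (i + k * m) B)"
      by (rule sum_nonneg) (use EAt[of k] Q_pos in \<open>auto intro: less_imp_le\<close>)
    have "{B \<in> At n. B \<in> C n} = C n" for n using EAt by (auto simp: C_def)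
    then have "(\<Sum>n<J. \<Sum>B\<in>{B \<in> At n. B \<in> C n}. Q n B) = (\<Sum>n<J. if n = i + k * m then \<Sum>B\<in>E k. Q (i + k * m) B else 0)"
      by (intro sum.cong) (auto simp: C_def)
    also have "\<dots> \<le> (\<Sum>B\<in>E k. Q (i + k * m) B)" using nn by (simp add: sum.delta)
    also have "\<dots> \<le> \<delta>" using bound[of k] k by linarith
    finally show "(\<Sum>n<J. \<Sum>B\<in>{B \<in> At n. B \<in> C n}. Q n B) \<le> \<delta>" .
  qed
  moreover have "\<exists>n\<ge>i. \<exists>n'. closure (X n') \<subseteq> X n" if X: "branch X" "\<forall>n. X n \<notin> C n" for X
  proof (rule ccontr)
    assume no: "\<not> ?thesis"
    have "X (i + j * m) \<in> E j" for j
    proof (induction j)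
      case 0
      then show ?case using branch_At[OF X(1)] by (simp add: E0)
    next
      case (Suc j)
      have "\<not> closure (X (i + Suc j * m)) \<subseteq> X (i + j * m)" using no by auto
      moreover have "X (i + Suc j * m) \<subseteq> X (i + j * m)" by (rule branch_subset[OF X(1)]) simp
      ultimately show ?case unfolding ES using Suc branch_At[OF X(1)] by blast
    qed
    then have "X (i + k * m) \<in> C (i + k * m)" by (simp add: C_def)
    then show False using X(2) by blast
  qed
  ultimately show ?thesis by blast
qed

text \<open>The weight gains at most the factor \<open>1 + \<epsilon>\<close> per level while the
  volume loses at least the factor \<open>1 - c1\<close>; by the choice of
  \<open>\<epsilon>\<close>, the power \<open>\<tau>\<close> of the volume absorbs the
  weight.\<close>

lemma Q_le_powr:
  assumes e: "(1 + \<epsilon>) * (1 - c1) powr \<tau> \<le> 1" and \<tau>: "0 \<le> \<tau>" and A: "A \<in> At n"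
  shows "Q n A \<le> vol A powr (1 - \<tau>)"
proof -
  note v = vol_pos[OF A]
  have c: "0 < 1 - c1" using c1_less_1 by simp
  have "vol A powr \<tau> \<le> ((1 - c1) ^ n) powr \<tau>"
    using vol_At_le[OF A] v \<tau> by (intro powr_mono2) auto
  also have "\<dots> = ((1 - c1) powr \<tau>) ^ n"
    using c by (simp add: powr_realpow[symmetric] powr_powr mult.commute)
  finally have "(1 + \<epsilon>) ^ n * vol A powr \<tau> \<le> (1 + \<epsilon>) ^ n * ((1 - c1) powr \<tau>) ^ n"
    using eps_pos by (intro mult_left_mono) auto
  also have "\<dots> = ((1 + \<epsilon>) * (1 - c1) powr \<tau>) ^ n" by (simp add: power_mult_distrib)
  also have "\<dots> \<le> 1" using e eps_pos by (intro power_le_one) auto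
  finally have 1: "(1 + \<epsilon>) ^ n * vol A powr \<tau> \<le> 1" .
  have "vol A = vol A powr \<tau> * vol A powr (1 - \<tau>)" using v by (simp add: powr_add[symmetric])
  then have "Q n A \<le> (1 + \<epsilon>) ^ n * (vol A powr \<tau> * vol A powr (1 - \<tau>))" using Q_le[OF A] by simp
  also have "\<dots> = ((1 + \<epsilon>) ^ n * vol A powr \<tau>) * vol A powr (1 - \<tau>)" by simp
  also have "\<dots> \<le> 1 * vol A powr (1 - \<tau>)" using 1 by (rule mult_right_mono) simp
  finally show ?thesis by simp
qed

end

section \<open>The mass distribution principle for families of atoms\<close>

context multiplied
begin

text \<open>\<open>C\<close> consists of the first atoms along the tree that meet \<open>U\<close>
  and have volume at most \<open>r ^ DIM('a)\<close>, all their ancestors being larger. They are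
  disjoint, comparable to this bound in volume and lie within a multiple of \<open>r\<close> from
  \<open>U\<close>; so boundedly many occur, each of mass at most \<open>r powr s\<close>. A branch
  whose atoms all contain a point of \<open>U\<close> must pass through one of them.\<close>

lemma cover_family:
  fixes s :: real
  assumes s: "0 < s" "s < DIM('a)" and e: "(1 + \<epsilon>) * (1 - c1) powr (1 - s / DIM('a)) \<le> 1"
  shows "\<exists>K\<ge>0. \<forall>U r. 0 < r \<longrightarrow> r < 1 \<longrightarrow> bounded U \<longrightarrow> diameter U \<le> r \<longrightarrow>
    (\<exists>C. kap C 0 \<Omega> \<le> ennreal (K * r powr s) \<and>
      (\<forall>X. branch X \<longrightarrow> (\<forall>n. X n \<notin> C n) \<longrightarrow> (\<forall>x\<in>U. \<exists>n. x \<notin> X n)))"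
proof -
  let ?d = "DIM('a)"
  have d0: "0 < ?d" by simp
  \<comment> \<open>Chosen so that volume at most \<open>r ^ DIM('a)\<close> forces diameter at most
    \<open>K1 * r\<close>; the maximum with 1 makes the power at least its base.\<close>
  define K1 where "K1 = max 1 (1 / V) / c5"
  have K1: "0 < K1" unfolding K1_def using c5_pos by simp
  have VK1: "1 \<le> V * (c5 * K1) ^ ?d"
  proof -
    have "max 1 (1 / V) \<le> max 1 (1 / V) ^ ?d" by (rule self_le_power) simp_all
    then have "1 / V \<le> (c5 * K1) ^ ?d" unfolding K1_def using c5_pos by simp
    then have "V * (1 / V) \<le> V * (c5 * K1) ^ ?d" using V_pos by (intro mult_left_mono) auto
    then show ?thesis using V_pos by simp
  qed
  \<comment> \<open>Volume of a ball of radius \<open>(1 + K1) * r\<close> divided by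
    \<open>c1 * r ^ DIM('a)\<close>, the least volume of a member of \<open>C\<close>.\<close>
  define K where "K = V * (1 + K1) ^ ?d / c1"
  have K0: "0 \<le> K" unfolding K_def using V_pos K1 c1_pos by simp
  have "\<exists>C. kap C 0 \<Omega> \<le> ennreal (K * r powr s) \<and>
      (\<forall>X. branch X \<longrightarrow> (\<forall>n. X n \<notin> C n) \<longrightarrow> (\<forall>x\<in>U. \<exists>n. x \<notin> X n))"
    if r: "0 < r" "r < 1" and U: "bounded U" "diameter U \<le> r" for U r
  proof (cases "U = {}")
    case True
    have "kap (\<lambda>n. {}) 0 \<Omega> \<le> ennreal (K * r powr s)" using K0 by (intro kap_le) simp
    then show ?thesis using True by blast
  next
    case False
    then obtain x0 where x0: "x0 \<in> U" by blast
    define C where "C n = {A \<in> At n. A \<inter> U \<noteq> {} \<and> vol A \<le> r ^ ?d \<and>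
      (\<forall>n'<n. \<forall>A'\<in>At n'. A \<subseteq> A' \<longrightarrow> r ^ ?d < vol A')}" for n
    have CAt: "C n \<subseteq> At n" for n by (auto simp: C_def)
    have anti: "A \<inter> B = {}" if "n < n'" and A: "A \<in> C n" and B: "B \<in> C n'" for n n' A B
    proof (rule ccontr)
      assume "A \<inter> B \<noteq> {}"
      then obtain x where "x \<in> A" "x \<in> B" by blast
      moreover have "A \<in> At n" "B \<in> At n'" using A B CAt by blast+
      ultimately have "B \<subseteq> A" using nested_or_disjoint[of A n B n' x] that(1) by simp
      then have "r ^ ?d < vol A" using B that(1) \<open>A \<in> At n\<close> unfolding C_def by blast
      then show False using A by (simp add: C_def)
    qed
    define Y where "Y = cball x0 (r + K1 * r)"
    have CY: "A \<subseteq> Y" if AC: "A \<in> C n" for A n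
    proof
      fix z assume z: "z \<in> A"
      have A: "A \<in> At n" using AC CAt by blast
      obtain y where y: "y \<in> A" "y \<in> U" using AC unfolding C_def by blast
      have "V * (c5 * diameter A) ^ ?d \<le> vol A" by (rule vol_ge_diameter[OF A])
      also have "\<dots> \<le> 1 * r ^ ?d" using AC by (simp add: C_def)
      also have "\<dots> \<le> (V * (c5 * K1) ^ ?d) * r ^ ?d" using VK1 r by (intro mult_right_mono) auto
      also have "\<dots> = V * (c5 * (K1 * r)) ^ ?d" by (simp add: power_mult_distrib)
      finally have "(c5 * diameter A) ^ ?d \<le> (c5 * (K1 * r)) ^ ?d" using V_pos by simp
      then have "c5 * diameter A \<le> c5 * (K1 * r)"
        using c5_pos K1 r diameter_pos[OF A] by (subst (asm) power_mono_iff) auto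
      then have "diameter A \<le> K1 * r" using c5_pos by simp
      moreover have "dist y z \<le> diameter A" by (rule diameter_bounded_bound[OF At_bounded[OF A] y(1) z])
      moreover have "dist x0 y \<le> diameter U" by (rule diameter_bounded_bound[OF U(1) x0 y(2)])
      ultimately have "dist x0 z \<le> r + K1 * r" using dist_triangle[of x0 z y] U(2) by linarith
      then show "z \<in> Y" by (simp add: Y_def)
    qed
    have volge: "c1 * r ^ ?d \<le> vol A" if A: "A \<in> C n" for A n
    proof (cases n)
      case 0
      \<comment> \<open>\<open>r < 1\<close> keeps \<open>\<Omega>\<close>, of volume 1, out of
        \<open>C\<close>; every member thus has a parent of volume above
        \<open>r ^ DIM('a)\<close>.\<close>
      have "r ^ ?d < 1" using r d0 by (simp add: power_less_one_iff)
      moreover have "A = \<Omega>" using A 0 by (simp add: C_def At_0)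
      ultimately show ?thesis using A measure_domain by (simp add: C_def)
    next
      case (Suc k)
      then have "A \<in> At (Suc k)" using A CAt by blast
      from parent[OF this] obtain E where E: "E \<in> At k" "A \<subseteq> E" "c1 * vol E \<le> vol A" by metis
      have "r ^ ?d < vol E" using A E Suc unfolding C_def by blast
      then have "c1 * r ^ ?d \<le> c1 * vol E" using c1_pos by simp
      then show ?thesis using E(3) by linarith
    qed
    have QC: "Q n A \<le> r powr s * (vol A / (c1 * r ^ ?d))" if A: "A \<in> C n" for A n
    proof -
      have AA: "A \<in> At n" using A CAt by blast
      have "Q n A \<le> vol A powr (1 - (1 - s / ?d))" by (rule Q_le_powr[OF e _ AA]) (use s in simp)
      also have "\<dots> \<le> (r ^ ?d) powr (s / ?d)"
        using A vol_pos[OF AA] s by (auto simp: C_def intro: powr_mono2)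
      also have "\<dots> = r powr s" using r by (simp add: powr_realpow[symmetric] powr_powr)
      finally have 1: "Q n A \<le> r powr s" .
      have "1 \<le> vol A / (c1 * r ^ ?d)" using volge[OF A] c1_pos r by simp
      then have "r powr s * 1 \<le> r powr s * (vol A / (c1 * r ^ ?d))" by (intro mult_left_mono) auto
      with 1 show ?thesis by simp
    qed
    have "kap C 0 \<Omega> \<le> ennreal (K * r powr s)"
    proof (rule kap_le)
      fix J
      have "(\<Sum>n<J. \<Sum>B\<in>{B \<in> At n. B \<in> C n}. Q n B) = (\<Sum>n<J. \<Sum>B\<in>C n. Q n B)"
        using CAt by (intro sum.cong) auto
      also have "\<dots> \<le> (\<Sum>n<J. \<Sum>B\<in>C n. r powr s / (c1 * r ^ ?d) * Int_on B (\<lambda>x. 1))"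
      proof (intro sum_mono)
        fix n B assume B: "B \<in> C n"
        then have "B \<in> At n" using CAt by blast
        from Int_on_const[OF At_measurable[OF this], of 1] QC[OF B]
        show "Q n B \<le> r powr s / (c1 * r ^ ?d) * Int_on B (\<lambda>x. 1)" by simp
      qed
      also have "\<dots> = r powr s / (c1 * r ^ ?d) * (\<Sum>n<J. \<Sum>B\<in>C n. Int_on B (\<lambda>x. 1))"
        by (simp add: sum_distrib_left)
      also have "\<dots> \<le> r powr s / (c1 * r ^ ?d) * Int_on Y (\<lambda>x. 1)"
      proof (rule mult_left_mono)
        show "(\<Sum>n<J. \<Sum>B\<in>C n. Int_on B (\<lambda>x. 1)) \<le> Int_on Y (\<lambda>x. 1)"
          by (rule antichain_sum_le[OF CAt anti CY]) (auto simp: Y_def)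
      qed (use c1_pos r in simp)
      also have "Int_on Y (\<lambda>x. 1) = V * (r + K1 * r) ^ ?d"
        using Int_on_const[of Y 1] vol_cball[of "r + K1 * r" x0] r K1 by (simp add: Y_def)
      also have "r + K1 * r = (1 + K1) * r" by (simp add: algebra_simps)
      also have "r powr s / (c1 * r ^ ?d) * (V * ((1 + K1) * r) ^ ?d) = K * r powr s"
        unfolding K_def using r c1_pos by (simp add: power_mult_distrib)
      finally show "(\<Sum>n<J. \<Sum>B\<in>{B \<in> At n. B \<in> C n}. Q n B) \<le> K * r powr s" .
    qed
    moreover have "\<exists>n. x \<notin> X n" if X: "branch X" "\<forall>n. X n \<notin> C n" and x: "x \<in> U" for X x
    proof (rule ccontr)
      assume "\<nexists>n. x \<notin> X n"
      then have xX: "x \<in> X n" for n by blast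
      have "(\<lambda>n. (1 - c1) ^ n) \<longlonglongrightarrow> 0" using c1_pos c1_less_1 by (intro LIMSEQ_power_zero) auto
      moreover have "0 < r ^ ?d" using r by simp
      ultimately have "\<forall>\<^sub>F n in sequentially. (1 - c1) ^ n < r ^ ?d" by (rule order_tendstoD(2))
      then obtain n where "(1 - c1) ^ n < r ^ ?d" by (auto simp: eventually_sequentially)
      then have "vol (X n) \<le> r ^ ?d" using vol_At_le[OF branch_At[OF X(1)], of n] by linarith
      then obtain k where k: "vol (X k) \<le> r ^ ?d" "\<And>j. j < k \<Longrightarrow> \<not> vol (X j) \<le> r ^ ?d"
        using exists_least_iff[of "\<lambda>n. vol (X n) \<le> r ^ ?d"] by blast
      have "X k \<in> C k"
        unfolding C_def
      proof (intro CollectI conjI allI impI ballI)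
        fix n' A' assume "n' < k" "A' \<in> At n'" "X k \<subseteq> A'"
        then have "A' = X n'" using branch_unique[OF X(1), of n' k A'] by simp
        then show "r ^ ?d < vol A'" using k(2)[OF \<open>n' < k\<close>] by simp
      qed (use branch_At[OF X(1)] k(1) xX[of k] x in auto)
      then show False using X(2) by blast
    qed
    ultimately show ?thesis by blast
  qed
  then show ?thesis using K0 by blast
qed

text \<open>Atoms need not be closed, so nested atoms may have an empty intersection.  If a branch
  passes infinitely often to a descendant whose closure lies in the ancestor, then the intersection
  of the closures lies in every atom of the branch.\<close>

lemma branch_point:
  assumes X: "branch X" and int: "\<And>i. \<exists>n\<ge>i. \<exists>n'. closure (X n') \<subseteq> X n"
  shows "\<exists>x. \<forall>n. x \<in> X n"
proof -
  have "\<Inter>(range (\<lambda>n. closure (X n))) \<noteq> {}"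
  proof (rule compact_nest)
    show "compact (closure (X n))" for n using At_bounded[OF branch_At[OF X]] by (simp add: compact_closure)
    show "closure (X n) \<noteq> {}" for n using At_nonempty[OF branch_At[OF X]] by simp
    show "closure (X n) \<subseteq> closure (X m)" if "m \<le> n" for m n by (rule closure_mono[OF branch_subset[OF X that]])
  qed
  then obtain x where x: "\<And>n. x \<in> closure (X n)" by blast
  have "x \<in> X i" for i
  proof -
    obtain n n' where "n \<ge> i" "closure (X n') \<subseteq> X n" using int by blast
    then show ?thesis using x[of n'] branch_subset[OF X \<open>n \<ge> i\<close>] by blast
  qed
  then show ?thesis by blast
qed

lemma suminf_geometric_eighth: "(\<Sum>i. ennreal ((1 / 8) * (1 / 2) ^ Suc i)) = ennreal (1 / 8)"
proof (rule suminf_ennreal_eq)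
  show "(\<lambda>i. (1 / 8) * (1 / 2) ^ Suc i) sums (1 / 8 :: real)"
    using sums_mult[OF power_half_series, of "1/8"] by simp
qed simp

text \<open>Against a cheap cover \<open>U\<close>, three families are excluded for each
  \<open>i\<close>: atoms near \<open>U i\<close>, atoms with oscillation above
  \<open>(1/2) ^ i\<close>, and atoms that stay at the boundary of their ancestors after level
  \<open>i\<close>. Their total mass is below 1, so a branch survives; its atoms have a common
  point, at which \<open>G\<close> is Cauchy and which lies in no \<open>U i\<close>.\<close>

theorem hausdorff_measure_convergence_set:
  fixes s :: real
  assumes s: "0 < s" "s < DIM('a)" and e: "(1 + \<epsilon>) * (1 - c1) powr (1 - s / DIM('a)) \<le> 1"
  shows "hausdorff_measure s {x \<in> \<Omega>. Cauchy (\<lambda>n. G n x)} \<noteq> 0"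
proof
  let ?E = "{x \<in> \<Omega>. Cauchy (\<lambda>n. G n x)}"
  assume zero: "hausdorff_measure s ?E = 0"
  from cover_family[OF s e] obtain K where K: "0 \<le> K" "\<forall>U r. 0 < r \<longrightarrow> r < 1 \<longrightarrow> bounded U \<longrightarrow> diameter U \<le> r \<longrightarrow>
    (\<exists>C. kap C 0 \<Omega> \<le> ennreal (K * r powr s) \<and>
      (\<forall>X. branch X \<longrightarrow> (\<forall>n. X n \<notin> C n) \<longrightarrow> (\<forall>x\<in>U. \<exists>n. x \<notin> X n)))"
    by (elim exE conjE)
  \<comment> \<open>The families around the cover cost at most
    \<open>K * (\<eta> + \<eta>) \<le> 1 / 4\<close>, and each of the two other kinds costs
    \<open>1 / 8\<close>.\<close>
  define \<eta> where "\<eta> = 1 / (8 * (K + 1))"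
  have \<eta>: "0 < \<eta>" "\<eta> < 1" "K * \<eta> \<le> 1 / 8" unfolding \<eta>_def using K(1) by (auto simp: field_simps)
  \<comment> \<open>The scale \<open>1/2\<close> keeps the radii \<open>r i\<close> below 1, as
    \<open>cover_family\<close> requires.\<close>
  have "hausdorff_content s (1/2) ?E \<le> hausdorff_measure s ?E"
    unfolding hausdorff_measure_def by (rule SUP_upper) simp
  then have "hausdorff_content s (1/2) ?E < ennreal \<eta>" using zero \<eta>(1) by simp
  then obtain U where U: "?E \<subseteq> (\<Union>i. U i)" "\<And>i. bounded (U i)" "\<And>i. diameter (U i) \<le> 1/2"
    and sumU: "(\<Sum>i. diam_power s (U i)) < ennreal \<eta>"
    unfolding hausdorff_content_def by (auto simp: INF_less_iff)
  \<comment> \<open>A set of diameter 0 must still receive a positive radius. The cut-off adds at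
    most \<open>\<eta> * (1/2) ^ Suc i\<close> to the power \<open>s\<close> of the radius, in total
    \<open>\<eta>\<close>.\<close>
  define r where "r i = max (diameter (U i)) ((\<eta> * (1/2) ^ Suc i) powr (1 / s))" for i :: nat
  have small: "0 < \<eta> * (1/2) ^ Suc i" "\<eta> * (1/2) ^ Suc i < 1" for i
  proof -
    show "0 < \<eta> * (1/2) ^ Suc i" using \<eta>(1) by simp
    have "\<eta> * (1/2) ^ Suc i \<le> \<eta> * 1" using \<eta>(1) by (intro mult_left_mono power_le_one) auto
    then show "\<eta> * (1/2) ^ Suc i < 1" using \<eta>(2) by linarith
  qed
  have r01: "0 < r i" "r i < 1" "diameter (U i) \<le> r i" for i
  proof -
    have "0 < (\<eta> * (1/2) ^ Suc i) powr (1 / s)" using \<eta>(1) by simp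
    then show "0 < r i" unfolding r_def by (rule less_le_trans) simp
    have "(\<eta> * (1/2) ^ Suc i) powr (1 / s) < 1 powr (1 / s)"
      using small[of i] s(1) by (intro powr_less_mono2) auto
    then show "r i < 1" unfolding r_def using U(3)[of i] by simp
    show "diameter (U i) \<le> r i" by (simp add: r_def)
  qed
  have rs: "ennreal (r i powr s) \<le> diam_power s (U i) + ennreal (\<eta> * (1/2) ^ Suc i)" for i
  proof (cases "diameter (U i) \<le> (\<eta> * (1/2) ^ Suc i) powr (1 / s)")
    case True
    then have "r i = (\<eta> * (1/2) ^ Suc i) powr (1 / s)" by (simp add: r_def)
    then have eq: "r i powr s = \<eta> * (1/2) ^ Suc i" using small(1)[of i] s(1) by (simp add: powr_powr)
    show ?thesis unfolding eq by (rule add_increasing) simp_all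
  next
    case False
    then have ri: "r i = diameter (U i)" by (simp add: r_def)
    have "U i \<noteq> {}" using False small(1)[of i] by auto
    then have "diam_power s (U i) = ennreal (r i powr s)" using s(1) by (simp add: diam_power_def ri)
    then show ?thesis by simp
  qed
  have "\<exists>C. kap C 0 \<Omega> \<le> ennreal (K * r i powr s) \<and>
      (\<forall>X. branch X \<longrightarrow> (\<forall>n. X n \<notin> C n) \<longrightarrow> (\<forall>x\<in>U i. \<exists>n. x \<notin> X n))" for i
    using K(2)[rule_format, OF r01(1,2) U(2) r01(3)] .
  then obtain C1 where C1: "\<And>i. kap (C1 i) 0 \<Omega> \<le> ennreal (K * r i powr s)"
    "\<And>i X. branch X \<Longrightarrow> \<forall>n. X n \<notin> C1 i n \<Longrightarrow> \<forall>x\<in>U i. \<exists>n. x \<notin> X n" by metis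
  let ?g = "\<lambda>i. (1 / 8) * (1 / 2) ^ Suc i :: real"
  have g0: "0 < ?g i" "0 < (1/2::real) ^ i" for i by simp_all
  have "\<exists>C m. kap C 0 \<Omega> \<le> ennreal (?g i) \<and>
    (\<forall>X. branch X \<longrightarrow> (\<forall>n. X n \<notin> C n) \<longrightarrow> (\<forall>n>m. \<forall>x\<in>X n. \<bar>G n x - G m x\<bar> \<le> (1/2) ^ i))" for i
    by (rule oscillation_family[OF g0(2) g0(1)])
  then obtain C2 mm where C2: "\<And>i. kap (C2 i) 0 \<Omega> \<le> ennreal (?g i)"
    "\<And>i X. branch X \<Longrightarrow> \<forall>n. X n \<notin> C2 i n \<Longrightarrow> \<forall>n>mm i. \<forall>x\<in>X n. \<bar>G n x - G (mm i) x\<bar> \<le> (1/2) ^ i" by metis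
  have "\<exists>C. kap C 0 \<Omega> \<le> ennreal (?g i) \<and>
    (\<forall>X. branch X \<longrightarrow> (\<forall>n. X n \<notin> C n) \<longrightarrow> (\<exists>n\<ge>i. \<exists>n'. closure (X n') \<subseteq> X n))" for i
    by (rule interior_family[OF g0(1)])
  then obtain C3 where C3: "\<And>i. kap (C3 i) 0 \<Omega> \<le> ennreal (?g i)"
    "\<And>i X. branch X \<Longrightarrow> \<forall>n. X n \<notin> C3 i n \<Longrightarrow> \<exists>n\<ge>i. \<exists>n'. closure (X n') \<subseteq> X n" by metis
  define C where "C i = (\<lambda>n. C1 i n \<union> (C2 i n \<union> C3 i n))" for i
  have "kap (C i) 0 \<Omega> \<le> kap (C1 i) 0 \<Omega> + (kap (C2 i) 0 \<Omega> + kap (C3 i) 0 \<Omega>)" for i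
    unfolding C_def by (rule order_trans[OF kap_Un add_left_mono[OF kap_Un]])
  also have "\<dots> i \<le> ennreal K * (diam_power s (U i) + ennreal (\<eta> * (1/2) ^ Suc i)) + (ennreal (?g i) + ennreal (?g i))" for i
  proof (intro add_mono C2(1) C3(1))
    have "kap (C1 i) 0 \<Omega> \<le> ennreal K * ennreal (r i powr s)" using C1(1)[of i] K(1) by (simp add: ennreal_mult)
    also have "\<dots> \<le> ennreal K * (diam_power s (U i) + ennreal (\<eta> * (1/2) ^ Suc i))"
      using rs by (intro mult_left_mono) auto
    finally show "kap (C1 i) 0 \<Omega> \<le> ennreal K * (diam_power s (U i) + ennreal (\<eta> * (1/2) ^ Suc i))" .
  qed
  finally have kC: "kap (C i) 0 \<Omega> \<le> ennreal K * (diam_power s (U i) + ennreal (\<eta> * (1/2) ^ Suc i)) + (ennreal (?g i) + ennreal (?g i))" for i .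
  have sum\<eta>: "(\<Sum>i. ennreal (\<eta> * (1/2) ^ Suc i)) = ennreal \<eta>"
  proof (rule suminf_ennreal_eq)
    show "(\<lambda>i. \<eta> * (1/2) ^ Suc i) sums \<eta>" using sums_mult[OF power_half_series, of \<eta>] by simp
  qed (use \<eta>(1) in simp)
  have "(\<Sum>i. kap (C i) 0 \<Omega>) \<le> (\<Sum>i. ennreal K * (diam_power s (U i) + ennreal (\<eta> * (1/2) ^ Suc i)) + (ennreal (?g i) + ennreal (?g i)))"
    by (rule suminf_le[OF kC]) auto
  also have "\<dots> = ennreal K * ((\<Sum>i. diam_power s (U i)) + ennreal \<eta>) + (ennreal (1/8) + ennreal (1/8))"
    by (simp only: suminf_add[OF summableI summableI, symmetric] ennreal_suminf_cmult sum\<eta> suminf_geometric_eighth)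
  also have "\<dots> \<le> ennreal K * (ennreal \<eta> + ennreal \<eta>) + (ennreal (1/8) + ennreal (1/8))"
    using sumU by (intro add_right_mono mult_left_mono add_mono) auto
  also have "\<dots> = ennreal (K * (\<eta> + \<eta>) + (1/8 + 1/8))"
    using K(1) \<eta>(1) by (simp add: ennreal_plus[symmetric] ennreal_mult[symmetric] del: ennreal_plus)
  also have "\<dots> < ennreal 1"
    using \<eta>(3) K(1) \<eta>(1) by (intro ennreal_lessI) (auto simp: distrib_left)
  finally have "(\<Sum>i. kap (C i) 0 \<Omega>) < 1" by simp
  from branch_avoiding[OF this] obtain X where bX: "branch X" and X: "\<And>i n. X n \<notin> C i n" by blast
  have no: "\<forall>n. X n \<notin> C1 i n" "\<forall>n. X n \<notin> C2 i n" "\<forall>n. X n \<notin> C3 i n" for i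
    using X[of _ i] by (auto simp: C_def)
  obtain x where x: "\<And>n. x \<in> X n" using branch_point[OF bX C3(2)[OF bX no(3)]] by blast
  have "Cauchy (\<lambda>n. G n x)"
  proof (rule metric_CauchyI)
    fix \<delta> :: real assume "0 < \<delta>"
    then obtain i where i: "(1/2) ^ i < \<delta> / 2" using real_arch_pow_inv[of "\<delta>/2" "1/2"] by auto
    have "\<bar>G n x - G (mm i) x\<bar> \<le> (1/2) ^ i" if "n > mm i" for n
      using C2(2)[OF bX no(2)] that x by blast
    then have "dist (G m x) (G n x) < \<delta>" if "m > mm i" "n > mm i" for m n
      using that i unfolding dist_real_def by (smt (verit) field_sum_of_halves)
    then show "\<exists>k. \<forall>m\<ge>k. \<forall>n\<ge>k. dist (G m x) (G n x) < \<delta>"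
      by (intro exI[of _ "Suc (mm i)"]) auto
  qed
  moreover have "x \<in> \<Omega>" using x[of 0] At_subset[OF branch_At[OF bX]] by blast
  ultimately have "x \<in> ?E" by simp
  then obtain i where "x \<in> U i" using U(1) by blast
  then show False using C1(2)[OF bX no(1)] x by blast
qed

end

section \<open>Hausdorff dimension\<close>

lemma diam_power_antimono:
  assumes "0 \<le> s" "s \<le> t" "bounded U" "diameter U \<le> 1"
  shows "diam_power t U \<le> diam_power s U"
proof -
  have d: "0 \<le> diameter U" using diameter_ge_0[OF assms(3)] .
  have le: "diameter U powr t \<le> diameter U powr s" using assms d by (intro powr_mono') auto
  have "diameter U powr t \<le> 1" if "0 < t" using d assms(4) that powr_mono2[of t "diameter U" 1] by simp
  then show ?thesis using le assms(1,2) unfolding diam_power_def by (auto intro: ennreal_leI simp flip: ennreal_1)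
qed

lemma hausdorff_content_antimono_delta:
  assumes "\<delta> \<le> \<delta>'"
  shows "hausdorff_content s \<delta>' E \<le> hausdorff_content s \<delta> E"
  unfolding hausdorff_content_def
proof (rule INF_superset_mono[OF _ order_refl])
  show "{U. E \<subseteq> \<Union> (range U) \<and> (\<forall>i. bounded (U i) \<and> diameter (U i) \<le> \<delta>)}
     \<subseteq> {U. E \<subseteq> \<Union> (range U) \<and> (\<forall>i. bounded (U i) \<and> diameter (U i) \<le> \<delta>')}"
    using assms by (auto intro: order_trans)
qed

lemma hausdorff_content_antimono:
  assumes "0 \<le> s" "s \<le> t" "\<delta> \<le> 1"
  shows "hausdorff_content t \<delta> E \<le> hausdorff_content s \<delta> E"
  unfolding hausdorff_content_def
proof (rule INF_mono)
  fix U assume U: "U \<in> {U :: nat \<Rightarrow> 'a set. E \<subseteq> (\<Union>i. U i) \<and> (\<forall>i. bounded (U i) \<and> diameter (U i) \<le> \<delta>)}"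
  have "(\<Sum>i. diam_power t (U i)) \<le> (\<Sum>i. diam_power s (U i))"
  proof (rule suminf_le)
    fix i
    have "bounded (U i)" "diameter (U i) \<le> \<delta>" using U by auto
    then show "diam_power t (U i) \<le> diam_power s (U i)" using assms by (intro diam_power_antimono) auto
  qed auto
  then show "\<exists>V\<in>{U :: nat \<Rightarrow> 'a set. E \<subseteq> (\<Union>i. U i) \<and> (\<forall>i. bounded (U i) \<and> diameter (U i) \<le> \<delta>)}.
      (\<Sum>i. diam_power t (V i)) \<le> (\<Sum>i. diam_power s (U i))" using U by blast
qed

text \<open>Powers of the diameter decrease in the exponent for diameters at most 1, hence the
  detour through the scale \<open>min \<delta> 1\<close>.\<close>

lemma hausdorff_measure_zero_mono:
  assumes "0 \<le> s" "s \<le> t" "hausdorff_measure s E = 0"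
  shows "hausdorff_measure t E = 0"
proof -
  have "hausdorff_content t \<delta> E \<le> 0" if "0 < \<delta>" for \<delta>
  proof -
    have "hausdorff_content t \<delta> E \<le> hausdorff_content t (min \<delta> 1) E" by (rule hausdorff_content_antimono_delta) simp
    also have "\<dots> \<le> hausdorff_content s (min \<delta> 1) E" using assms(1,2) by (rule hausdorff_content_antimono) simp
    also have "\<dots> \<le> hausdorff_measure s E" unfolding hausdorff_measure_def using that by (intro SUP_upper) simp
    finally show ?thesis using assms(3) by simp
  qed
  then have "hausdorff_measure t E \<le> 0" unfolding hausdorff_measure_def by (intro SUP_least) auto
  then show ?thesis by simp
qed

lemma hausdorff_measure_mono: "E \<subseteq> E' \<Longrightarrow> hausdorff_measure s E \<le> hausdorff_measure s E'"
  unfolding hausdorff_measure_def hausdorff_content_def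
  by (intro SUP_mono' INF_superset_mono) auto

text \<open>An exponent \<open>s < d\<close> of measure zero is moved to \<open>(s + d) / 2\<close>,
  which is positive even for \<open>s = 0\<close>.\<close>

lemma hausdorff_dim_ge:
  assumes "0 < d" "\<And>s. 0 < s \<Longrightarrow> s < d \<Longrightarrow> hausdorff_measure s E \<noteq> 0"
  shows "ereal d \<le> hausdorff_dim E"
  unfolding hausdorff_dim_def
proof (rule INF_greatest)
  fix s assume "s \<in> {s. 0 \<le> s \<and> hausdorff_measure s E = 0}"
  then have s: "0 \<le> s" "hausdorff_measure s E = 0" by auto
  show "ereal d \<le> ereal s"
  proof (rule ccontr)
    assume "\<not> ?thesis"
    then have "s < d" by simp
    then have "hausdorff_measure ((s + d) / 2) E = 0" using s by (intro hausdorff_measure_zero_mono[OF s(1) _ s(2)]) simp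
    then show False using assms(2)[of "(s + d) / 2"] s \<open>s < d\<close> assms(1) by simp
  qed
qed

section \<open>The upper bound for the dimension\<close>

lemma (in atom_tree) small_atoms:
  assumes "0 < \<zeta>"
  shows "\<exists>n. \<forall>A\<in>At n. diameter A \<le> \<zeta>"
proof -
  have "(\<lambda>n. (1 - c1) ^ n) \<longlonglongrightarrow> 0" using c1_pos c1_less_1 by (intro LIMSEQ_power_zero) auto
  moreover have "0 < V * (c5 * \<zeta>) ^ DIM('a)" using V_pos c5_pos assms by simp
  ultimately have "\<forall>\<^sub>F n in sequentially. (1 - c1) ^ n < V * (c5 * \<zeta>) ^ DIM('a)" by (rule order_tendstoD(2))
  then obtain n where n: "(1 - c1) ^ n < V * (c5 * \<zeta>) ^ DIM('a)" by (auto simp: eventually_sequentially)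
  have "diameter A \<le> \<zeta>" if A: "A \<in> At n" for A
  proof -
    have "V * (c5 * diameter A) ^ DIM('a) \<le> V * (c5 * \<zeta>) ^ DIM('a)"
      using vol_ge_diameter[OF A] vol_At_le[OF A] n by linarith
    then have "(c5 * diameter A) ^ DIM('a) \<le> (c5 * \<zeta>) ^ DIM('a)" using V_pos by simp
    then have "c5 * diameter A \<le> c5 * \<zeta>"
      using c5_pos assms diameter_pos[OF A] by (subst (asm) power_mono_iff) auto
    then show ?thesis using c5_pos by simp
  qed
  then show ?thesis by blast
qed

text \<open>The atoms of a fine level are an economical cover: by fatness
  \<open>diameter A ^ DIM('a)\<close> is at most a multiple of the volume, the volumes sum to 1, and
  the excess exponent \<open>s - DIM('a)\<close> makes the sum small.\<close>

lemma (in atom_tree) hausdorff_dim_le: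
  assumes E: "E \<subseteq> \<Omega>"
  shows "hausdorff_dim E \<le> DIM('a)"
proof -
  let ?d = "DIM('a)"
  have content: "hausdorff_content s \<delta> E \<le> ennreal e" if s: "?d < s" and \<delta>: "0 < \<delta>" and e: "0 < e" for s \<delta> e :: real
  proof -
    let ?k = "V * c5 ^ ?d"
    have k: "0 < ?k" using V_pos c5_pos by simp
    define \<zeta> where "\<zeta> = min \<delta> ((e * ?k) powr (1 / (s - ?d)))"
    have "0 < e * ?k" using e k by (rule mult_pos_pos)
    then have "0 < (e * ?k) powr (1 / (s - ?d))" unfolding powr_gt_zero by (rule less_imp_neq[THEN not_sym])
    then have \<zeta>: "0 < \<zeta>" "\<zeta> \<le> \<delta>" using \<delta> by (simp_all only: \<zeta>_def min_less_iff_conj min.cobounded1)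
    have "\<zeta> powr (s - ?d) \<le> ((e * ?k) powr (1 / (s - ?d))) powr (s - ?d)"
      using \<zeta>(1) s by (intro powr_mono2) (auto simp: \<zeta>_def)
    also have "\<dots> = e * ?k" using s e k by (simp add: powr_powr)
    finally have \<zeta>s: "\<zeta> powr (s - ?d) \<le> e * ?k" .
    obtain n where n: "\<And>A. A \<in> At n \<Longrightarrow> diameter A \<le> \<zeta>" using small_atoms[OF \<zeta>(1)] by blast
    obtain h where h: "bij_betw h {0..<card (At n)} (At n)" using ex_bij_betw_nat_finite[OF finite_At] by blast
    define U where "U i = (if i < card (At n) then h i else {})" for i
    have hA: "h i \<in> At n" if "i < card (At n)" for i using h that by (auto simp: bij_betw_def)
    have "\<Omega> \<subseteq> (\<Union>i. U i)"
    proof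
      fix x assume "x \<in> \<Omega>"
      then obtain A where A: "A \<in> At n" "x \<in> A" using At_cover[of n] by blast
      have "A \<in> h ` {0..<card (At n)}" using A(1) unfolding bij_betw_imp_surj_on[OF h] .
      then obtain i where i: "A = h i" "i \<in> {0..<card (At n)}" by (rule imageE)
      then have "x \<in> U i" using A(2) by (simp add: U_def)
      then show "x \<in> (\<Union>i. U i)" by blast
    qed
    then have "E \<subseteq> (\<Union>i. U i)" using E by blast
    moreover have "bounded (U i) \<and> diameter (U i) \<le> \<delta>" for i
    proof (cases "i < card (At n)")
      case True
      then show ?thesis using At_bounded[OF hA[OF True]] n[OF hA[OF True]] \<zeta>(2) by (simp add: U_def)
    qed (use \<delta> in \<open>simp add: U_def\<close>)
    ultimately have "hausdorff_content s \<delta> E \<le> (\<Sum>i. diam_power s (U i))"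
      unfolding hausdorff_content_def by (intro INF_lower) auto
    also have "\<dots> = (\<Sum>i\<in>{0..<card (At n)}. diam_power s (U i))"
      by (rule suminf_finite) (auto simp: U_def diam_power_def)
    also have "\<dots> = (\<Sum>i\<in>{0..<card (At n)}. diam_power s (h i))" by (rule sum.cong) (auto simp: U_def)
    also have "\<dots> = (\<Sum>A\<in>At n. diam_power s A)" by (rule sum.reindex_bij_betw[OF h])
    also have "\<dots> \<le> (\<Sum>A\<in>At n. ennreal (e * vol A))"
    proof (rule sum_mono)
      fix A assume A: "A \<in> At n"
      have D: "0 < diameter A" by (rule diameter_pos[OF A])
      have "diameter A powr s = diameter A powr (s - ?d) * diameter A ^ ?d"
        using D by (simp add: powr_realpow[symmetric] powr_add[symmetric])
      also have "\<dots> \<le> \<zeta> powr (s - ?d) * diameter A ^ ?d"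
        using D n[OF A] s by (intro mult_right_mono powr_mono2) auto
      also have "\<dots> \<le> (e * ?k) * diameter A ^ ?d" using \<zeta>s D by (intro mult_right_mono) auto
      also have "\<dots> = e * (V * (c5 * diameter A) ^ ?d)" by (simp add: power_mult_distrib)
      also have "\<dots> \<le> e * vol A" using vol_ge_diameter[OF A] e by (intro mult_left_mono) auto
      finally have "diameter A powr s \<le> e * vol A" .
      then show "diam_power s A \<le> ennreal (e * vol A)"
        using s At_nonempty[OF A] by (auto simp: diam_power_def intro: ennreal_leI)
    qed
    also have "\<dots> = ennreal (\<Sum>A\<in>At n. e * vol A)" using e by (intro sum_ennreal) simp
    also have "(\<Sum>A\<in>At n. e * vol A) = e * (\<Sum>A\<in>At n. vol A)" by (simp add: sum_distrib_left)
    also have "(\<Sum>A\<in>At n. vol A) = 1"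
    proof -
      have "{B \<in> At n. B \<subseteq> \<Omega>} = At n" using At_subset by blast
      then show ?thesis using vol_descendants[of \<Omega> 0 n] measure_domain by (simp add: At_0)
    qed
    finally show ?thesis by simp
  qed
  have zero: "hausdorff_measure s E = 0" if "?d < s" for s :: real
  proof -
    have "hausdorff_content s \<delta> E \<le> 0" if "0 < \<delta>" for \<delta>
    proof (rule ennreal_le_epsilon)
      fix e :: real assume "0 < e"
      then show "hausdorff_content s \<delta> E \<le> 0 + ennreal e" using content[OF \<open>?d < s\<close> that] by simp
    qed
    then have "hausdorff_measure s E \<le> 0" unfolding hausdorff_measure_def by (intro SUP_least) auto
    then show ?thesis by simp
  qed
  show ?thesis
  proof (rule ereal_le_epsilon2)
    fix e :: real assume "0 < e"
    then have "hausdorff_dim E \<le> ereal (?d + e)"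
      unfolding hausdorff_dim_def using zero[of "?d + e"] by (intro INF_lower) auto
    then show "hausdorff_dim E \<le> ereal ?d + ereal e" by simp
  qed
qed

section \<open>Growth along convergent branches\<close>

text \<open>Summation by parts against \<open>R n = g n - g0\<close>. The boundary term at
  \<open>n\<close> and the part of the sum from \<open>K\<close> on, where \<open>R\<close> is
  small, take \<open>e / 3\<close> of \<open>m n\<close> each; the constant \<open>C\<close>
  collects what does not grow with \<open>n\<close> and takes the last third.\<close>

lemma kronecker:
  fixes g m :: "nat \<Rightarrow> real"
  assumes g: "Cauchy g" and m: "incseq m" "filterlim m at_top sequentially" and e: "0 < e"
  shows "\<forall>\<^sub>F n in sequentially. \<bar>\<Sum>k<n. m (Suc k) * (g (Suc k) - g k)\<bar> \<le> e * m n"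
proof -
  obtain g0 where "g \<longlonglongrightarrow> g0" using g real_Cauchy_convergent convergent_def by blast
  then have R0: "(\<lambda>n. g n - g0) \<longlonglongrightarrow> 0" by (simp add: LIM_zero)
  define R where "R n = g n - g0" for n
  have parts: "(\<Sum>k<n. m (Suc k) * (g (Suc k) - g k)) = m n * R n - m 0 * R 0 - (\<Sum>k<n. R k * (m (Suc k) - m k))" for n
    by (induction n) (simp_all add: R_def algebra_simps)
  have "R \<longlonglongrightarrow> 0" using R0 by (simp add: R_def[abs_def])
  then have "\<forall>\<^sub>F n in sequentially. \<bar>R n\<bar> < e / 3"
    using e tendsto_rabs_zero[of R sequentially] by (intro order_tendstoD(2)[of _ 0]) auto
  then obtain K where K: "\<And>n. K \<le> n \<Longrightarrow> \<bar>R n\<bar> < e / 3" by (auto simp: eventually_sequentially)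
  define C where "C = \<bar>m 0 * R 0\<bar> + (\<Sum>k<K. \<bar>R k\<bar> * (m (Suc k) - m k)) + e / 3 * \<bar>m K\<bar>"
  have inc: "m k \<le> m (Suc k)" for k using m(1) by (simp add: incseq_SucD)
  have tail: "(\<Sum>k<K + i. \<bar>R k\<bar> * (m (Suc k) - m k)) \<le> (\<Sum>k<K. \<bar>R k\<bar> * (m (Suc k) - m k)) + e / 3 * (m (K + i) - m K)" for i
  proof (induction i)
    case (Suc i)
    have "\<bar>R (K + i)\<bar> * (m (Suc (K + i)) - m (K + i)) \<le> e / 3 * (m (Suc (K + i)) - m (K + i))"
      using K[of "K + i"] inc by (intro mult_right_mono) auto
    then show ?case using Suc by (simp add: algebra_simps)
  qed simp
  have "\<forall>\<^sub>F n in sequentially. C * (3 / e) \<le> m n" using m(2) by (simp add: filterlim_at_top)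
  moreover have "\<forall>\<^sub>F n in sequentially. 0 \<le> m n" using m(2) by (simp add: filterlim_at_top)
  moreover have "\<forall>\<^sub>F n in sequentially. K \<le> n" by (rule eventually_ge_at_top)
  ultimately show ?thesis
  proof eventually_elim
    fix n assume n: "C * (3 / e) \<le> m n" "0 \<le> m n" "K \<le> n"
    have 1: "\<bar>\<Sum>k<n. R k * (m (Suc k) - m k)\<bar> \<le> (\<Sum>k<n. \<bar>R k\<bar> * (m (Suc k) - m k))"
    proof (rule order_trans[OF sum_abs sum_mono])
      fix k show "\<bar>R k * (m (Suc k) - m k)\<bar> \<le> \<bar>R k\<bar> * (m (Suc k) - m k)" using inc[of k] by (simp add: abs_mult)
    qed
    have 2: "(\<Sum>k<n. \<bar>R k\<bar> * (m (Suc k) - m k)) \<le> (\<Sum>k<K. \<bar>R k\<bar> * (m (Suc k) - m k)) + e / 3 * (m n - m K)"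
      using tail[of "n - K"] n(3) by simp
    have 3: "\<bar>m n * R n\<bar> \<le> e / 3 * m n"
    proof -
      have "m n * \<bar>R n\<bar> \<le> m n * (e / 3)" using K[OF n(3)] n(2) by (intro mult_left_mono) auto
      then show ?thesis using n(2) by (simp add: abs_mult mult.commute)
    qed
    have 4: "- (e / 3 * m K) \<le> e / 3 * \<bar>m K\<bar>" using e abs_ge_minus_self[of "m K"] mult_left_mono[of "- m K" "\<bar>m K\<bar>" "e / 3"] by simp
    have 5: "C \<le> e / 3 * m n" using n(1) e by (simp add: field_simps)
    have "\<bar>m n * R n - m 0 * R 0 - (\<Sum>k<n. R k * (m (Suc k) - m k))\<bar>
        \<le> \<bar>m n * R n\<bar> + \<bar>m 0 * R 0\<bar> + \<bar>\<Sum>k<n. R k * (m (Suc k) - m k)\<bar>" by linarith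
    also have "\<dots> \<le> e / 3 * m n + e / 3 * m n + C"
      using 1 2 3 4 unfolding C_def by (simp add: right_diff_distrib)
    also have "\<dots> \<le> e * m n" using 5 by simp
    finally show "\<bar>\<Sum>k<n. m (Suc k) * (g (Suc k) - g k)\<bar> \<le> e * m n" unfolding parts .
  qed
qed

context multiplied
begin

lemma M_incseq: "x \<in> \<Omega> \<Longrightarrow> incseq (\<lambda>n. M n x)"
  using rho_nonneg eps_pos by (intro incseq_SucI) (simp add: M_Suc)

text \<open>\<open>1 / c6\<close> passes from \<open>D k\<close> to \<open>\<rho> k\<close>,
  \<open>1 / c1\<close> from the atom of level \<open>Suc k\<close> to its parent, and
  \<open>1 / \<epsilon>\<close> from \<open>\<rho> k\<close> to the step of
  \<open>M\<close>.\<close>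

definition Kc :: real where "Kc = 1 / (\<epsilon> * c6 * c1)"

lemma Kc_pos: "0 < Kc"
  unfolding Kc_def using eps_pos c6_pos c1_pos by simp

lemma cexp_nonneg: "x \<in> \<Omega> \<Longrightarrow> 0 \<le> cexp \<Omega> F (Suc k) (\<lambda>y. \<bar>increment f (Suc k) y\<bar>) x"
  using cexp_eq_mean[OF at_At in_at bdd_meas_abs[OF bdd_D], of x "Suc k" k] Int_on_nonneg[of _ "\<lambda>y. \<bar>D k y\<bar>"]
  by (simp add: D_def)

lemma cexp_le: "x \<in> \<Omega> \<Longrightarrow> cexp \<Omega> F (Suc k) (\<lambda>y. \<bar>increment f (Suc k) y\<bar>) x \<le> Kc * (\<epsilon> * \<rho> k x)"
proof -
  assume x: "x \<in> \<Omega>"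
  let ?B = "atom_at (Suc k) x" and ?A = "atom_at k x"
  have A: "?A \<in> At k" "x \<in> ?A" and B: "?B \<in> At (Suc k)" "x \<in> ?B" using at_At[OF x] in_at[OF x] by auto
  have BA: "?B \<subseteq> ?A" by (rule at_mono[OF x]) simp
  have "cexp \<Omega> F (Suc k) (\<lambda>y. \<bar>increment f (Suc k) y\<bar>) x = Int_on ?B (\<lambda>y. \<bar>D k y\<bar>) / vol ?B"
    using cexp_eq_mean[OF B bdd_meas_abs[OF bdd_D[of k]]] by (simp add: D_def)
  also have "\<dots> \<le> Int_on ?A (\<lambda>y. \<bar>D k y\<bar>) / (c1 * vol ?A)"
  proof (rule frac_le)
    show "Int_on ?B (\<lambda>y. \<bar>D k y\<bar>) \<le> Int_on ?A (\<lambda>y. \<bar>D k y\<bar>)"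
      using bdd_meas_At[OF bdd_meas_abs[OF bdd_D] A(1)] At_measurable[OF A(1)] At_measurable[OF B(1)] BA
      by (rule Int_on_mono_set) simp
    show "c1 * vol ?A \<le> vol ?B" using vol_descendant(1)[OF A(1), of ?B 1] B BA by simp
    show "0 \<le> Int_on ?A (\<lambda>y. \<bar>D k y\<bar>)" by (rule Int_on_nonneg) simp
    show "0 < c1 * vol ?A" using c1_pos vol_pos[OF A(1)] by simp
  qed
  also have "\<dots> \<le> (\<rho> k x * vol ?A / c6) / (c1 * vol ?A)"
    using D_le_rho[OF A] c6_pos c1_pos vol_pos[OF A(1)] by (intro divide_right_mono) (auto simp: field_simps)
  also have "\<dots> = Kc * (\<epsilon> * \<rho> k x)"
    unfolding Kc_def using vol_pos[OF A(1)] eps_pos c6_pos c1_pos by (simp add: field_simps)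
  finally show ?thesis .
qed

lemma sum_cexp_le:
  assumes "x \<in> \<Omega>"
  shows "(\<Sum>k<n. cexp \<Omega> F (Suc k) (\<lambda>y. \<bar>increment f (Suc k) y\<bar>) x) \<le> Kc * M n x"
proof -
  have "(\<Sum>k<n. cexp \<Omega> F (Suc k) (\<lambda>y. \<bar>increment f (Suc k) y\<bar>) x) \<le> (\<Sum>k<n. Kc * (\<epsilon> * \<rho> k x))"
    by (rule sum_mono) (rule cexp_le[OF assms])
  then show ?thesis by (simp add: M_def sum_distrib_left)
qed

lemma suminf_cexp_finite:
  assumes x: "x \<in> \<Omega>" and B: "\<And>n. M n x \<le> B"
  shows "(\<Sum>k. ennreal (cexp \<Omega> F (Suc k) (\<lambda>y. \<bar>increment f (Suc k) y\<bar>) x)) < \<infinity>"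
proof -
  have "(\<Sum>k. ennreal (cexp \<Omega> F (Suc k) (\<lambda>y. \<bar>increment f (Suc k) y\<bar>) x)) \<le> ennreal (Kc * B)"
  proof (rule suminf_le_const[OF summableI])
    fix n
    have "(\<Sum>k<n. ennreal (cexp \<Omega> F (Suc k) (\<lambda>y. \<bar>increment f (Suc k) y\<bar>) x)) =
        ennreal (\<Sum>k<n. cexp \<Omega> F (Suc k) (\<lambda>y. \<bar>increment f (Suc k) y\<bar>) x)"
      by (rule sum_ennreal) (rule cexp_nonneg[OF x])
    also have "\<dots> \<le> ennreal (Kc * B)"
      using sum_cexp_le[OF x, of n] B[of n] Kc_pos mult_left_mono[of "M n x" B Kc] by (intro ennreal_leI) linarith
    finally show "(\<Sum>k<n. ennreal (cexp \<Omega> F (Suc k) (\<lambda>y. \<bar>increment f (Suc k) y\<bar>) x)) \<le> ennreal (Kc * B)" .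
  qed
  also have "\<dots> < \<infinity>" by simp
  finally show ?thesis .
qed

text \<open>\<open>f n\<close> is \<open>f 0\<close> plus the drift plus a sum of
  \<open>(1 + M (Suc k) x) * (G (Suc k) x - G k x)\<close>, to which Kronecker's lemma applies. A
  quarter of \<open>1 + M n x\<close> is spent on this sum and a quarter on
  \<open>\<bar>f 0 x\<bar> + 1\<close>; half remains.\<close>

lemma growth:
  assumes x: "x \<in> \<Omega>" and c: "Cauchy (\<lambda>n. G n x)" and unb: "\<nexists>B. \<forall>n. M n x \<le> B"
  shows "filterlim (\<lambda>n. 1 + M n x) at_top sequentially"
    "\<forall>\<^sub>F n in sequentially. (1 + M n x) / 2 \<le> f n x"
proof -
  show lim: "filterlim (\<lambda>n. 1 + M n x) at_top sequentially"
    unfolding filterlim_at_top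
  proof
    fix B
    obtain n0 where n0: "B < M n0 x" using unb by (meson not_le)
    have "B \<le> 1 + M n x" if "n0 \<le> n" for n using incseqD[OF M_incseq[OF x] that] n0 by linarith
    then show "\<forall>\<^sub>F n in sequentially. B \<le> 1 + M n x" unfolding eventually_sequentially by blast
  qed
  have inc: "incseq (\<lambda>n. 1 + M n x)" using M_incseq[OF x] by (simp add: incseq_def)
  have fn: "f n x = f 0 x + M n x + (\<Sum>k<n. (1 + M (Suc k) x) * (G (Suc k) x - G k x))" for n
  proof (induction n)
    case (Suc n)
    have "0 < 1 + M (Suc n) x" using M_nonneg[OF x, of "Suc n"] by linarith
    then have "(1 + M (Suc n) x) * (G (Suc n) x - G n x) = D n x - \<epsilon> * \<rho> n x" by (simp add: G_Suc H_def)
    then show ?case using Suc by (simp add: D_eq M_Suc)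
  qed (simp add: M_def)
  have "\<forall>\<^sub>F n in sequentially. \<bar>\<Sum>k<n. (1 + M (Suc k) x) * (G (Suc k) x - G k x)\<bar> \<le> 1 / 4 * (1 + M n x)"
    by (rule kronecker[OF c inc lim]) simp
  moreover have "\<forall>\<^sub>F n in sequentially. 4 * (\<bar>f 0 x\<bar> + 1) \<le> 1 + M n x"
    using lim unfolding filterlim_at_top by (rule spec)
  ultimately show "\<forall>\<^sub>F n in sequentially. (1 + M n x) / 2 \<le> f n x"
  proof eventually_elim
    fix n assume n: "\<bar>\<Sum>k<n. (1 + M (Suc k) x) * (G (Suc k) x - G k x)\<bar> \<le> 1 / 4 * (1 + M n x)"
      "4 * (\<bar>f 0 x\<bar> + 1) \<le> 1 + M n x"
    define T where "T = (\<Sum>k<n. (1 + M (Suc k) x) * (G (Suc k) x - G k x))"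
    have eq: "f n x = f 0 x + M n x + T" unfolding T_def by (rule fn)
    have T: "\<bar>T\<bar> \<le> 1 / 4 * (1 + M n x)" unfolding T_def by (rule n(1))
    have arith: "(1 + m) / 2 \<le> a + m + t" if "\<bar>t\<bar> \<le> 1 / 4 * (1 + m)" "4 * (\<bar>a\<bar> + 1) \<le> 1 + m" for a m t :: real
      using that by (simp add: abs_if field_simps split: if_splits)
    show "(1 + M n x) / 2 \<le> f n x" unfolding eq by (rule arith[OF T n(2)])
  qed
qed

text \<open>The partial sums are at most \<open>Kc * M n x\<close>, so divergence makes the drift
  unbounded and the quotient is eventually at least \<open>1 / (2 * Kc)\<close>.\<close>

lemma liminf_pos:
  assumes x: "x \<in> \<Omega>" and c: "Cauchy (\<lambda>n. G n x)"
    and inf: "(\<Sum>k. ennreal (cexp \<Omega> F (Suc k) (\<lambda>y. \<bar>increment f (Suc k) y\<bar>) x)) = \<infinity>"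
  shows "0 < liminf (\<lambda>n. ereal (f n x / (\<Sum>k=1..n. cexp \<Omega> F k (\<lambda>y. \<bar>increment f k y\<bar>) x)))"
proof -
  let ?s = "\<lambda>n. \<Sum>k<n. cexp \<Omega> F (Suc k) (\<lambda>y. \<bar>increment f (Suc k) y\<bar>) x"
  have unb: "\<nexists>B. \<forall>n. M n x \<le> B" using suminf_cexp_finite[OF x] inf by auto
  \<comment> \<open>A vanishing denominator would give the quotient the value 0 by convention; from
    \<open>n0\<close> on it is positive.\<close>
  have "\<exists>n. 0 < ?s n"
  proof (rule ccontr)
    assume "\<not> ?thesis"
    then have s0: "?s n \<le> 0" for n by (auto simp: not_less)
    have "cexp \<Omega> F (Suc k) (\<lambda>y. \<bar>increment f (Suc k) y\<bar>) x = 0" for k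
    proof (rule antisym)
      have "0 \<le> ?s k" by (rule sum_nonneg) (rule cexp_nonneg[OF x])
      then show "cexp \<Omega> F (Suc k) (\<lambda>y. \<bar>increment f (Suc k) y\<bar>) x \<le> 0" using s0[of "Suc k"] by simp
    qed (rule cexp_nonneg[OF x])
    then show False using inf by simp
  qed
  then obtain n0 where n0: "0 < ?s n0" by blast
  have pos: "0 < ?s n" if "n0 \<le> n" for n
  proof -
    have "?s n0 \<le> ?s n" using that cexp_nonneg[OF x] by (intro sum_mono2) auto
    then show ?thesis using n0 by linarith
  qed
  have "\<forall>\<^sub>F n in sequentially. n0 \<le> n" by (rule eventually_ge_at_top)
  then have "\<forall>\<^sub>F n in sequentially. ereal (1 / (2 * Kc)) \<le> ereal (f n x / (\<Sum>k=1..n. cexp \<Omega> F k (\<lambda>y. \<bar>increment f k y\<bar>) x))"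
    using growth(2)[OF x c unb]
  proof eventually_elim
    fix n assume n: "n0 \<le> n" "(1 + M n x) / 2 \<le> f n x"
    have eq: "(\<Sum>k=1..n. cexp \<Omega> F k (\<lambda>y. \<bar>increment f k y\<bar>) x) = ?s n"
      by (simp add: sum.atLeast1_atMost_eq)
    have "?s n \<le> Kc * (1 + M n x)" using sum_cexp_le[OF x, of n] Kc_pos by (simp add: distrib_left)
    also have "\<dots> \<le> Kc * (2 * f n x)" using n(2) Kc_pos by (intro mult_left_mono) auto
    finally have "1 / (2 * Kc) \<le> f n x / ?s n" using Kc_pos pos[OF n(1)] by (simp add: field_simps)
    then show "ereal (1 / (2 * Kc)) \<le> ereal (f n x / (\<Sum>k=1..n. cexp \<Omega> F k (\<lambda>y. \<bar>increment f k y\<bar>) x))"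
      unfolding eq by simp
  qed
  then have "ereal (1 / (2 * Kc)) \<le> liminf (\<lambda>n. ereal (f n x / (\<Sum>k=1..n. cexp \<Omega> F k (\<lambda>y. \<bar>increment f k y\<bar>) x)))"
    by (rule Liminf_bounded)
  moreover have "0 < ereal (1 / (2 * Kc))" using Kc_pos by simp
  ultimately show ?thesis by (rule less_le_trans[rotated])
qed

lemma bounded_finite:
  assumes x: "x \<in> \<Omega>" and c: "Cauchy (\<lambda>n. G n x)" and bd: "\<And>n. \<bar>f n x\<bar> \<le> B"
  shows "(\<Sum>k. ennreal (cexp \<Omega> F (Suc k) (\<lambda>y. \<bar>increment f (Suc k) y\<bar>) x)) < \<infinity>"
proof (cases "\<exists>B. \<forall>n. M n x \<le> B")
  case True
  then obtain B where "\<And>n. M n x \<le> B" by blast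
  then show ?thesis by (rule suminf_cexp_finite[OF x])
next
  case False
  have "\<forall>\<^sub>F n in sequentially. 2 * B + 1 \<le> 1 + M n x"
    using growth(1)[OF x c False] unfolding filterlim_at_top by (rule spec)
  with growth(2)[OF x c False] have "\<forall>\<^sub>F n in sequentially. False"
  proof eventually_elim
    fix n assume n: "(1 + M n x) / 2 \<le> f n x" "2 * B + 1 \<le> 1 + M n x"
    have "(1 + M n x) / 2 \<le> B" using n(1) abs_le_D1[OF bd[of n]] by (rule order_trans)
    then show False using n(2) by simp
  qed
  then show ?thesis by simp
qed

end

section \<open>Choice of the parameters and conclusion\<close>

lemma (in sparse_smartingale) multiplied_exists:
  assumes "0 < \<epsilon>" "\<epsilon> \<le> 1 / 2"
  shows "\<exists>c \<phi> \<rho>. multiplied \<Omega> F c0 c4 S l0 f L c \<epsilon> \<phi> \<rho>"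
proof (rule multipliers_exist)
  fix c \<phi> \<rho>
  assume a: "0 < c" "\<And>k x. \<bar>\<phi> k x\<bar> \<le> (1::real)" "\<And>k. bdd_meas \<Omega> (\<phi> k)"
    "\<And>k x. \<not> active k \<Longrightarrow> x \<in> \<Omega> \<Longrightarrow> \<phi> k x = 0" "\<And>k x. \<not> active k \<Longrightarrow> x \<in> \<Omega> \<Longrightarrow> \<rho> k x = (0::real)"
    "\<And>k B x y. B \<in> At (Suc k + l) \<Longrightarrow> x \<in> B \<Longrightarrow> y \<in> B \<Longrightarrow> \<phi> k x = \<phi> k y"
    "\<And>k A x y. A \<in> At k \<Longrightarrow> x \<in> A \<Longrightarrow> y \<in> A \<Longrightarrow> \<rho> k x = \<rho> k y"
    "\<And>k A u. A \<in> At k \<Longrightarrow> u \<in> S2 \<Longrightarrow> Int_on A (\<lambda>x. \<phi> k x * u x) = 0"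
    "\<And>k x. x \<in> \<Omega> \<Longrightarrow> 0 \<le> \<rho> k x"
    "\<And>k A q y. A \<in> At k \<Longrightarrow> q \<in> S \<Longrightarrow> y \<in> A \<Longrightarrow> Int_on A (\<lambda>x. \<phi> k x * (D k x * q x)) = \<rho> k y * Int_on A q"
    "\<And>k A y. A \<in> At k \<Longrightarrow> y \<in> A \<Longrightarrow> c * Int_on A (\<lambda>x. \<bar>D k x\<bar>) \<le> \<rho> k y * vol A"
  have "multiplied \<Omega> F c0 c4 S l0 f L c \<epsilon> \<phi> \<rho>"
    by unfold_locales (fact a assms)+
  then show ?thesis by blast
qed

lemma (in atom_tree) multiplier_size_exists:
  fixes s :: real
  assumes "s < DIM('a)"
  shows "\<exists>\<epsilon>>0. \<epsilon> \<le> 1 / 2 \<and> (1 + \<epsilon>) * (1 - c1) powr (1 - s / DIM('a)) \<le> 1"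
proof -
  let ?p = "(1 - c1) powr (1 - s / DIM('a))"
  have "s / DIM('a) < 1" using assms by simp
  then have "?p < 1 powr (1 - s / DIM('a))" using c1_pos c1_less_1 by (intro powr_less_mono2) auto
  then have p: "0 < ?p" "?p < 1" using c1_less_1 by auto
  define \<epsilon> where "\<epsilon> = min (1/2) (1 / ?p - 1)"
  have "0 < \<epsilon>" unfolding \<epsilon>_def using p by simp
  moreover have "(1 + \<epsilon>) * ?p \<le> (1 / ?p) * ?p" using p unfolding \<epsilon>_def by (intro mult_right_mono) auto
  then have "(1 + \<epsilon>) * ?p \<le> 1" using p by simp
  moreover have "\<epsilon> \<le> 1 / 2" unfolding \<epsilon>_def by (rule min.cobounded1)
  ultimately show ?thesis by blast
qed

theorem theorem4p2:
  fixes \<Omega> :: "'a::euclidean_space set"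
    and F :: "nat \<Rightarrow> 'a measure"
    and S :: "('a \<Rightarrow> real) set"
    and f :: "nat \<Rightarrow> 'a \<Rightarrow> real"
    and c0 c4 L :: real
    and l0 :: nat
  assumes "convex \<Omega>" and "compact \<Omega>" and "measure lebesgue \<Omega> = 1"
    and "binary_filtration \<Omega> F"
    and "\<And>n A. A \<in> atoms (F n) \<Longrightarrow> convex A"
    and "(\<lambda>n. MAX A\<in>atoms (F n). diameter A) \<longlonglongrightarrow> 0"
    and "c4 > 0" and "\<And>n A. A \<in> atoms (F n) \<Longrightarrow> width A \<ge> c4 * diameter A"
    and "\<And>g. g \<in> S \<Longrightarrow> real_polynomial_function g"
    and "\<exists>B. finite B \<and> S = span B" and "(\<lambda>x. 1) \<in> S"
    and "\<And>k. k \<ge> l0 \<Longrightarrow> sign_resolving F S k"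
    and "c0 > 0"
    and "\<And>n A A' A''. A \<in> atoms (F n) \<Longrightarrow> siblings (F (Suc n)) A A' A''
           \<Longrightarrow> measure lebesgue A' \<ge> c0 * measure lebesgue A''"
    and "smartingale \<Omega> F S f"
    and "nu_sparse \<Omega> (sparsity_index S l0) f"
    and "\<And>n x. n \<ge> 1 \<Longrightarrow> x \<in> \<Omega> \<Longrightarrow> \<bar>increment f n x\<bar> \<le> L"
  shows
    "((\<forall>x\<in>\<Omega>. (\<Sum>k. ennreal (cexp \<Omega> F (Suc k) (\<lambda>y. \<bar>increment f (Suc k) y\<bar>) x)) = \<infinity>) \<longrightarrow>
        hausdorff_dim {x \<in> \<Omega>. liminf (\<lambda>n. ereal (f n x /
            (\<Sum>k=1..n. cexp \<Omega> F k (\<lambda>y. \<bar>increment f k y\<bar>) x))) > 0} = DIM('a))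
     \<and> ((\<exists>M. \<forall>n. \<forall>x\<in>\<Omega>. \<bar>f n x\<bar> \<le> M) \<longrightarrow>
        hausdorff_dim {x \<in> \<Omega>. (\<Sum>k. ennreal (cexp \<Omega> F (Suc k) (\<lambda>y. \<bar>increment f (Suc k) y\<bar>) x)) < \<infinity>}
          = DIM('a))"
proof -
  interpret sparse_smartingale \<Omega> F c0 c4 S l0 f L
    by unfold_locales (fact assms)+
  have dim: "hausdorff_dim T = DIM('a)"
    if "T \<subseteq> \<Omega>" "\<And>s::real. 0 < s \<Longrightarrow> s < DIM('a) \<Longrightarrow> hausdorff_measure s T \<noteq> 0" for T
    using hausdorff_dim_le[OF that(1)] hausdorff_dim_ge[OF _ that(2)] by (intro antisym) simp_all
  \<comment> \<open>\<open>\<epsilon>\<close> and all that is built from it depend on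
    \<open>s\<close>; hence \<open>T\<close> is required to contain the points of convergence for
    every choice of the parameters.\<close>
  have pos: "hausdorff_measure s T \<noteq> 0"
    if s: "0 < s" "s < DIM('a)"
      and T: "\<And>c \<epsilon> \<phi> \<rho> x. multiplied \<Omega> F c0 c4 S l0 f L c \<epsilon> \<phi> \<rho> \<Longrightarrow> x \<in> \<Omega>
        \<Longrightarrow> Cauchy (\<lambda>n. multiplied.G f \<epsilon> \<rho> n x) \<Longrightarrow> x \<in> T" for s :: real and T
  proof -
    obtain \<epsilon> where \<epsilon>: "0 < \<epsilon>" "\<epsilon> \<le> 1 / 2" "(1 + \<epsilon>) * (1 - c1) powr (1 - s / DIM('a)) \<le> 1"
      using multiplier_size_exists[OF s(2)] by blast
    obtain c \<phi> \<rho> where m: "multiplied \<Omega> F c0 c4 S l0 f L c \<epsilon> \<phi> \<rho>"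
      using multiplied_exists[OF \<epsilon>(1,2)] by blast
    then interpret m: multiplied \<Omega> F c0 c4 S l0 f L c \<epsilon> \<phi> \<rho> .
    have "{x \<in> \<Omega>. Cauchy (\<lambda>n. m.G n x)} \<subseteq> T" using T[OF m] by blast
    from hausdorff_measure_mono[OF this, of s] m.hausdorff_measure_convergence_set[OF s \<epsilon>(3)]
    show ?thesis by auto
  qed
  show ?thesis
  proof (intro conjI impI)
    assume inf: "\<forall>x\<in>\<Omega>. (\<Sum>k. ennreal (cexp \<Omega> F (Suc k) (\<lambda>y. \<bar>increment f (Suc k) y\<bar>) x)) = \<infinity>"
    show "hausdorff_dim {x \<in> \<Omega>. liminf (\<lambda>n. ereal (f n x /
            (\<Sum>k=1..n. cexp \<Omega> F k (\<lambda>y. \<bar>increment f k y\<bar>) x))) > 0} = DIM('a)"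
    proof (rule dim)
      fix s :: real assume s: "0 < s" "s < DIM('a)"
      show "hausdorff_measure s {x \<in> \<Omega>. liminf (\<lambda>n. ereal (f n x /
            (\<Sum>k=1..n. cexp \<Omega> F k (\<lambda>y. \<bar>increment f k y\<bar>) x))) > 0} \<noteq> 0"
        by (rule pos[OF s]) (use multiplied.liminf_pos inf in blast)
    qed blast
  next
    assume "\<exists>M. \<forall>n. \<forall>x\<in>\<Omega>. \<bar>f n x\<bar> \<le> M"
    then obtain K where K: "\<And>n x. x \<in> \<Omega> \<Longrightarrow> \<bar>f n x\<bar> \<le> K" by blast
    show "hausdorff_dim {x \<in> \<Omega>. (\<Sum>k. ennreal (cexp \<Omega> F (Suc k) (\<lambda>y. \<bar>increment f (Suc k) y\<bar>) x)) < \<infinity>} = DIM('a)"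
    proof (rule dim)
      fix s :: real assume s: "0 < s" "s < DIM('a)"
      show "hausdorff_measure s {x \<in> \<Omega>. (\<Sum>k. ennreal (cexp \<Omega> F (Suc k) (\<lambda>y. \<bar>increment f (Suc k) y\<bar>) x)) < \<infinity>} \<noteq> 0"
      proof (rule pos[OF s])
        fix c \<epsilon> \<phi> \<rho> x
        assume m: "multiplied \<Omega> F c0 c4 S l0 f L c \<epsilon> \<phi> \<rho>" and x: "x \<in> \<Omega>"
          and c: "Cauchy (\<lambda>n. multiplied.G f \<epsilon> \<rho> n x)"
        from multiplied.bounded_finite[OF m x c K[OF x]] x
        show "x \<in> {x \<in> \<Omega>. (\<Sum>k. ennreal (cexp \<Omega> F (Suc k) (\<lambda>y. \<bar>increment f (Suc k) y\<bar>) x)) < \<infinity>}"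
          by (intro CollectI conjI)
      qed
    qed blast
  qed
qed

end
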